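(* Let $G$ be a group. (1) The following are equivalent. (a) $G$ is abelian. (b) $\mathcal B(G)$ is Krull. (c) $\mathcal B(G)$ is completely integrally closed. (d) $\mathcal B(G)$ is root closed. (e) $\mathcal B(G)$ is weakly Krull. (f) $\mathcal B(G)$ is a transfer Krull monoid. (g) $\mathcal B(G)\subseteq\mathcal F(G)$ is saturated. (2) $\mathcal B(G)$ is seminormal if and only if $|G'|\le 2$. (3) $\mathcal B(G)$ is a C-monoid if and only if $\mathcal B(G)$ is a G-monoid if and only if $G$ is finite.
   Context: A monoid is a commutative cancellative semigroup with identity; $\mathsf q(H)$ is the quotient group of $H$ and $H^\times$ its group of units. $G'$ denotes the commutator subgroup of $G$. Sequences. $\mathcal F(G)$ is the free abelian monoid with basis $G$ (a multiplicative group), with operation $\boldsymbol{\cdot}$. For $S=g_1\boldsymbol{\cdot}\ldots\boldsymbol{\cdot}g_\ell\in\mathcal F(G)$ let $\pi(S)=\{g_{\sigma(1)}\cdots g_{\sigma(\ell)}\in G:\sigma\text{ a permutation of }[1,\ell]\}$ (with $\pi=\{1_G\}$ for the empty sequence). $\mathcal B(G)=\{S\in\mathcal F(G):1_G\in\pi(S)\}$, the monoid of product-one sequences over $G$. Monoid properties. For a monoid $H$: $H'=\{x\in\mathsf q(H):\exists n\in\mathbb N\ \forall m\ge n\ x^m\in H\}$, $\widetilde H=\{x\in\mathsf q(H):\exists n\in\mathbb N\ x^n\in H\}$, $\widehat H=\{x\in\mathsf q(H):\exists c\in H\ \forall n\in\mathbb N\ cx^n\in H\}$. $H$ is seminormal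 / root closed / completely integrally closed if $H=H'$ / $H=\widetilde H$ / $H=\widehat H$. For $X\subseteq\mathsf q(H)$ let $(H:X)=\{y\in\mathsf q(H):yX\subseteq H\}$ and $X_v=(H:(H:X))$; a $v$-ideal is $X\subseteq H$ with $X_v=X$; $H$ is $v$-noetherian if it satisfies the ascending chain condition on $v$-ideals; $H$ is Krull if it is completely integrally closed and $v$-noetherian. An $s$-ideal is $X\subseteq H$ with $XH=X$; $\mathfrak X(H)$ is the set of minimal nonempty prime $s$-ideals of $H$; for a prime $s$-ideal $\mathfrak p$, $H_{\mathfrak p}=\{s_1/s_2\in\mathsf q(H): s_1\in H, s_2\in H\setminus\mathfrak p\}$. $H$ is weakly Krull if $H=\bigcap_{\mathfrak p\in\mathfrak X(H)}H_{\mathfrak p}$ (an empty intersection being $\mathsf q(H)$) and $\{\mathfrak p\in\mathfrak X(H):a\in\mathfrak p\}$ is finite for all $a\in H$. A submonoid $H\subseteq D$ is saturated if for $a,b\in H$, $a\mid_D b$ implies $a\mid_H b$ (equivalently $\mathsf q(H)\cap D=H$). A monoid homomorphism $\theta:H\to D$ is a transfer homomorphism if (T1) $D=\theta(H)D^\times$ and $\theta^{-1}(D^\times)=H^\times$; (T2) whenever $u\in H$, $b,c\in D$ and $\theta(u)=bc$, there are $v,w\in H$ with $u=vw$, $\theta(v)\simeq b$, $\theta(w)\simeq c$, where $\simeq$ means equal up to multiplication by a unit of $D$. $H$ is transfer Krull if there is a transfer homomorphism from $H$ into a Krull monoid. $H$ is a G-monoid if there is $a\in H$ such that every element of $H$ divides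 (in $H$) some power of $a$. For a submonoid $H\subseteq F$, elements $y,y'\in F$ are $H$-equivalent if for all $x\in F$: $yx\in H\iff y'x\in H$; $\mathcal C^*(H,F)$ is the set of $H$-equivalence classes of elements of $(F\setminus F^\times)\cup\{1_F\}$. $H$ is a C-monoid if it is a submonoid of some factorial monoid $F$ with $H^\times=H\cap F^\times$ and $\mathcal C^*(H,F)$ finite. *)

theory Defs
  imports "HOL-Algebra.Algebra"
begin

text \<open>
  A monoid in the sense of factorization theory is a \<^locale>\<open>comm_monoid_cancel\<close>, and exponents
  are positive integers, hence the guards \<^term>\<open>(0::nat) < n\<close>, without which the root closure
  would be the whole quotient group.
\<close>

section \<open>The quotient group\<close>

definition fraction_rel :: "('a, 'b) monoid_scheme \<Rightarrow> (('a \<times> 'a) \<times> ('a \<times> 'a)) set" where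
  "fraction_rel H = {((a, s), (b, t)). a \<in> carrier H \<and> s \<in> carrier H \<and> b \<in> carrier H \<and> t \<in> carrier H
                    \<and> a \<otimes>\<^bsub>H\<^esub> t = b \<otimes>\<^bsub>H\<^esub> s}"

definition fraction :: "('a, 'b) monoid_scheme \<Rightarrow> 'a \<Rightarrow> 'a \<Rightarrow> ('a \<times> 'a) set" where
  "fraction H a s = fraction_rel H `` {(a, s)}"

definition quotient_group :: "('a, 'b) monoid_scheme \<Rightarrow> ('a \<times> 'a) set monoid" where
  "quotient_group H =
     \<lparr>carrier = (carrier H \<times> carrier H) // fraction_rel H,
      monoid.mult = (\<lambda>A B. \<Union>(a, s)\<in>A. \<Union>(b, t)\<in>B. fraction H (a \<otimes>\<^bsub>H\<^esub> b) (s \<otimes>\<^bsub>H\<^esub> t)),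
      one = fraction H \<one>\<^bsub>H\<^esub> \<one>\<^bsub>H\<^esub>\<rparr>"

definition to_quotient :: "('a, 'b) monoid_scheme \<Rightarrow> 'a \<Rightarrow> ('a \<times> 'a) set" where
  "to_quotient H a = fraction H a \<one>\<^bsub>H\<^esub>"

text \<open>The copy of \<^term>\<open>H\<close> inside its quotient group.\<close>

definition embedded :: "('a, 'b) monoid_scheme \<Rightarrow> ('a \<times> 'a) set set" where
  "embedded H = to_quotient H ` carrier H"

context comm_monoid_cancel
begin

lemma equiv_fraction_rel: "equiv (carrier G \<times> carrier G) (fraction_rel G)"
proof (rule equivI)
  show "fraction_rel G \<subseteq> (carrier G \<times> carrier G) \<times> (carrier G \<times> carrier G)"
    by (auto simp: fraction_rel_def)
  show "refl_on (carrier G \<times> carrier G) (fraction_rel G)"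
    by (auto simp: fraction_rel_def refl_on_def)
  show "sym (fraction_rel G)"
    by (auto simp: fraction_rel_def sym_def)
  show "trans (fraction_rel G)"
  proof (rule transI, clarsimp simp: fraction_rel_def)
    fix a s b t c u
    assume c: "a \<in> carrier G" "s \<in> carrier G" "b \<in> carrier G" "t \<in> carrier G"
      "c \<in> carrier G" "u \<in> carrier G"
      and e: "a \<otimes> t = b \<otimes> s" "b \<otimes> u = c \<otimes> t"
    have "(a \<otimes> u) \<otimes> t = (a \<otimes> t) \<otimes> u" using c by (simp add: m_ac)
    also have "\<dots> = (b \<otimes> u) \<otimes> s" using c e(1) by (simp add: m_ac)
    also have "\<dots> = (c \<otimes> s) \<otimes> t" using c e(2) by (simp add: m_ac)
    finally show "a \<otimes> u = c \<otimes> s" using c r_cancel by blast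
  qed
qed

lemma fraction_eq_iff:
  assumes "a \<in> carrier G" "s \<in> carrier G" "b \<in> carrier G" "t \<in> carrier G"
  shows "fraction G a s = fraction G b t \<longleftrightarrow> a \<otimes> t = b \<otimes> s"
  using eq_equiv_class_iff[OF equiv_fraction_rel, of "(a, s)" "(b, t)"] assms
  by (auto simp: fraction_def fraction_rel_def)

lemma carrier_quotient_group:
  "carrier (quotient_group G) = {fraction G a s | a s. a \<in> carrier G \<and> s \<in> carrier G}"
  by (fastforce simp: quotient_group_def quotient_def fraction_def)

lemma fraction_closed:
  "a \<in> carrier G \<Longrightarrow> s \<in> carrier G \<Longrightarrow> fraction G a s \<in> carrier (quotient_group G)"
  by (auto simp: carrier_quotient_group)

lemma mult_fraction:
  assumes c: "a \<in> carrier G" "s \<in> carrier G" "b \<in> carrier G" "t \<in> carrier G"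
  shows "fraction G a s \<otimes>\<^bsub>quotient_group G\<^esub> fraction G b t = fraction G (a \<otimes> b) (s \<otimes> t)"
proof -
  have in1: "(a, s) \<in> fraction G a s" "(b, t) \<in> fraction G b t"
    using c by (auto simp: fraction_def fraction_rel_def)
  have eq: "fraction G (a' \<otimes> b') (s' \<otimes> t') = fraction G (a \<otimes> b) (s \<otimes> t)"
    if "(a', s') \<in> fraction G a s" "(b', t') \<in> fraction G b t" for a' s' b' t'
  proof -
    from that have c': "a' \<in> carrier G" "s' \<in> carrier G" "b' \<in> carrier G" "t' \<in> carrier G"
      and e: "a \<otimes> s' = a' \<otimes> s" "b \<otimes> t' = b' \<otimes> t"
      by (auto simp: fraction_def fraction_rel_def)
    have "(a' \<otimes> b') \<otimes> (s \<otimes> t) = (a' \<otimes> s) \<otimes> (b' \<otimes> t)" using c c' by (simp add: m_ac)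
    also have "\<dots> = (a \<otimes> s') \<otimes> (b \<otimes> t')" by (simp only: e)
    also have "\<dots> = (a \<otimes> b) \<otimes> (s' \<otimes> t')" using c c' by (simp add: m_ac)
    finally show ?thesis using c c' by (simp add: fraction_eq_iff)
  qed
  have "fraction G a s \<otimes>\<^bsub>quotient_group G\<^esub> fraction G b t =
      (\<Union>(a', s')\<in>fraction G a s. \<Union>(b', t')\<in>fraction G b t. fraction G (a' \<otimes> b') (s' \<otimes> t'))"
    by (simp add: quotient_group_def)
  also have "\<dots> = (\<Union>(a', s')\<in>fraction G a s. \<Union>(b', t')\<in>fraction G b t. fraction G (a \<otimes> b) (s \<otimes> t))"
    using eq by (intro SUP_cong refl) (auto split: prod.split)
  also have "\<dots> = fraction G (a \<otimes> b) (s \<otimes> t)"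
    using in1 by auto
  finally show ?thesis .
qed

lemma one_quotient_group: "\<one>\<^bsub>quotient_group G\<^esub> = fraction G \<one> \<one>"
  by (simp add: quotient_group_def)

lemma comm_group_quotient_group: "comm_group (quotient_group G)"
proof (rule comm_groupI)
  show "\<one>\<^bsub>quotient_group G\<^esub> \<in> carrier (quotient_group G)"
    by (simp add: one_quotient_group fraction_closed)
next
  fix x y assume "x \<in> carrier (quotient_group G)" "y \<in> carrier (quotient_group G)"
  then obtain a s b t where xy: "x = fraction G a s" "y = fraction G b t"
    "a \<in> carrier G" "s \<in> carrier G" "b \<in> carrier G" "t \<in> carrier G"
    unfolding carrier_quotient_group by blast
  show "x \<otimes>\<^bsub>quotient_group G\<^esub> y \<in> carrier (quotient_group G)"
    using xy by (simp add: mult_fraction fraction_closed)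
  show "x \<otimes>\<^bsub>quotient_group G\<^esub> y = y \<otimes>\<^bsub>quotient_group G\<^esub> x"
    using xy by (simp add: mult_fraction m_comm)
next
  fix x y z
  assume "x \<in> carrier (quotient_group G)" "y \<in> carrier (quotient_group G)"
    "z \<in> carrier (quotient_group G)"
  then obtain a s b t c u where "x = fraction G a s" "y = fraction G b t" "z = fraction G c u"
    "a \<in> carrier G" "s \<in> carrier G" "b \<in> carrier G" "t \<in> carrier G" "c \<in> carrier G" "u \<in> carrier G"
    unfolding carrier_quotient_group by blast
  then show "x \<otimes>\<^bsub>quotient_group G\<^esub> y \<otimes>\<^bsub>quotient_group G\<^esub> z =
      x \<otimes>\<^bsub>quotient_group G\<^esub> (y \<otimes>\<^bsub>quotient_group G\<^esub> z)"
    by (simp add: mult_fraction m_assoc)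
next
  fix x assume "x \<in> carrier (quotient_group G)"
  then obtain a s where x: "x = fraction G a s" "a \<in> carrier G" "s \<in> carrier G"
    unfolding carrier_quotient_group by blast
  show "\<one>\<^bsub>quotient_group G\<^esub> \<otimes>\<^bsub>quotient_group G\<^esub> x = x"
    using x by (simp add: mult_fraction one_quotient_group)
  have "fraction G s a \<otimes>\<^bsub>quotient_group G\<^esub> x = \<one>\<^bsub>quotient_group G\<^esub>"
    using x by (simp add: mult_fraction one_quotient_group fraction_eq_iff m_comm)
  then show "\<exists>y\<in>carrier (quotient_group G). y \<otimes>\<^bsub>quotient_group G\<^esub> x = \<one>\<^bsub>quotient_group G\<^esub>"
    using x fraction_closed by blast
qed

lemma to_quotient_hom: "to_quotient G \<in> hom G (quotient_group G)"
  by (auto simp: hom_def to_quotient_def fraction_closed mult_fraction)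

lemma inj_on_to_quotient: "inj_on (to_quotient G) (carrier G)"
  by (auto simp: inj_on_def to_quotient_def fraction_eq_iff)

end

section \<open>Closure properties\<close>

definition seminormal :: "('a, 'b) monoid_scheme \<Rightarrow> bool" where
  "seminormal H \<longleftrightarrow>
     embedded H = {x \<in> carrier (quotient_group H).
       \<exists>n::nat. 0 < n \<and> (\<forall>m\<ge>n. x [^]\<^bsub>quotient_group H\<^esub> m \<in> embedded H)}"

definition root_closed :: "('a, 'b) monoid_scheme \<Rightarrow> bool" where
  "root_closed H \<longleftrightarrow>
     embedded H = {x \<in> carrier (quotient_group H).
       \<exists>n::nat. 0 < n \<and> x [^]\<^bsub>quotient_group H\<^esub> n \<in> embedded H}"

definition completely_integrally_closed :: "('a, 'b) monoid_scheme \<Rightarrow> bool" where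
  "completely_integrally_closed H \<longleftrightarrow>
     embedded H = {x \<in> carrier (quotient_group H).
       \<exists>c\<in>embedded H. \<forall>n::nat. 0 < n \<longrightarrow>
         c \<otimes>\<^bsub>quotient_group H\<^esub> (x [^]\<^bsub>quotient_group H\<^esub> n) \<in> embedded H}"

section \<open>Krull monoids\<close>

definition colon :: "('a, 'b) monoid_scheme \<Rightarrow> ('a \<times> 'a) set set \<Rightarrow> ('a \<times> 'a) set set" where
  "colon H A = {y \<in> carrier (quotient_group H). \<forall>x\<in>A. y \<otimes>\<^bsub>quotient_group H\<^esub> x \<in> embedded H}"

definition v_ideal :: "('a, 'b) monoid_scheme \<Rightarrow> ('a \<times> 'a) set set \<Rightarrow> bool" where
  "v_ideal H A \<longleftrightarrow> A \<subseteq> embedded H \<and> colon H (colon H A) = A"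

definition v_noetherian :: "('a, 'b) monoid_scheme \<Rightarrow> bool" where
  "v_noetherian H \<longleftrightarrow>
     (\<forall>I :: nat \<Rightarrow> ('a \<times> 'a) set set.
        (\<forall>n. v_ideal H (I n) \<and> I n \<subseteq> I (Suc n)) \<longrightarrow> (\<exists>N. \<forall>n\<ge>N. I n = I N))"

definition krull_monoid :: "('a, 'b) monoid_scheme \<Rightarrow> bool" where
  "krull_monoid H \<longleftrightarrow> comm_monoid_cancel H \<and> completely_integrally_closed H \<and> v_noetherian H"

section \<open>Weakly Krull monoids\<close>

definition s_ideal :: "('a, 'b) monoid_scheme \<Rightarrow> 'a set \<Rightarrow> bool" where
  "s_ideal H A \<longleftrightarrow> A \<subseteq> carrier H \<and> A <#>\<^bsub>H\<^esub> carrier H = A"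

definition prime_s_ideal :: "('a, 'b) monoid_scheme \<Rightarrow> 'a set \<Rightarrow> bool" where
  "prime_s_ideal H P \<longleftrightarrow> s_ideal H P \<and> P \<noteq> carrier H \<and>
     (\<forall>a\<in>carrier H. \<forall>b\<in>carrier H. a \<otimes>\<^bsub>H\<^esub> b \<in> P \<longrightarrow> a \<in> P \<or> b \<in> P)"

definition min_primes :: "('a, 'b) monoid_scheme \<Rightarrow> 'a set set" where
  "min_primes H = {P. prime_s_ideal H P \<and> P \<noteq> {} \<and>
     (\<forall>Q. prime_s_ideal H Q \<and> Q \<noteq> {} \<and> Q \<subseteq> P \<longrightarrow> Q = P)}"

definition localization_at :: "('a, 'b) monoid_scheme \<Rightarrow> 'a set \<Rightarrow> ('a \<times> 'a) set set" where
  "localization_at H P = {fraction H a s | a s. a \<in> carrier H \<and> s \<in> carrier H - P}"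

definition weakly_krull :: "('a, 'b) monoid_scheme \<Rightarrow> bool" where
  "weakly_krull H \<longleftrightarrow>
     embedded H = carrier (quotient_group H) \<inter> (\<Inter>P\<in>min_primes H. localization_at H P) \<and>
     (\<forall>a\<in>carrier H. finite {P \<in> min_primes H. a \<in> P})"

section \<open>Saturated submonoids\<close>

definition saturated_submonoid :: "'a set \<Rightarrow> ('a, 'b) monoid_scheme \<Rightarrow> bool" where
  "saturated_submonoid A D \<longleftrightarrow> submonoid A D \<and>
     (\<forall>a\<in>A. \<forall>b\<in>A. a divides\<^bsub>D\<^esub> b \<longrightarrow> a divides\<^bsub>D\<lparr>carrier := A\<rparr>\<^esub> b)"

section \<open>Transfer Krull monoids\<close>

definition equal_up_to_unit :: "('a, 'b) monoid_scheme \<Rightarrow> 'a \<Rightarrow> 'a \<Rightarrow> bool" where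
  "equal_up_to_unit D x y \<longleftrightarrow> (\<exists>e\<in>Units D. x = y \<otimes>\<^bsub>D\<^esub> e)"

definition transfer_hom :: "('a, 'b) monoid_scheme \<Rightarrow> ('c, 'd) monoid_scheme \<Rightarrow> ('a \<Rightarrow> 'c) \<Rightarrow> bool" where
  "transfer_hom H D \<theta> \<longleftrightarrow>
     \<theta> \<in> hom H D \<and> \<theta> \<one>\<^bsub>H\<^esub> = \<one>\<^bsub>D\<^esub> \<and>
     carrier D = (\<theta> ` carrier H) <#>\<^bsub>D\<^esub> Units D \<and>
     {u \<in> carrier H. \<theta> u \<in> Units D} = Units H \<and>
     (\<forall>u\<in>carrier H. \<forall>b\<in>carrier D. \<forall>c\<in>carrier D. \<theta> u = b \<otimes>\<^bsub>D\<^esub> c \<longrightarrow>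
        (\<exists>v\<in>carrier H. \<exists>w\<in>carrier H. u = v \<otimes>\<^bsub>H\<^esub> w \<and>
           equal_up_to_unit D (\<theta> v) b \<and> equal_up_to_unit D (\<theta> w) c))"

text \<open>
  HOL cannot quantify over types inside a formula, so the type of the elements of the target
  monoid is a parameter. That \<open>H\<close> is transfer Krull, with no restriction on the target, is asserted
  by \<open>transfer_krull TYPE('d) H\<close> for a particular \<open>'d\<close>, and it is used as a hypothesis in full
  generality by assuming \<open>transfer_krull TYPE('d) H\<close> with \<open>'d\<close> a free type variable.
\<close>

definition transfer_krull :: "'d itself \<Rightarrow> ('a, 'b) monoid_scheme \<Rightarrow> bool" where
  "transfer_krull _ H \<longleftrightarrow> (\<exists>(D :: 'd monoid) \<theta>. krull_monoid D \<and> transfer_hom H D \<theta>)"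

section \<open>G-monoids and C-monoids\<close>

definition G_monoid :: "('a, 'b) monoid_scheme \<Rightarrow> bool" where
  "G_monoid H \<longleftrightarrow> (\<exists>a\<in>carrier H. \<forall>b\<in>carrier H. \<exists>n::nat. b divides\<^bsub>H\<^esub> (a [^]\<^bsub>H\<^esub> n))"

definition submonoid_equiv :: "'f set \<Rightarrow> ('f, 'b) monoid_scheme \<Rightarrow> 'f \<Rightarrow> 'f \<Rightarrow> bool" where
  "submonoid_equiv A F y y' \<longleftrightarrow> (\<forall>x\<in>carrier F. y \<otimes>\<^bsub>F\<^esub> x \<in> A \<longleftrightarrow> y' \<otimes>\<^bsub>F\<^esub> x \<in> A)"

definition reduced_class_set :: "'f set \<Rightarrow> ('f, 'b) monoid_scheme \<Rightarrow> 'f set set" where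
  "reduced_class_set A F =
     (\<lambda>y. {y' \<in> carrier F. submonoid_equiv A F y y'}) ` ((carrier F - Units F) \<union> {\<one>\<^bsub>F\<^esub>})"

text \<open>
  As for \<^const>\<open>transfer_krull\<close>, the type of the elements of the factorial monoid is a parameter;
  hence \<open>H\<close> is a submonoid of \<open>F\<close> by means of an injective monoid homomorphism.
\<close>

definition C_monoid :: "'f itself \<Rightarrow> ('a, 'b) monoid_scheme \<Rightarrow> bool" where
  "C_monoid _ H \<longleftrightarrow>
     (\<exists>(F :: 'f monoid) \<iota>. factorial_monoid F \<and>
        \<iota> \<in> hom H F \<and> \<iota> \<one>\<^bsub>H\<^esub> = \<one>\<^bsub>F\<^esub> \<and> inj_on \<iota> (carrier H) \<and>
        \<iota> ` Units H = \<iota> ` carrier H \<inter> Units F \<and>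
        finite (reduced_class_set (\<iota> ` carrier H) F))"

section \<open>Product-one sequences\<close>

definition free_abelian_monoid :: "('a, 'b) monoid_scheme \<Rightarrow> 'a multiset monoid" where
  "free_abelian_monoid G = \<lparr>carrier = {S. set_mset S \<subseteq> carrier G}, monoid.mult = (+), one = {#}\<rparr>"

definition products :: "('a, 'b) monoid_scheme \<Rightarrow> 'a multiset \<Rightarrow> 'a set" where
  "products G S = {foldr (\<otimes>\<^bsub>G\<^esub>) gs \<one>\<^bsub>G\<^esub> | gs. mset gs = S}"

definition product_one_sequences :: "('a, 'b) monoid_scheme \<Rightarrow> 'a multiset set" where
  "product_one_sequences G = {S \<in> carrier (free_abelian_monoid G). \<one>\<^bsub>G\<^esub> \<in> products G S}"

definition product_one_monoid :: "('a, 'b) monoid_scheme \<Rightarrow> 'a multiset monoid" where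
  "product_one_monoid G = (free_abelian_monoid G)\<lparr>carrier := product_one_sequences G\<rparr>"

context monoid
begin

lemma foldr_mult_closed: "set gs \<subseteq> carrier G \<Longrightarrow> foldr (\<otimes>) gs \<one> \<in> carrier G"
  by (induction gs) auto

lemma foldr_mult_append:
  "set gs \<subseteq> carrier G \<Longrightarrow> set hs \<subseteq> carrier G \<Longrightarrow>
   foldr (\<otimes>) (gs @ hs) \<one> = foldr (\<otimes>) gs \<one> \<otimes> foldr (\<otimes>) hs \<one>"
  by (induction gs) (auto simp: foldr_mult_closed m_assoc simp del: foldr_append)

lemma comm_monoid_cancel_free_abelian_monoid: "comm_monoid_cancel (free_abelian_monoid G)"
  by (intro comm_monoid_cancelI comm_monoidI) (auto simp: free_abelian_monoid_def)

lemma submonoid_product_one_sequences: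
  "submonoid (product_one_sequences G) (free_abelian_monoid G)"
proof
  fix S T
  assume "S \<in> product_one_sequences G" "T \<in> product_one_sequences G"
  then obtain gs hs where "mset gs = S" "mset hs = T" "set gs \<subseteq> carrier G" "set hs \<subseteq> carrier G"
    "foldr (\<otimes>) gs \<one> = \<one>" "foldr (\<otimes>) hs \<one> = \<one>"
    by (auto simp: product_one_sequences_def products_def free_abelian_monoid_def)
  then have "mset (gs @ hs) = S + T" "foldr (\<otimes>) (gs @ hs) \<one> = \<one>"
    "set_mset (S + T) \<subseteq> carrier G"
    by (auto simp: foldr_mult_append simp del: foldr_append)
  then show "S \<otimes>\<^bsub>free_abelian_monoid G\<^esub> T \<in> product_one_sequences G"
    unfolding product_one_sequences_def products_def free_abelian_monoid_def
    by (simp, metis)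
qed (auto simp: product_one_sequences_def products_def free_abelian_monoid_def)

lemma comm_monoid_cancel_product_one_monoid: "comm_monoid_cancel (product_one_monoid G)"
proof -
  interpret submonoid "product_one_sequences G" "free_abelian_monoid G"
    by (rule submonoid_product_one_sequences)
  show ?thesis
    using m_closed one_closed
    by (intro comm_monoid_cancelI comm_monoidI)
       (auto simp: product_one_monoid_def free_abelian_monoid_def)
qed

end

end

theory Submission
  imports Defs
begin

text \<open>
  If \<open>k = [g, h] \<noteq> 1\<close>, then the letter \<open>k\<close> is the quotient of the product-one sequences
  \<open>k \<cdot> g \<cdot> h \<cdot> g\<^sup>-\<^sup>1 \<cdot> h\<^sup>-\<^sup>1\<close> and \<open>g \<cdot> h \<cdot> g\<^sup>-\<^sup>1 \<cdot> h\<^sup>-\<^sup>1\<close> without having product one. This refutes saturation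
  and, as minimal primes are the sets of sequences containing a fixed letter and the four letters
  can be split to avoid it, weak Krullness. The quotient \<open>x = g \<cdot> (h g h\<^sup>-\<^sup>1)\<^sup>-\<^sup>1\<close> satisfies
  \<open>h \<cdot> h\<^sup>-\<^sup>1 \<cdot> x\<^sup>n \<in> \<B>\<close> for all \<open>n\<close>, which refutes complete integral closure; a transfer homomorphism to a
  Krull monoid would have to send \<open>x\<close> to a unit, and with it the nonempty sequence
  \<open>g \<cdot> g\<^sup>-\<^sup>1 \<cdot> h g h\<^sup>-\<^sup>1 \<cdot> (h g h\<^sup>-\<^sup>1)\<^sup>-\<^sup>1\<close>.

  Seminormality is tested on sequences \<open>S\<close> such that all large powers of \<open>S\<close> have product one.
  Suitable sequences of three or four letters show in turn that any two elements \<open>g\<close>, \<open>h\<close> satisfy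
  \<open>[g, h\<^sup>2] = 1\<close> or \<open>[g, h\<^sup>3] = 1\<close>, that commutators are involutions, that they are central, and that at
  most one of them is nontrivial. If the monoid is root closed, the involution itself is a root of \<open>1\<close>.

  For finite \<open>G\<close>, a letter \<open>g\<close> of high multiplicity can be cancelled \<open>|G|\<close> times by the pigeonhole
  principle, so there are finitely many classes. Conversely, finitely many classes give a common
  denominator \<open>T\<close> for all quotients lying in the factorial monoid. Applied to \<open>x\<close>, this bounds the
  conjugacy classes of \<open>G\<close>; then commutators have finite order by Dietzmann's argument, and \<open>T\<close>
  applied to the letters \<open>k\<close> makes the set of commutators, hence \<open>G'\<close>, finite. Finally every letter \<open>g\<close>
  is represented by a divisor \<open>p\<^sub>g\<close> in the factorial monoid, and \<open>p\<^sub>g\<close>, \<open>p\<^sub>h\<close> can only be equivalent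
  when \<open>g\<close> and \<open>h\<close> agree modulo \<open>G'\<close>.
\<close>

section \<open>Fractions\<close>

text \<open>Reduces the set equation that defines a closure property to the one inclusion with
  content.\<close>

lemma eq_restriction_iff:
  assumes "A \<subseteq> C" "\<And>x. x \<in> A \<Longrightarrow> P x"
  shows "A = {x \<in> C. P x} \<longleftrightarrow> (\<forall>x\<in>C. P x \<longrightarrow> x \<in> A)"
  using assms by blast

context comm_monoid_cancel
begin

lemma fraction_in_embedded_iff:
  assumes "a \<in> carrier G" "s \<in> carrier G"
  shows "fraction G a s \<in> embedded G \<longleftrightarrow> (\<exists>c\<in>carrier G. a = c \<otimes> s)"
  using assms by (auto simp: embedded_def to_quotient_def fraction_eq_iff image_iff)

lemma pow_fraction:
  assumes "a \<in> carrier G" "s \<in> carrier G"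
  shows "fraction G a s [^]\<^bsub>quotient_group G\<^esub> (n::nat) = fraction G (a [^] n) (s [^] n)"
proof -
  interpret Q: comm_group "quotient_group G" by (rule comm_group_quotient_group)
  show ?thesis
    using assms by (induction n) (simp_all add: one_quotient_group mult_fraction)
qed

lemma ball_quotient_group:
  "(\<forall>x\<in>carrier (quotient_group G). P x) \<longleftrightarrow>
   (\<forall>a\<in>carrier G. \<forall>s\<in>carrier G. P (fraction G a s))"
  unfolding carrier_quotient_group by blast

lemma to_quotient_mult_fraction:
  assumes "c \<in> carrier G" "a \<in> carrier G" "s \<in> carrier G"
  shows "to_quotient G c \<otimes>\<^bsub>quotient_group G\<^esub> fraction G a s = fraction G (c \<otimes> a) s"
  using assms by (simp add: to_quotient_def mult_fraction)

lemma embedded_subset: "embedded G \<subseteq> carrier (quotient_group G)"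
  by (auto simp: embedded_def to_quotient_def fraction_closed)

lemma embedded_closed_pow: "x \<in> embedded G \<Longrightarrow> x [^]\<^bsub>quotient_group G\<^esub> (n::nat) \<in> embedded G"
  by (force simp: embedded_def to_quotient_def pow_fraction)

text \<open>For a quotient \<open>a/s\<close>, a power lies in the embedded copy exactly if that
  power of \<open>s\<close> divides the same power of \<open>a\<close>. This turns the condition on
  the quotient group into divisibility inside the monoid; the next two closure properties are
  treated alike.\<close>

lemma seminormal_iff:
  "seminormal G \<longleftrightarrow> (\<forall>a\<in>carrier G. \<forall>s\<in>carrier G.
     (\<exists>n::nat. 0 < n \<and> (\<forall>m\<ge>n. \<exists>c\<in>carrier G. a [^] m = c \<otimes> s [^] m)) \<longrightarrow>
     (\<exists>c\<in>carrier G. a = c \<otimes> s))"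
proof -
  have "seminormal G \<longleftrightarrow> (\<forall>x\<in>carrier (quotient_group G).
      (\<exists>n::nat. 0 < n \<and> (\<forall>m\<ge>n. x [^]\<^bsub>quotient_group G\<^esub> m \<in> embedded G)) \<longrightarrow> x \<in> embedded G)"
    using embedded_subset embedded_closed_pow by (auto simp: seminormal_def)
  then show ?thesis
    by (simp add: ball_quotient_group pow_fraction fraction_in_embedded_iff)
qed

lemma root_closed_iff:
  "root_closed G \<longleftrightarrow> (\<forall>a\<in>carrier G. \<forall>s\<in>carrier G.
     (\<exists>n::nat. 0 < n \<and> (\<exists>c\<in>carrier G. a [^] n = c \<otimes> s [^] n)) \<longrightarrow>
     (\<exists>c\<in>carrier G. a = c \<otimes> s))"
proof -
  have "root_closed G \<longleftrightarrow> (\<forall>x\<in>carrier (quotient_group G).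
      (\<exists>n::nat. 0 < n \<and> x [^]\<^bsub>quotient_group G\<^esub> n \<in> embedded G) \<longrightarrow> x \<in> embedded G)"
    using embedded_subset embedded_closed_pow by (auto simp: root_closed_def)
  then show ?thesis
    by (simp add: ball_quotient_group pow_fraction fraction_in_embedded_iff)
qed

lemma completely_integrally_closed_iff:
  "completely_integrally_closed G \<longleftrightarrow> (\<forall>a\<in>carrier G. \<forall>s\<in>carrier G.
     (\<exists>d\<in>carrier G. \<forall>n::nat. 0 < n \<longrightarrow> (\<exists>c\<in>carrier G. d \<otimes> a [^] n = c \<otimes> s [^] n)) \<longrightarrow>
     (\<exists>c\<in>carrier G. a = c \<otimes> s))"
proof -
  interpret Q: comm_group "quotient_group G" by (rule comm_group_quotient_group)
  have "completely_integrally_closed G \<longleftrightarrow> (\<forall>x\<in>carrier (quotient_group G).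
      (\<exists>d\<in>carrier G. \<forall>n::nat. 0 < n \<longrightarrow>
        to_quotient G d \<otimes>\<^bsub>quotient_group G\<^esub> x [^]\<^bsub>quotient_group G\<^esub> n \<in> embedded G) \<longrightarrow>
      x \<in> embedded G)"
  proof -
    have in_closure: "\<exists>d\<in>carrier G. \<forall>n::nat. 0 < n \<longrightarrow>
        to_quotient G d \<otimes>\<^bsub>quotient_group G\<^esub> x [^]\<^bsub>quotient_group G\<^esub> n \<in> embedded G"
      if "x \<in> embedded G" for x
    proof (intro bexI[of _ \<one>] allI impI)
      fix n :: nat
      have "to_quotient G \<one> = \<one>\<^bsub>quotient_group G\<^esub>"
        by (simp add: to_quotient_def one_quotient_group)
      then show "to_quotient G \<one> \<otimes>\<^bsub>quotient_group G\<^esub> x [^]\<^bsub>quotient_group G\<^esub> n \<in> embedded G"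
        using embedded_closed_pow[OF that, of n] embedded_subset by auto
    qed simp
    have bex: "(\<exists>c\<in>embedded G. P c) \<longleftrightarrow> (\<exists>d\<in>carrier G. P (to_quotient G d))" for P
      by (simp add: embedded_def)
    show ?thesis
      unfolding completely_integrally_closed_def bex
      by (rule eq_restriction_iff[OF embedded_subset in_closure])
  qed
  then show ?thesis
    by (simp add: ball_quotient_group pow_fraction fraction_in_embedded_iff to_quotient_mult_fraction)
qed

end

section \<open>Products of sequences\<close>

lemma repeat_mset_subsetD:
  assumes "0 < n" "repeat_mset n s \<subseteq># repeat_mset n a"
  shows "s \<subseteq># a"
proof (rule mset_subset_eqI)
  fix x
  show "count s x \<le> count a x" using mset_subset_eq_count[OF assms(2), of x] assms(1) by simp
qed

text \<open>A deficit of \<open>a\<close> against \<open>s\<close> at one letter is multiplied by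
  \<open>n\<close> and would outgrow the fixed multiplicity in \<open>d\<close>.\<close>

lemma subset_of_bounded_multiples:
  assumes "\<And>n. 0 < n \<Longrightarrow> repeat_mset n s \<subseteq># d + repeat_mset n a"
  shows "s \<subseteq># a"
proof (rule mset_subset_eqI, rule ccontr)
  fix x assume "\<not> count s x \<le> count a x"
  then have "Suc (count d x) * Suc (count a x) \<le> Suc (count d x) * count s x"
    by (intro mult_le_mono2) simp
  then show False using mset_subset_eq_count[OF assms[of "Suc (count d x)"], of x] by simp
qed

lemma set_repeat_mset_subset: "set_mset (repeat_mset n S) \<subseteq> set_mset S"
  by (induction n) auto

context monoid
begin

abbreviation \<B> where
  "\<B> \<equiv> product_one_sequences G"

abbreviation \<H> where
  "\<H> \<equiv> product_one_monoid G"

definition list_prod :: "'a list \<Rightarrow> 'a" where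
  "list_prod gs = foldr (\<otimes>) gs \<one>"

lemma list_prod_Nil [simp]: "list_prod [] = \<one>"
  and list_prod_Cons [simp]: "list_prod (g # gs) = g \<otimes> list_prod gs"
  by (simp_all add: list_prod_def)

lemma list_prod_closed [simp, intro]: "set gs \<subseteq> carrier G \<Longrightarrow> list_prod gs \<in> carrier G"
  by (simp add: list_prod_def foldr_mult_closed)

lemma list_prod_append [simp]:
  "set gs \<subseteq> carrier G \<Longrightarrow> set hs \<subseteq> carrier G \<Longrightarrow>
   list_prod (gs @ hs) = list_prod gs \<otimes> list_prod hs"
  unfolding list_prod_def by (rule foldr_mult_append)

lemma products_eq: "products G S = {list_prod gs | gs. mset gs = S}"
  by (simp add: products_def list_prod_def)

lemma list_prod_in_products: "list_prod gs \<in> products G (mset gs)"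
  by (auto simp: products_eq)

lemma products_closed: "p \<in> products G S \<Longrightarrow> set_mset S \<subseteq> carrier G \<Longrightarrow> p \<in> carrier G"
  by (auto simp: products_eq)

lemma products_empty [simp]: "products G {#} = {\<one>}"
  by (auto simp: products_eq)

lemma products_single [simp]: "g \<in> carrier G \<Longrightarrow> products G {#g#} = {g}"
  by (auto simp: products_eq intro: exI[of _ "[g]"])

lemma products_add:
  assumes "p \<in> products G S" "q \<in> products G T"
    and "set_mset S \<subseteq> carrier G" "set_mset T \<subseteq> carrier G"
  shows "p \<otimes> q \<in> products G (S + T)"
proof -
  obtain gs hs where "mset gs = S" "mset hs = T" "p = list_prod gs" "q = list_prod hs"
    using assms by (auto simp: products_eq)
  with assms list_prod_in_products[of "gs @ hs"] show ?thesis by auto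
qed

lemma products_repeat:
  assumes "p \<in> products G S" "set_mset S \<subseteq> carrier G"
  shows "p [^] n \<in> products G (repeat_mset n S)"
proof (induction n)
  case (Suc n)
  have "p [^] n \<otimes> p \<in> products G (repeat_mset n S + S)"
    using assms Suc set_repeat_mset_subset[of n S] by (intro products_add) auto
  then show ?case by (simp add: add.commute)
qed simp

lemma products_replicate:
  "g \<in> carrier G \<Longrightarrow> g [^] n \<in> products G (replicate_mset n g)"
  using products_repeat[of g "{#g#}" n] by simp

lemma in_product_one_iff:
  "S \<in> \<B> \<longleftrightarrow> set_mset S \<subseteq> carrier G \<and> \<one> \<in> products G S"
  by (simp add: product_one_sequences_def free_abelian_monoid_def)

lemma product_oneE:
  assumes "S \<in> \<B>"
  obtains gs where "mset gs = S" "set gs \<subseteq> carrier G" "list_prod gs = \<one>"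
  using assms by (auto simp: in_product_one_iff products_eq)

lemma product_oneI:
  "set gs \<subseteq> carrier G \<Longrightarrow> list_prod gs = \<one> \<Longrightarrow> mset gs = S \<Longrightarrow> S \<in> \<B>"
  by (auto simp: in_product_one_iff products_eq intro: exI[of _ gs])

lemma product_one_carrier: "S \<in> \<B> \<Longrightarrow> set_mset S \<subseteq> carrier G"
  by (simp add: in_product_one_iff)

lemma empty_product_one [simp]: "{#} \<in> \<B>"
  by (simp add: in_product_one_iff)

lemma add_product_one [intro]:
  "S \<in> \<B> \<Longrightarrow> T \<in> \<B> \<Longrightarrow>
   S + T \<in> \<B>"
  using products_add[of \<one> S \<one> T] by (simp add: in_product_one_iff)

lemma repeat_product_one [intro]:
  "S \<in> \<B> \<Longrightarrow> repeat_mset n S \<in> \<B>"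
  by (induction n) auto

lemma sum_product_one:
  "(\<And>i. i \<in> I \<Longrightarrow> f i \<in> \<B>) \<Longrightarrow> sum f I \<in> \<B>"
  by (induction I rule: infinite_finite_induct) auto

lemma product_one_monoid_simps [simp]:
  "carrier \<H> = \<B>"
  "S \<otimes>\<^bsub>\<H>\<^esub> T = S + T"
  "\<one>\<^bsub>\<H>\<^esub> = {#}"
  by (simp_all add: product_one_monoid_def free_abelian_monoid_def)

lemma free_abelian_monoid_simps [simp]:
  "carrier (free_abelian_monoid G) = {S. set_mset S \<subseteq> carrier G}"
  "S \<otimes>\<^bsub>free_abelian_monoid G\<^esub> T = S + T"
  "\<one>\<^bsub>free_abelian_monoid G\<^esub> = {#}"
  by (simp_all add: free_abelian_monoid_def)

lemma pow_product_one_monoid [simp]: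
  "S [^]\<^bsub>\<H>\<^esub> (n::nat) = repeat_mset n S"
  by (induction n) (simp_all add: nat_pow_def add.commute)

lemma seminormal_product_one_iff:
  "seminormal \<H> \<longleftrightarrow> (\<forall>a\<in>\<B>. \<forall>s\<in>\<B>.
     (\<exists>n::nat. 0 < n \<and> (\<forall>m\<ge>n. \<exists>c\<in>\<B>. repeat_mset m a = c + repeat_mset m s)) \<longrightarrow>
     (\<exists>c\<in>\<B>. a = c + s))"
  by (simp add: comm_monoid_cancel.seminormal_iff[OF comm_monoid_cancel_product_one_monoid])

lemma root_closed_product_one_iff:
  "root_closed \<H> \<longleftrightarrow> (\<forall>a\<in>\<B>. \<forall>s\<in>\<B>.
     (\<exists>n::nat. 0 < n \<and> (\<exists>c\<in>\<B>. repeat_mset n a = c + repeat_mset n s)) \<longrightarrow>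
     (\<exists>c\<in>\<B>. a = c + s))"
  by (simp add: comm_monoid_cancel.root_closed_iff[OF comm_monoid_cancel_product_one_monoid])

lemma completely_integrally_closed_product_one_iff:
  "completely_integrally_closed \<H> \<longleftrightarrow>
   (\<forall>a\<in>\<B>. \<forall>s\<in>\<B>.
     (\<exists>d\<in>\<B>. \<forall>n::nat. 0 < n \<longrightarrow>
       (\<exists>c\<in>\<B>. d + repeat_mset n a = c + repeat_mset n s)) \<longrightarrow>
     (\<exists>c\<in>\<B>. a = c + s))"
  by (simp add: comm_monoid_cancel.completely_integrally_closed_iff[OF comm_monoid_cancel_product_one_monoid])

lemma Units_product_one_monoid [simp]: "Units \<H> = {{#}}"
  by (auto simp: Units_def)

end

text \<open>The remaining letters are listed as \<open>zs @ ys\<close>, the order that they have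
  after rotating the word until \<open>x\<close> is at an end.\<close>

lemma mset_eq_add_mset:
  assumes "mset gs = add_mset x S"
  obtains ys zs where "gs = ys @ x # zs" "mset (zs @ ys) = S"
proof -
  have "x \<in> set gs" using assms by (metis set_mset_mset union_single_eq_member)
  then obtain ys zs where "gs = ys @ x # zs" by (meson split_list)
  with assms that show ?thesis by auto
qed

lemma mset_eq_two: "mset gs = {#x, y#} \<longleftrightarrow> gs = [x, y] \<or> gs = [y, x]"
proof
  assume a: "mset gs = {#x, y#}"
  then obtain ys zs where "gs = ys @ x # zs" "mset (zs @ ys) = {#y#}"
    by (rule mset_eq_add_mset)
  moreover from this(2) have "zs @ ys = [y]" by (simp only: mset_single_iff)
  ultimately show "gs = [x, y] \<or> gs = [y, x]" by (auto simp: append_eq_Cons_conv)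
qed auto

lemma append_eq_two:
  assumes "zs @ ys = [u, v]"
  shows "(ys = [] \<and> zs = [u, v]) \<or> (ys = [v] \<and> zs = [u]) \<or> (ys = [u, v] \<and> zs = [])"
proof -
  obtain n where n: "zs = take n [u, v]" "ys = drop n [u, v]"
    using assms append_eq_conv_conj by metis
  consider "n = 0" | "n = 1" | "n \<ge> 2" by linarith
  then show ?thesis unfolding n by cases auto
qed

lemma mset_eq_three:
  assumes "mset gs = {#x, y, z#}"
  shows "gs \<in> {[x, y, z], [x, z, y], [y, x, z], [y, z, x], [z, x, y], [z, y, x]}"
proof -
  obtain ys zs where "gs = ys @ x # zs" "mset (zs @ ys) = {#y, z#}"
    using assms by (rule mset_eq_add_mset)
  then have "zs @ ys = [y, z] \<or> zs @ ys = [z, y]" by (simp only: mset_eq_two)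
  then show ?thesis
  proof
    assume "zs @ ys = [y, z]"
    from append_eq_two[OF this] \<open>gs = ys @ x # zs\<close> show ?thesis by (elim disjE conjE) simp_all
  next
    assume "zs @ ys = [z, y]"
    from append_eq_two[OF this] \<open>gs = ys @ x # zs\<close> show ?thesis by (elim disjE conjE) simp_all
  qed
qed

section \<open>Rotation of words, commutators, and sequences on which closure properties are
  tested\<close>

context group
begin

lemma mult_inv_mult [simp]:
  "x \<in> carrier G \<Longrightarrow> y \<in> carrier G \<Longrightarrow> x \<otimes> (inv x \<otimes> y) = y"
  "x \<in> carrier G \<Longrightarrow> y \<in> carrier G \<Longrightarrow> inv x \<otimes> (x \<otimes> y) = y"
  by (simp_all add: m_assoc[symmetric])

lemmas word_simps = m_assoc inv_mult_group

text \<open>A product-one word may be rotated.\<close>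

lemma add_mset_product_one_iff:
  "add_mset g S \<in> \<B> \<longleftrightarrow>
   g \<in> carrier G \<and> (\<exists>hs. mset hs = S \<and> set hs \<subseteq> carrier G \<and> list_prod hs \<otimes> g = \<one>)"
proof
  assume "add_mset g S \<in> \<B>"
  then obtain gs where gs: "mset gs = add_mset g S" "set gs \<subseteq> carrier G" "list_prod gs = \<one>"
    by (rule product_oneE)
  then obtain ys zs where yz: "gs = ys @ g # zs" "mset (zs @ ys) = S"
    by (auto elim: mset_eq_add_mset)
  with gs have c: "set ys \<subseteq> carrier G" "set zs \<subseteq> carrier G" "g \<in> carrier G" by auto
  have "list_prod ys \<otimes> (g \<otimes> list_prod zs) = \<one>" using gs yz c by simp
  then have "(g \<otimes> list_prod zs) \<otimes> list_prod ys = \<one>"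
    by (rule inv_comm) (use c in auto)
  then have "(list_prod zs \<otimes> list_prod ys) \<otimes> g = \<one>"
    using inv_comm[of "g" "list_prod zs \<otimes> list_prod ys"] c by (simp add: m_assoc)
  then show "g \<in> carrier G \<and> (\<exists>hs. mset hs = S \<and> set hs \<subseteq> carrier G \<and> list_prod hs \<otimes> g = \<one>)"
    using yz c by (intro conjI exI[of _ "zs @ ys"]) auto
next
  assume "g \<in> carrier G \<and> (\<exists>hs. mset hs = S \<and> set hs \<subseteq> carrier G \<and> list_prod hs \<otimes> g = \<one>)"
  then obtain hs where "g \<in> carrier G" "mset hs = S" "set hs \<subseteq> carrier G" "list_prod hs \<otimes> g = \<one>"
    by blast
  then show "add_mset g S \<in> \<B>"
    by (intro product_oneI[of "hs @ [g]"]) auto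
qed

lemma inv_in_products:
  assumes "add_mset g S \<in> \<B>"
  shows "inv g \<in> products G S"
proof -
  obtain hs where hs: "g \<in> carrier G" "mset hs = S" "set hs \<subseteq> carrier G" "list_prod hs \<otimes> g = \<one>"
    using assms by (auto simp: add_mset_product_one_iff)
  then have "list_prod hs = inv g" using inv_equality[OF hs(4)] by auto
  then show ?thesis using hs(2) list_prod_in_products[of hs] by simp
qed

lemma single_product_one_iff: "{#g#} \<in> \<B> \<longleftrightarrow> g = \<one>"
  by (auto simp: add_mset_product_one_iff)

lemma pair_product_one_iff:
  "{#g, h#} \<in> \<B> \<longleftrightarrow> g \<in> carrier G \<and> h \<in> carrier G \<and> h \<otimes> g = \<one>"
  by (auto simp: add_mset_product_one_iff intro!: exI[of _ "[h]"])

lemma inv_pair_product_one [simp]: "g \<in> carrier G \<Longrightarrow> {#g, inv g#} \<in> \<B>"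
  by (simp add: pair_product_one_iff)

definition commutator :: "'a \<Rightarrow> 'a \<Rightarrow> 'a" where
  "commutator g h = g \<otimes> h \<otimes> inv g \<otimes> inv h"

lemma commutator_closed [simp]:
  "g \<in> carrier G \<Longrightarrow> h \<in> carrier G \<Longrightarrow> commutator g h \<in> carrier G"
  by (simp add: commutator_def)

lemma commutator_eq_one_iff:
  assumes "g \<in> carrier G" "h \<in> carrier G"
  shows "commutator g h = \<one> \<longleftrightarrow> g \<otimes> h = h \<otimes> g"
proof
  have "commutator g h \<otimes> (h \<otimes> g) = g \<otimes> h"
    using assms by (simp add: commutator_def word_simps)
  then show "commutator g h = \<one> \<Longrightarrow> g \<otimes> h = h \<otimes> g" using assms by simp
  show "g \<otimes> h = h \<otimes> g \<Longrightarrow> commutator g h = \<one>"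
    using assms by (simp add: commutator_def m_assoc)
qed

lemma inv_commutator:
  "g \<in> carrier G \<Longrightarrow> h \<in> carrier G \<Longrightarrow> inv (commutator g h) = commutator h g"
  by (simp add: commutator_def word_simps)

lemma comm_groupI_commutator:
  "(\<And>g h. g \<in> carrier G \<Longrightarrow> h \<in> carrier G \<Longrightarrow> commutator g h = \<one>) \<Longrightarrow> comm_group G"
  by (intro group_comm_groupI) (simp add: commutator_eq_one_iff)

text \<open>The letters cancel in the order \<open>g, g^-1, h, h^-1\<close>, while the order
  \<open>g, h, g^-1, h^-1\<close> yields a commutator, which an additional letter
  \<open>[h, g]\<close> cancels. So \<open>[h, g]\<close> as a letter is a quotient of two
  product-one sequences.\<close>

lemma four_product_one:
  assumes "g \<in> carrier G" "h \<in> carrier G"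
  shows "{#g, h, inv g, inv h#} \<in> \<B>"
    and "{#commutator h g, g, h, inv g, inv h#} \<in> \<B>"
    and "inv (commutator h g) \<in> products G {#g, h, inv g, inv h#}"
proof -
  show "{#g, h, inv g, inv h#} \<in> \<B>"
    using assms by (intro product_oneI[of "[g, inv g, h, inv h]"]) auto
  show "{#commutator h g, g, h, inv g, inv h#} \<in> \<B>"
    using assms by (intro product_oneI[of "[commutator h g, g, h, inv g, inv h]"])
      (auto simp: commutator_def word_simps)
  show "inv (commutator h g) \<in> products G {#g, h, inv g, inv h#}"
    using list_prod_in_products[of "[g, h, inv g, inv h]"] assms
    by (simp add: inv_commutator) (simp add: commutator_def word_simps)
qed

text \<open>The sequence \<open>S\<close> is the quotient of its powers \<open>n + 2\<close> and
  \<open>n + 1\<close>, both of which have product one. Hence it represents an element of the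
  quotient group to which seminormality applies.\<close>

lemma seminormal_product_oneD:
  assumes "seminormal \<H>" "set_mset S \<subseteq> carrier G"
    and "\<And>m. m \<ge> n \<Longrightarrow> repeat_mset m S \<in> \<B>"
  shows "S \<in> \<B>"
proof -
  let ?a = "repeat_mset (Suc (Suc n)) S" and ?s = "repeat_mset (Suc n) S"
  have "\<exists>c\<in>\<B>. repeat_mset m ?a = c + repeat_mset m ?s" if "Suc n \<le> m" for m
    using that assms(3)[of m]
    by (intro bexI[of _ "repeat_mset m S"]) (simp_all add: multiset_eq_iff algebra_simps)
  then have "\<exists>n'::nat. 0 < n' \<and> (\<forall>m\<ge>n'. \<exists>c\<in>\<B>.
      repeat_mset m ?a = c + repeat_mset m ?s)"
    by blast
  moreover have "?a \<in> \<B>" "?s \<in> \<B>"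
    using assms(3) by (simp_all only: le_SucI order_refl)
  ultimately have "\<exists>c\<in>\<B>. ?a = c + ?s"
    using assms(1)[unfolded seminormal_product_one_iff] by blast
  then show ?thesis by auto
qed

text \<open>Every exponent from 2 on is a sum of twos and threes.\<close>

lemma seminormal_two_three:
  assumes "seminormal \<H>" "set_mset S \<subseteq> carrier G"
    and "repeat_mset 2 S \<in> \<B>" "repeat_mset 3 S \<in> \<B>"
  shows "S \<in> \<B>"
proof (rule seminormal_product_oneD[OF assms(1,2)])
  fix m :: nat assume m: "m \<ge> 2"
  have "\<exists>i j. m = i * 2 + j * 3"
  proof (cases "even m")
    case True
    then show ?thesis by (metis add_0_right evenE mult.commute mult_0)
  next
    case False
    with m have "m = ((m - 3) div 2) * 2 + 1 * 3" by presburger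
    then show ?thesis by blast
  qed
  then obtain i j where "m = i * 2 + j * 3" by blast
  then have "repeat_mset m S = repeat_mset i (repeat_mset 2 S) + repeat_mset j (repeat_mset 3 S)"
    by (simp add: multiset_eq_iff algebra_simps)
  also have "\<dots> \<in> \<B>" 
    by (intro add_product_one repeat_product_one[OF assms(3)] repeat_product_one[OF assms(4)])
  finally show "repeat_mset m S \<in> \<B>" .
qed

text \<open>The sequence \<open>b\<close> is a denominator: it exhibits \<open>S\<close> as the
  element \<open>(S + b)/b\<close> of the quotient group.\<close>

lemma root_closed_product_oneD:
  assumes "root_closed \<H>"
    and b: "b \<in> \<B>" "S + b \<in> \<B>"
    and n: "0 < n" "repeat_mset n S \<in> \<B>"
  shows "S \<in> \<B>"
proof -
  have "repeat_mset n (S + b) = repeat_mset n S + repeat_mset n b" by simp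
  then have "\<exists>c\<in>\<B>. S + b = c + b"
    using assms(1)[unfolded root_closed_product_one_iff] b n by blast
  then show ?thesis by auto
qed

lemma root_closed_imp_seminormal:
  assumes "root_closed \<H>"
  shows "seminormal \<H>"
  unfolding seminormal_product_one_iff
proof (intro ballI impI)
  fix a s
  assume "a \<in> \<B>" "s \<in> \<B>"
    and "\<exists>n::nat. 0 < n \<and> (\<forall>m\<ge>n. \<exists>c\<in>\<B>. repeat_mset m a = c + repeat_mset m s)"
  then show "\<exists>c\<in>\<B>. a = c + s"
    using assms[unfolded root_closed_product_one_iff] by blast
qed

end

section \<open>Seminormality and commutators\<close>

context group
begin

text \<open>Membership in the carrier is included so that the closure rules below chain without side
  conditions.\<close>

definition commutes :: "'a \<Rightarrow> 'a \<Rightarrow> bool" where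
  "commutes x y \<longleftrightarrow> x \<in> carrier G \<and> y \<in> carrier G \<and> x \<otimes> y = y \<otimes> x"

lemma commutes_sym: "commutes x y \<Longrightarrow> commutes y x"
  by (simp add: commutes_def)

lemma commutes_refl: "x \<in> carrier G \<Longrightarrow> commutes x x"
  by (simp add: commutes_def)

lemma commutes_mult:
  assumes "commutes x y" "commutes x z"
  shows "commutes x (y \<otimes> z)"
proof -
  have c: "x \<in> carrier G" "y \<in> carrier G" "z \<in> carrier G" and e: "x \<otimes> y = y \<otimes> x" "x \<otimes> z = z \<otimes> x"
    using assms by (auto simp: commutes_def)
  have "x \<otimes> (y \<otimes> z) = (y \<otimes> x) \<otimes> z" using c e by (simp add: m_assoc[symmetric])
  also have "\<dots> = (y \<otimes> z) \<otimes> x" using c e by (simp add: m_assoc)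
  finally show ?thesis using c by (simp add: commutes_def)
qed

lemma commutes_inv:
  assumes "commutes x y"
  shows "commutes x (inv y)"
proof -
  have c: "x \<in> carrier G" "y \<in> carrier G" and e: "x \<otimes> y = y \<otimes> x"
    using assms by (auto simp: commutes_def)
  have "inv y \<otimes> (y \<otimes> x) \<otimes> inv y = inv y \<otimes> (x \<otimes> y) \<otimes> inv y" by (simp add: e)
  then show ?thesis using c by (simp add: commutes_def m_assoc)
qed

lemma commutes_commutator_iff:
  "g \<in> carrier G \<Longrightarrow> h \<in> carrier G \<Longrightarrow> commutes g h \<longleftrightarrow> commutator g h = \<one>"
  by (simp add: commutes_def commutator_eq_one_iff)

lemma commutes_conj:
  "commutes x y \<Longrightarrow> x \<otimes> y \<otimes> inv x = y"
  by (simp add: commutes_def m_assoc) 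

lemma mult_self_eq_one_imp: "x \<in> carrier G \<Longrightarrow> x \<otimes> x = \<one> \<Longrightarrow> inv x = x"
  by (rule inv_equality) auto

lemma conj_mult_self:
  assumes "x \<in> carrier G" "y \<in> carrier G"
  shows "(x \<otimes> y \<otimes> inv x) \<otimes> (x \<otimes> y \<otimes> inv x) = \<one> \<longleftrightarrow> y \<otimes> y = \<one>"
proof -
  have "(x \<otimes> y \<otimes> inv x) \<otimes> (x \<otimes> y \<otimes> inv x) = x \<otimes> (y \<otimes> y) \<otimes> inv x"
    using assms by (simp add: word_simps)
  moreover have "y \<otimes> y = inv x \<otimes> (x \<otimes> (y \<otimes> y) \<otimes> inv x) \<otimes> x"
    using assms by (simp add: word_simps)
  ultimately show ?thesis using assms by auto
qed

lemma inv_mult_self: "y \<in> carrier G \<Longrightarrow> inv y \<otimes> inv y = \<one> \<longleftrightarrow> y \<otimes> y = \<one>"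
  by (metis inv_mult_group inv_closed inv_inv inv_one)

text \<open>Rotating \<open>u\<close> to the end leaves only the order of the other letters open;
  the next lemma does the same for four letters.\<close>

lemma list_prod_three_product_one:
  assumes "add_mset u {#x, y#} \<in> \<B>"
  shows "x \<otimes> y \<otimes> u = \<one> \<or> y \<otimes> x \<otimes> u = \<one>"
proof -
  obtain hs where "mset hs = {#x, y#}" "set hs \<subseteq> carrier G" "list_prod hs \<otimes> u = \<one>" "u \<in> carrier G"
    using assms by (auto simp: add_mset_product_one_iff)
  then show ?thesis by (auto simp: mset_eq_two)
qed

lemma list_prod_four_product_one:
  assumes "add_mset u {#x, y, z#} \<in> \<B>"
  shows "x \<otimes> (y \<otimes> z) \<otimes> u = \<one> \<or> x \<otimes> (z \<otimes> y) \<otimes> u = \<one> \<or> y \<otimes> (x \<otimes> z) \<otimes> u = \<one> \<or>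
    y \<otimes> (z \<otimes> x) \<otimes> u = \<one> \<or> z \<otimes> (x \<otimes> y) \<otimes> u = \<one> \<or> z \<otimes> (y \<otimes> x) \<otimes> u = \<one>"
proof -
  obtain hs where "mset hs = {#x, y, z#}" "set hs \<subseteq> carrier G" "list_prod hs \<otimes> u = \<one>" "u \<in> carrier G"
    using assms by (auto simp: add_mset_product_one_iff)
  then show ?thesis using mset_eq_three[of hs x y z] by auto
qed

end

section \<open>Seminormality forces at most one nontrivial commutator\<close>

locale seminormal_sequences = group +
  assumes seminormal_product_one: "seminormal \<H>"
begin

text \<open>Conjugation by \<open>h\<^sup>2\<close> becomes available only once the letter \<open>h\<close> occurs twice.\<close>

lemma commutes_square_or_cube:
  assumes g: "g \<in> carrier G" and h: "h \<in> carrier G"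
  shows "commutes g (h \<otimes> h) \<or> commutes g (h \<otimes> (h \<otimes> h))"
proof -
  \<comment> \<open>The inverse of \<open>h^-2 g h^2\<close>. In the second power, two letters
    \<open>h\<close> and two letters \<open>h^-1\<close> enclose \<open>u^2\<close> and turn it into
    \<open>g^-2\<close>; in the third power one pair \<open>h, h^-1\<close> is left over and
    cancels.\<close>
  define u where "u = inv h \<otimes> (inv h \<otimes> (inv g \<otimes> (h \<otimes> h)))"
  have u: "u \<in> carrier G" using g h by (simp add: u_def)
  let ?S = "{#u, h, inv h, g#}"
  have "repeat_mset 2 ?S \<in> \<B>"
  proof (rule product_oneI)
    show "list_prod [h, h, u, u, inv h, inv h, g, g] = \<one>"
      using g h by (simp add: u_def word_simps)
  qed (use g h u in \<open>simp_all add: numeral_eq_Suc\<close>)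
  moreover have "repeat_mset 3 ?S \<in> \<B>"
  proof (rule product_oneI)
    show "list_prod [h, h, u, u, u, inv h, inv h, g, g, g, h, inv h] = \<one>"
      using g h by (simp add: u_def word_simps)
  qed (use g h u in \<open>simp_all add: numeral_eq_Suc\<close>)
  ultimately have "?S \<in> \<B>"
    by (rule seminormal_two_three[OF seminormal_product_one, rotated]) (use g h u in auto)
  then have cases: "h \<otimes> (inv h \<otimes> g) \<otimes> u = \<one> \<or> h \<otimes> (g \<otimes> inv h) \<otimes> u = \<one> \<or> inv h \<otimes> (h \<otimes> g) \<otimes> u = \<one> \<or>
    inv h \<otimes> (g \<otimes> h) \<otimes> u = \<one> \<or> g \<otimes> (h \<otimes> inv h) \<otimes> u = \<one> \<or> g \<otimes> (inv h \<otimes> h) \<otimes> u = \<one>"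
    by (rule list_prod_four_product_one)
  \<comment> \<open>A product of the other three letters that cancels \<open>u\<close> must be
    \<open>h^-2 g h^2\<close>.\<close>
  have iu: "p = inv h \<otimes> (inv h \<otimes> (g \<otimes> (h \<otimes> h)))" if "p \<in> carrier G" "p \<otimes> u = \<one>" for p
    using inv_equality[OF that(2) u that(1)] g h by (simp add: u_def word_simps)
  \<comment> \<open>Up to cancellation the six orders give \<open>g\<close>, \<open>h g h^-1\<close>
    and \<open>h^-1 g h\<close>. Comparison with \<open>h^-2 g h^2\<close> makes \<open>g\<close>
    commute with \<open>h^2\<close>, \<open>h^3\<close> and \<open>h\<close>, respectively.\<close>
  consider "g \<otimes> u = \<one>" | "h \<otimes> (g \<otimes> inv h) \<otimes> u = \<one>" | "inv h \<otimes> (g \<otimes> h) \<otimes> u = \<one>"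
    using cases g h by auto
  then show ?thesis
  proof cases
    case 1
    then have "h \<otimes> (h \<otimes> g) = h \<otimes> (h \<otimes> (inv h \<otimes> (inv h \<otimes> (g \<otimes> (h \<otimes> h)))))"
      using iu[of g] g by simp
    then show ?thesis using g h by (simp add: commutes_def m_assoc)
  next
    case 2
    then have "h \<otimes> (h \<otimes> (h \<otimes> (g \<otimes> inv h) \<otimes> h)) =
        h \<otimes> (h \<otimes> (inv h \<otimes> (inv h \<otimes> (g \<otimes> (h \<otimes> h))) \<otimes> h))"
      using iu[of "h \<otimes> (g \<otimes> inv h)"] g h by simp
    then show ?thesis using g h by (simp add: commutes_def m_assoc)
  next
    case 3
    then have "h \<otimes> (h \<otimes> (inv h \<otimes> (g \<otimes> h) \<otimes> inv h)) =
        h \<otimes> (h \<otimes> (inv h \<otimes> (inv h \<otimes> (g \<otimes> (h \<otimes> h))) \<otimes> inv h))"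
      using iu[of "inv h \<otimes> (g \<otimes> h)"] g h by simp
    then have "commutes g h" using g h by (simp add: commutes_def m_assoc)
    then show ?thesis by (blast intro: commutes_mult)
  qed
qed

text \<open>The three letters \<open>u, g, h\<close> have both products \<open>k^2\<close> and
  \<open>k\<close>, so \<open>m\<close> copies of them have product \<open>k^(m + b)\<close> for
  every \<open>b \<le> m\<close>. For \<open>m \<ge> n\<close> some such exponent is a multiple of
  \<open>n\<close>; seminormality then makes \<open>k^2\<close> or \<open>k\<close> trivial.\<close>

lemma finite_order_commutator:
  assumes g: "g \<in> carrier G" and h: "h \<in> carrier G" and n: "0 < (n::nat)" "commutator g h [^] n = \<one>"
  shows "commutator g h \<otimes> commutator g h = \<one>"
proof -
  define k where "k = commutator g h"
  define u where "u = inv (g \<otimes> h) \<otimes> (k \<otimes> k)"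
  let ?S = "{#u, g, h#}"
  have k: "k \<in> carrier G" and u: "u \<in> carrier G" using g h by (simp_all add: k_def u_def)
  have 1: "g \<otimes> h \<otimes> u = k \<otimes> k" using g h k by (simp add: u_def word_simps)
  have "h \<otimes> g \<otimes> u = commutator h g \<otimes> (k \<otimes> k)"
    using g h k by (simp add: u_def word_simps commutator_def)
  then have 2: "h \<otimes> g \<otimes> u = k"
    using g h k by (simp add: inv_commutator[OF g h, symmetric] k_def[symmetric])
  have S: "set_mset ?S \<subseteq> carrier G" using g h u by auto
  have p1: "k \<otimes> k \<in> products G ?S"
  proof -
    have "mset [g, h, u] = ?S" "list_prod [g, h, u] = k \<otimes> k"
      using 1 g h u by (simp_all add: m_assoc)
    then show ?thesis by (metis list_prod_in_products)
  qed
  have p2: "k \<in> products G ?S"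
  proof -
    have "mset [h, g, u] = ?S" "list_prod [h, g, u] = k"
      using 2 g h u by (simp_all add: m_assoc)
    then show ?thesis by (metis list_prod_in_products)
  qed
  have "?S \<in> \<B>"
  proof (rule seminormal_product_oneD[OF seminormal_product_one S])
    fix m assume m: "n \<le> m"
    \<comment> \<open>The residue of \<open>-m\<close> modulo \<open>n\<close>, as
      \<open>n - 1\<close> is congruent to \<open>-1\<close>.\<close>
    define b where "b = (n - 1) * m mod n"
    have b: "b \<le> m" using m n by (simp add: b_def less_imp_le order_trans[OF mod_less_divisor[THEN less_imp_le]])
    have "(m + b) mod n = (m + (n - 1) * m) mod n" by (simp add: b_def mod_add_right_eq)
    also have "m + (n - 1) * m = n * m" using n by (cases n) auto
    finally have "n dvd m + b" by auto
    then obtain q where q: "m + b = n * q" by (elim dvdE)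
    have "(k \<otimes> k) [^] b \<otimes> k [^] (m - b) \<in> products G (repeat_mset b ?S + repeat_mset (m - b) ?S)"
      using S set_repeat_mset_subset[of _ ?S]
      by (intro products_add products_repeat p1 p2 S) (meson order_trans)+
    moreover have "repeat_mset b ?S + repeat_mset (m - b) ?S = repeat_mset m ?S"
      using repeat_mset_distrib[of b "m - b" ?S] b by (simp only: le_add_diff_inverse)
    moreover have "(k \<otimes> k) [^] b \<otimes> k [^] (m - b) = \<one>"
    proof -
      have "(k \<otimes> k) [^] b = k [^] (2 * b)"
        using k nat_pow_pow[of k 2 b] by (simp add: numeral_2_eq_2)
      then have "(k \<otimes> k) [^] b \<otimes> k [^] (m - b) = k [^] (2 * b + (m - b))"
        using k by (simp add: nat_pow_mult)
      also have "2 * b + (m - b) = n * q" using b q by simp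
      also have "k [^] (n * q) = \<one>"
        using k n by (simp add: nat_pow_pow[symmetric] k_def)
      finally show ?thesis .
    qed
    moreover have "set_mset (repeat_mset m ?S) \<subseteq> carrier G"
      using set_repeat_mset_subset S by (rule order_trans)
    ultimately show "repeat_mset m ?S \<in> \<B>"
      by (simp only: in_product_one_iff)
  qed
  then have "k \<otimes> k = \<one> \<or> k = \<one>" using list_prod_three_product_one[of u g h] 1 2 by auto
  then show ?thesis using k by (auto simp: k_def)
qed

text \<open>If \<open>h^2\<close> commutes with \<open>g\<close>, then conjugation by
  \<open>h\<close> inverts \<open>k = [g, h]\<close>. But \<open>h\<close> also commutes with
  \<open>k^2\<close> or \<open>k^3\<close>, so that power is its own inverse and \<open>k\<close>
  has finite order.\<close>

lemma commutator_square_of_commutes_square: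
  assumes "commutes g (h \<otimes> h)" and h: "h \<in> carrier G"
  shows "commutator g h \<otimes> commutator g h = \<one>"
proof -
  define k where "k = commutator g h"
  have g: "g \<in> carrier G" using assms by (simp add: commutes_def)
  have k: "k \<in> carrier G" using g h by (simp add: k_def)
  have "commutes (inv g) (h \<otimes> h)" using assms by (blast intro: commutes_sym commutes_inv)
  then have e: "h \<otimes> (h \<otimes> inv g) = inv g \<otimes> (h \<otimes> h)" using h g by (simp add: commutes_def m_assoc)
  have "h \<otimes> k = (h \<otimes> g \<otimes> inv h) \<otimes> (h \<otimes> (h \<otimes> inv g)) \<otimes> inv h"
    using g h by (simp add: k_def commutator_def word_simps)
  also have "\<dots> = inv k \<otimes> h"
    unfolding e using g h by (simp add: k_def commutator_def word_simps)
  finally have hk: "h \<otimes> k = inv k \<otimes> h" .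
  have hkx: "h \<otimes> (k \<otimes> x) = inv k \<otimes> (h \<otimes> x)" if "x \<in> carrier G" for x
    using that h k hk by (metis inv_closed m_assoc)
  have "k [^] (4::nat) = \<one> \<or> k [^] (6::nat) = \<one>"
    using commutes_square_or_cube[OF h k]
  proof
    assume "commutes h (k \<otimes> k)"
    then have "inv k \<otimes> (inv k \<otimes> h) = k \<otimes> (k \<otimes> h)"
      using h k by (simp add: commutes_def hkx hk m_assoc)
    then have "k \<otimes> (k \<otimes> (inv k \<otimes> (inv k \<otimes> h))) \<otimes> inv h = k \<otimes> (k \<otimes> (k \<otimes> (k \<otimes> h))) \<otimes> inv h" by simp
    then have "k \<otimes> (k \<otimes> (k \<otimes> k)) = \<one>" using h k by (simp add: m_assoc)
    then show ?thesis using k by (simp add: numeral_eq_Suc m_assoc)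
  next
    assume "commutes h (k \<otimes> (k \<otimes> k))"
    then have "inv k \<otimes> (inv k \<otimes> (inv k \<otimes> h)) = k \<otimes> (k \<otimes> (k \<otimes> h))"
      using h k by (simp add: commutes_def hkx hk m_assoc)
    then have "k \<otimes> (k \<otimes> (k \<otimes> (inv k \<otimes> (inv k \<otimes> (inv k \<otimes> h))))) \<otimes> inv h =
      k \<otimes> (k \<otimes> (k \<otimes> (k \<otimes> (k \<otimes> (k \<otimes> h))))) \<otimes> inv h" by simp
    then have "k \<otimes> (k \<otimes> (k \<otimes> (k \<otimes> (k \<otimes> k)))) = \<one>" using h k by (simp add: m_assoc)
    then show ?thesis using k by (simp add: numeral_eq_Suc m_assoc)
  qed
  then show ?thesis
    using finite_order_commutator[OF g h, of 4] finite_order_commutator[OF g h, of 6]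
    by (auto simp: k_def)
qed

lemma commutator_square_sym:
  "g \<in> carrier G \<Longrightarrow> h \<in> carrier G \<Longrightarrow>
   commutator g h \<otimes> commutator g h = \<one> \<longleftrightarrow> commutator h g \<otimes> commutator h g = \<one>"
  using inv_mult_self[of "commutator g h"] by (simp add: inv_commutator)

text \<open>Otherwise the cubes of \<open>g\<close>, \<open>h\<close>, \<open>g h\<close> and
  \<open>h g^-1\<close> commute with \<open>g\<close> and \<open>h\<close>. These relations make the
  conjugates of \<open>h\<close> by powers of \<open>g\<close> commute with each other, hence
  \<open>[g, h]^3 = 1\<close>, and a commutator of finite order has trivial square.\<close>

lemma commutator_square:
  assumes g: "g \<in> carrier G" and h: "h \<in> carrier G"
  shows "commutator g h \<otimes> commutator g h = \<one>"
proof (rule ccontr)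
  assume ne: "commutator g h \<otimes> commutator g h \<noteq> \<one>"
  define g3 where "g3 = g \<otimes> (g \<otimes> g)"
  define h3 where "h3 = h \<otimes> (h \<otimes> h)"
  have gh3: "commutes g h3"
    using commutes_square_or_cube[OF g h] commutator_square_of_commutes_square[of g h] ne h
    by (auto simp: h3_def)
  have hg3: "commutes h g3"
    using commutes_square_or_cube[OF h g] commutator_square_of_commutes_square[of h g] ne g h
    by (auto simp: g3_def commutator_square_sym[of g h])
  have gg3: "commutes g g3" and hh3: "commutes h h3"
    unfolding g3_def h3_def using g h by (auto intro!: commutes_mult commutes_refl)
  \<comment> \<open>The commutator of \<open>g\<close> with \<open>g h\<close> is a conjugate of
    \<open>[g, h]\<close>, and the one with \<open>s = h g^-1\<close> below is \<open>[g, h]\<close>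
    itself. Neither has trivial square, so the cubes of \<open>t\<close> and \<open>s\<close>
    commute with \<open>g\<close>, and then with \<open>h\<close>.\<close>
  define t where "t = g \<otimes> h"
  define t3 where "t3 = t \<otimes> (t \<otimes> t)"
  have t: "t \<in> carrier G" using g h by (simp add: t_def)
  have gt3: "commutes g t3"
  proof -
    have "commutator g t = g \<otimes> commutator g h \<otimes> inv g"
      using g h by (simp add: t_def commutator_def word_simps)
    then have "commutator g t \<otimes> commutator g t \<noteq> \<one>"
      using ne g h conj_mult_self[of g "commutator g h"] by simp
    then show ?thesis
      using commutes_square_or_cube[OF g t] commutator_square_of_commutes_square[of g t] t
      by (auto simp: t3_def)
  qed
  have ht3: "commutes h t3"
  proof -
    have "commutes t3 t" unfolding t3_def using t by (blast intro: commutes_sym commutes_mult commutes_refl)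
    then have "commutes t3 (inv g \<otimes> t)" using gt3 by (blast intro: commutes_mult commutes_inv commutes_sym)
    then show ?thesis using g h by (simp add: t_def commutes_sym)
  qed
  define s where "s = h \<otimes> inv g"
  define s3 where "s3 = s \<otimes> (s \<otimes> s)"
  have s: "s \<in> carrier G" using g h by (simp add: s_def)
  have gs3: "commutes g s3"
  proof -
    have "commutator g s = (g \<otimes> h \<otimes> inv g) \<otimes> inv h"
      using g h by (simp add: s_def commutator_def word_simps)
    then have "commutator g s = commutator g h" by (simp add: commutator_def)
    then show ?thesis
      using commutes_square_or_cube[OF g s] commutator_square_of_commutes_square[of g s] s ne
      by (auto simp: s3_def)
  qed
  have hs3: "commutes h s3"
  proof -
    have "commutes s3 s" unfolding s3_def using s by (blast intro: commutes_sym commutes_mult commutes_refl)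
    then have "commutes s3 (s \<otimes> g)" using gs3 by (blast intro: commutes_mult commutes_inv commutes_sym)
    then show ?thesis using g h by (simp add: s_def commutes_sym m_assoc)
  qed
  define h1 where "h1 = g \<otimes> (h \<otimes> inv g)"
  define h2 where "h2 = inv g \<otimes> (h \<otimes> g)"
  have c: "h1 \<in> carrier G" "h2 \<in> carrier G" "g3 \<in> carrier G" "h3 \<in> carrier G"
    "t3 \<in> carrier G" "s3 \<in> carrier G"
    using g h t s by (simp_all add: h1_def h2_def g3_def h3_def t3_def s3_def)
  \<comment> \<open>Expand \<open>g^-1 (g h)^3 g\<close>, which equals \<open>(g h)^3\<close>, and
    move the factor \<open>g^-3\<close> to the left past \<open>g\<close> and \<open>h\<close>. The
    equation \<open>Q\<close> comes from \<open>(h g^-1)^3\<close> in the same way.\<close>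
  have P: "h \<otimes> (h1 \<otimes> h2) = t3 \<otimes> inv g3"
  proof -
    have "inv g \<otimes> t3 \<otimes> inv (inv g) = t3"
      using gt3 by (blast intro: commutes_conj commutes_sym commutes_inv)
    then have "t3 \<otimes> inv g3 = inv g \<otimes> t3 \<otimes> g \<otimes> inv g3" using g by simp
    also have "\<dots> = h \<otimes> (h1 \<otimes> (g \<otimes> (g \<otimes> (h \<otimes> inv g3)) \<otimes> g))"
    proof -
      have "inv g3 \<otimes> g = g \<otimes> inv g3"
        using gg3 by (metis commutes_def commutes_inv)
      then show ?thesis
        using g h c by (simp add: t3_def t_def h1_def m_assoc)
    qed
    also have "h \<otimes> inv g3 = inv g3 \<otimes> h"
      using hg3 by (metis commutes_def commutes_inv)
    also have "h \<otimes> (h1 \<otimes> (g \<otimes> (g \<otimes> (inv g3 \<otimes> h)) \<otimes> g)) = h \<otimes> (h1 \<otimes> h2)"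
      using g h c by (simp add: g3_def h2_def word_simps)
    finally show ?thesis by simp
  qed
  have Q: "h \<otimes> (h2 \<otimes> h1) = s3 \<otimes> g3"
  proof -
    have "s3 \<otimes> g3 = h \<otimes> (h2 \<otimes> (inv g \<otimes> (inv g \<otimes> (h \<otimes> g3)) \<otimes> inv g))"
    proof -
      have "g3 \<otimes> inv g = inv g \<otimes> g3"
        using gg3 by (metis commutes_def commutes_inv commutes_sym)
      then show ?thesis
        using g h c by (simp add: s3_def s_def h2_def m_assoc)
    qed
    also have "h \<otimes> g3 = g3 \<otimes> h" using hg3 by (simp add: commutes_def)
    also have "h \<otimes> (h2 \<otimes> (inv g \<otimes> (inv g \<otimes> (g3 \<otimes> h)) \<otimes> inv g)) = h \<otimes> (h2 \<otimes> h1)"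
      using g h c by (simp add: g3_def h1_def word_simps)
    finally show ?thesis by simp
  qed
  define z where "z = commutator h1 h2"
  have z: "z \<in> carrier G" using c by (simp add: z_def)
  \<comment> \<open>By \<open>P\<close> and \<open>Q\<close>, \<open>z\<close> is a product of the
    cubes \<open>t3\<close>, \<open>g3\<close>, \<open>s3\<close> and their inverses.\<close>
  have zc: "commutes x z" if "x \<in> {g, h}" for x
  proof -
    have "z = inv h \<otimes> (h \<otimes> (h1 \<otimes> h2)) \<otimes> inv (inv h \<otimes> (h \<otimes> (h2 \<otimes> h1)))"
      using h c by (simp add: z_def commutator_def word_simps)
    also have "\<dots> = (inv h \<otimes> (t3 \<otimes> inv g3)) \<otimes> inv (inv h \<otimes> (s3 \<otimes> g3))"
      by (simp only: P Q)
    also have "\<dots> = inv h \<otimes> ((t3 \<otimes> inv g3) \<otimes> inv (s3 \<otimes> g3)) \<otimes> h"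
      using h c by (simp add: word_simps)
    also have "\<dots> = inv h \<otimes> ((t3 \<otimes> inv g3) \<otimes> inv (s3 \<otimes> g3)) \<otimes> inv (inv h)"
      using h by simp
    also have "\<dots> = (t3 \<otimes> inv g3) \<otimes> inv (s3 \<otimes> g3)"
      using ht3 hg3 hs3 by (intro commutes_conj) (blast intro: commutes_mult commutes_inv commutes_sym)
    finally show ?thesis
      using that gt3 gg3 gs3 ht3 hg3 hs3 by (auto intro!: commutes_mult commutes_inv)
  qed
  have z1: "commutes z h1" and z2: "commutes z h2"
    unfolding h1_def h2_def using zc[of g] zc[of h]
    by (blast intro: commutes_mult commutes_inv commutes_sym)+
  have e: "h1 \<otimes> h2 \<otimes> inv h1 = z \<otimes> h2"
    using c by (simp add: z_def commutator_def m_assoc)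
  have h23: "h2 \<otimes> (h2 \<otimes> h2) = h3"
  proof -
    have "h2 \<otimes> (h2 \<otimes> h2) = inv g \<otimes> h3 \<otimes> inv (inv g)"
      using g h by (simp add: h2_def h3_def m_assoc)
    then show ?thesis using gh3 commutes_conj[of "inv g" h3] by (metis commutes_inv commutes_sym)
  qed
  \<comment> \<open>Conjugating \<open>h2^3 = h3\<close> by \<open>h1\<close> replaces
    \<open>h2\<close> by \<open>z h2\<close>. Since \<open>z\<close> commutes with
    \<open>h2\<close>, cubing yields \<open>z^3 = 1\<close>.\<close>
  have "h3 = h1 \<otimes> h3 \<otimes> inv h1"
    unfolding h1_def using gh3 hh3
    by (intro commutes_conj[symmetric]) (blast intro: commutes_mult commutes_inv commutes_sym)
  also have "\<dots> = (h1 \<otimes> h2 \<otimes> inv h1) \<otimes> ((h1 \<otimes> h2 \<otimes> inv h1) \<otimes> (h1 \<otimes> h2 \<otimes> inv h1))"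
    using c by (simp add: h23[symmetric] m_assoc)
  also have "\<dots> = z \<otimes> (h2 \<otimes> z) \<otimes> (h2 \<otimes> z) \<otimes> h2" using c z by (simp add: e m_assoc)
  also have "h2 \<otimes> z = z \<otimes> h2" using z2 by (simp add: commutes_def)
  also have "z \<otimes> (z \<otimes> h2) \<otimes> (z \<otimes> h2) \<otimes> h2 = z \<otimes> z \<otimes> (h2 \<otimes> z) \<otimes> (h2 \<otimes> h2)"
    using c z by (simp add: m_assoc)
  also have "h2 \<otimes> z = z \<otimes> h2" using z2 by (simp add: commutes_def)
  also have "z \<otimes> z \<otimes> (z \<otimes> h2) \<otimes> (h2 \<otimes> h2) = z \<otimes> (z \<otimes> z) \<otimes> h3"
    using c z by (simp add: h23[symmetric] m_assoc)
  finally have zzz: "z \<otimes> (z \<otimes> z) = \<one>" using c z by simp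
  then have "z [^] (3::nat) = \<one>" using z by (simp add: numeral_eq_Suc m_assoc)
  then have "z \<otimes> z = \<one>" using finite_order_commutator[of h1 h2 3] c by (simp add: z_def)
  with zzz z have "z = \<one>" by simp
  then have "commutes h1 h2" using c by (simp add: z_def commutes_commutator_iff)
  then have "inv g \<otimes> (h1 \<otimes> h2) \<otimes> g = inv g \<otimes> (h2 \<otimes> h1) \<otimes> g" by (simp add: commutes_def)
  then have hh2: "h \<otimes> (inv g \<otimes> inv g \<otimes> h \<otimes> g \<otimes> g) = (inv g \<otimes> inv g \<otimes> h \<otimes> g \<otimes> g) \<otimes> h"
    using g h by (simp add: h1_def h2_def word_simps)
  \<comment> \<open>Conjugation by \<open>g^-2\<close> and by \<open>g\<close> agree on
    \<open>h\<close>, because \<open>g^3\<close> commutes with \<open>h\<close>. Hence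
    \<open>h\<close> commutes with \<open>h1\<close>.\<close>
  have "inv g \<otimes> inv g \<otimes> h \<otimes> g \<otimes> g = h1"
  proof -
    have "inv g \<otimes> inv g \<otimes> h \<otimes> g \<otimes> g = g \<otimes> (inv g3 \<otimes> h \<otimes> inv (inv g3)) \<otimes> inv g"
      using g h by (simp add: g3_def word_simps)
    also have "inv g3 \<otimes> h \<otimes> inv (inv g3) = h"
      using hg3 by (intro commutes_conj) (blast intro: commutes_inv commutes_sym)
    finally show ?thesis using g h by (simp add: h1_def m_assoc)
  qed
  with hh2 have hh1: "h \<otimes> h1 = h1 \<otimes> h" by simp
  have ihh1: "inv h \<otimes> h1 = h1 \<otimes> inv h"
    using hh1 h c by (metis commutes_def commutes_inv commutes_sym)
  define k where "k = commutator g h"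
  have k: "k = h1 \<otimes> inv h" using g h by (simp add: k_def commutator_def h1_def m_assoc)
  have ihh1x: "inv h \<otimes> (h1 \<otimes> x) = h1 \<otimes> (inv h \<otimes> x)" if "x \<in> carrier G" for x
    using that c h ihh1 by (metis inv_closed m_assoc)
  \<comment> \<open>Here \<open>k\<close> is the product of the commuting elements \<open>h1\<close>
    and \<open>h^-1\<close>, and \<open>h1^3\<close> is a conjugate of \<open>h^3\<close> by
    \<open>g\<close>, that is, \<open>h^3\<close> itself.\<close>
  have "k \<otimes> (k \<otimes> k) = h1 \<otimes> (h1 \<otimes> h1) \<otimes> inv h3"
    using c h by (simp add: k h3_def word_simps ihh1x)
  also have "h1 \<otimes> (h1 \<otimes> h1) = g \<otimes> h3 \<otimes> inv g"
    using g h by (simp add: h1_def h3_def m_assoc)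
  also have "\<dots> = h3" using gh3 by (rule commutes_conj)
  finally have "k [^] (3::nat) = \<one>" using c h k by (simp add: numeral_eq_Suc m_assoc)
  then show False using finite_order_commutator[OF g h, of 3] ne by (simp add: k_def)
qed

lemma commutator_sym: "g \<in> carrier G \<Longrightarrow> h \<in> carrier G \<Longrightarrow> commutator g h = commutator h g"
  using mult_self_eq_one_imp[of "commutator g h"] commutator_square[of g h]
  by (simp add: inv_commutator)

text \<open>With \<open>k' = g k g^-1\<close>, the letter \<open>u\<close> is chosen such that
  \<open>u, g, h\<close> have the products \<open>k'\<close>, \<open>k\<close> and
  \<open>k k'\<close> in suitable orders. All of these have trivial square, as \<open>k k'\<close>
  is the commutator \<open>[k, g]\<close>; so the second and third powers of the sequence have
  product one. Seminormality then forces \<open>k' = k\<close>.\<close>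

lemma commutes_commutator_left:
  assumes g: "g \<in> carrier G" and h: "h \<in> carrier G"
  shows "commutes g (commutator g h)"
proof -
  define k where "k = commutator g h"
  define k' where "k' = g \<otimes> k \<otimes> inv g"
  define u where "u = inv (g \<otimes> h) \<otimes> k'"
  have c: "k \<in> carrier G" "k' \<in> carrier G" "u \<in> carrier G"
    using g h by (simp_all add: k_def k'_def u_def)
  have kk: "k \<otimes> k = \<one>" unfolding k_def by (rule commutator_square[OF g h])
  then have k'k': "k' \<otimes> k' = \<one>" using conj_mult_self[OF g c(1)] by (simp add: k'_def)
  have ik: "inv k = k" "inv k' = k'" using kk k'k' c by (simp_all add: mult_self_eq_one_imp)
  have kk'kk': "(k \<otimes> k') \<otimes> (k \<otimes> k') = \<one>"
  proof -
    have "commutator k g = k \<otimes> k'" using g c ik by (simp add: commutator_def k'_def m_assoc)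
    then show ?thesis using commutator_square[of k g] g c by simp
  qed
  let ?S = "{#u, g, h#}"
  have w1: "g \<otimes> (h \<otimes> u) = k'" using g h c by (simp add: u_def word_simps)
  have w2: "h \<otimes> (u \<otimes> g) = k" using g h c by (simp add: u_def k'_def word_simps)
  have w3: "h \<otimes> (g \<otimes> u) = k \<otimes> k'"
  proof -
    have "h \<otimes> (g \<otimes> u) = commutator h g \<otimes> k'" using g h c by (simp add: u_def commutator_def word_simps)
    then show ?thesis using commutator_sym[OF h g] by (simp add: k_def)
  qed
  have "repeat_mset 2 ?S \<in> \<B>"
  proof (rule product_oneI)
    have "list_prod [g, h, u, g, h, u] = (g \<otimes> (h \<otimes> u)) \<otimes> (g \<otimes> (h \<otimes> u))"
      using g h c by (simp add: m_assoc)
    then show "list_prod [g, h, u, g, h, u] = \<one>" by (simp only: w1 k'k')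
  qed (use g h c in \<open>simp_all add: numeral_eq_Suc\<close>)
  moreover have "repeat_mset 3 ?S \<in> \<B>"
  proof (rule product_oneI)
    have "list_prod [h, u, g, g, h, u, h, g, u] =
        (h \<otimes> (u \<otimes> g)) \<otimes> (g \<otimes> (h \<otimes> u)) \<otimes> (h \<otimes> (g \<otimes> u))"
      using g h c by (simp add: m_assoc)
    then show "list_prod [h, u, g, g, h, u, h, g, u] = \<one>" by (simp only: w1 w2 w3 kk'kk')
  qed (use g h c in \<open>simp_all add: numeral_eq_Suc\<close>)
  ultimately have "?S \<in> \<B>"
    by (rule seminormal_two_three[OF seminormal_product_one, rotated]) (use g h c in auto)
  then have "k' = \<one> \<or> k \<otimes> k' = \<one>"
    using list_prod_three_product_one[of u g h] g h c by (simp add: m_assoc w1 w3)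
  then have "k' = k"
  proof
    assume "k' = \<one>"
    then have "inv g \<otimes> (g \<otimes> k \<otimes> inv g) \<otimes> g = inv g \<otimes> \<one> \<otimes> g" by (simp add: k'_def)
    then have "k = \<one>" using g c by (simp add: m_assoc)
    then show ?thesis using \<open>k' = \<one>\<close> by simp
  next
    assume "k \<otimes> k' = \<one>"
    then show ?thesis using inv_equality[of k k'] c ik by simp
  qed
  then have "g \<otimes> k \<otimes> inv g \<otimes> g = k \<otimes> g" by (simp add: k'_def)
  then have "commutes g k" using g c by (simp add: commutes_def m_assoc)
  then show ?thesis by (simp add: k_def)
qed

text \<open>Expanding \<open>[g, h^2]\<close> gives \<open>[g, h]\<close> times its conjugate by
  \<open>h\<close>, which is \<open>[g, h]^2\<close>.\<close>

lemma commutes_square: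
  assumes g: "g \<in> carrier G" and h: "h \<in> carrier G"
  shows "commutes g (h \<otimes> h)"
proof -
  have "commutator g (h \<otimes> h) = commutator g h \<otimes> (h \<otimes> commutator g h \<otimes> inv h)"
    using g h by (simp add: commutator_def word_simps)
  also have "h \<otimes> commutator g h \<otimes> inv h = commutator g h"
    using commutes_commutator_left[OF h g] commutator_sym[OF g h] by (simp add: commutes_conj)
  finally show ?thesis using g h by (simp add: commutes_commutator_iff commutator_square)
qed

text \<open>Squares are central, and a commutator is a product of squares:
  \<open>[g, h] = (g h)^2 (h^-1 g^-2 h) h^-2\<close>.\<close>

lemma commutes_commutator:
  assumes x: "x \<in> carrier G" and g: "g \<in> carrier G" and h: "h \<in> carrier G"
  shows "commutes x (commutator g h)"
proof -
  have "commutes (inv h) (inv g \<otimes> inv g)" using g h by (simp add: commutes_square)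
  then have "inv h \<otimes> (inv g \<otimes> inv g) \<otimes> inv (inv h) = inv g \<otimes> inv g" by (rule commutes_conj)
  moreover have "commutator g h =
      (g \<otimes> h \<otimes> (g \<otimes> h)) \<otimes> (inv h \<otimes> (inv g \<otimes> inv g) \<otimes> inv (inv h)) \<otimes> (inv h \<otimes> inv h)"
    using g h by (simp add: commutator_def word_simps)
  ultimately have "commutator g h = (g \<otimes> h \<otimes> (g \<otimes> h)) \<otimes> (inv g \<otimes> inv g) \<otimes> (inv h \<otimes> inv h)"
    by simp
  then show ?thesis using x g h by (simp add: commutes_mult commutes_square)
qed

text \<open>Centrality removes the conjugation from the usual commutator identity, so commutators
  are multiplicative in each argument.\<close>

lemma commutator_mult_left:
  assumes c: "x \<in> carrier G" "y \<in> carrier G" "z \<in> carrier G"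
  shows "commutator (x \<otimes> y) z = commutator x z \<otimes> commutator y z"
proof -
  have "commutator (x \<otimes> y) z = x \<otimes> commutator y z \<otimes> inv x \<otimes> commutator x z"
    using c by (simp add: commutator_def word_simps)
  also have "x \<otimes> commutator y z \<otimes> inv x = commutator y z"
    using c by (simp add: commutes_conj commutes_commutator)
  also have "commutator y z \<otimes> commutator x z = commutator x z \<otimes> commutator y z"
    using commutes_commutator[of "commutator y z" x z] c by (simp add: commutes_def)
  finally show ?thesis .
qed

lemma commutator_mult_right:
  assumes c: "x \<in> carrier G" "y \<in> carrier G" "z \<in> carrier G"
  shows "commutator z (x \<otimes> y) = commutator z x \<otimes> commutator z y"
  using commutator_mult_left[OF c] commutator_sym c by simp

text \<open>
  With \<open>s\<^sub>4 = (s\<^sub>1 s\<^sub>2 s\<^sub>3)\<^sup>-\<^sup>1 c\<close> and \<open>c = [s\<^sub>1, s\<^sub>3]\<close>, the six products of \<open>s\<^sub>1, \<dots>, s\<^sub>4\<close> avoid exactly the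
  transposition of the non-adjacent letters \<open>s\<^sub>1\<close> and \<open>s\<^sub>3\<close>, which becomes possible in higher powers.
\<close>

lemma no_three_distinct_commutators:
  assumes s: "s1 \<in> carrier G" "s2 \<in> carrier G" "s3 \<in> carrier G"
    and ne: "commutator s1 s2 \<noteq> \<one>" "commutator s2 s3 \<noteq> \<one>" "commutator s1 s3 \<noteq> \<one>"
  shows "commutator s1 s2 = commutator s2 s3 \<or> commutator s1 s2 = commutator s1 s3 \<or>
    commutator s2 s3 = commutator s1 s3"
proof (rule ccontr)
  assume distinct: "\<not> ?thesis"
  define a where "a = commutator s1 s2"
  define b where "b = commutator s2 s3"
  define c where "c = commutator s1 s3"
  define s4 where "s4 = inv (s1 \<otimes> (s2 \<otimes> s3)) \<otimes> c"
  have abc: "a \<in> carrier G" "b \<in> carrier G" "c \<in> carrier G" "s4 \<in> carrier G"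
    using s by (simp_all add: a_def b_def c_def s4_def)
  have sq: "a \<otimes> a = \<one>" "b \<otimes> b = \<one>" "c \<otimes> c = \<one>"
    using s by (simp_all add: a_def b_def c_def commutator_square)
  have sqx: "a \<otimes> (a \<otimes> x) = x" "b \<otimes> (b \<otimes> x) = x" "c \<otimes> (c \<otimes> x) = x" if "x \<in> carrier G" for x
    using abc sq that by (simp_all add: m_assoc[symmetric])
  have central: "x \<otimes> a = a \<otimes> x" "x \<otimes> b = b \<otimes> x" "x \<otimes> c = c \<otimes> x" if "x \<in> carrier G" for x
    using commutes_commutator[OF that] s by (simp_all add: a_def b_def c_def commutes_def)
  have centralx: "x \<otimes> (a \<otimes> y) = a \<otimes> (x \<otimes> y)" "x \<otimes> (b \<otimes> y) = b \<otimes> (x \<otimes> y)"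
    "x \<otimes> (c \<otimes> y) = c \<otimes> (x \<otimes> y)" if "x \<in> carrier G" "y \<in> carrier G" for x y
    using central[OF that(1)] abc that by (simp_all add: m_assoc[symmetric])
  have swap: "s2 \<otimes> (s1 \<otimes> x) = a \<otimes> (s1 \<otimes> (s2 \<otimes> x))" "s3 \<otimes> (s2 \<otimes> x) = b \<otimes> (s2 \<otimes> (s3 \<otimes> x))"
    "s3 \<otimes> (s1 \<otimes> x) = c \<otimes> (s1 \<otimes> (s3 \<otimes> x))" if "x \<in> carrier G" for x
    using s that commutator_sym[OF s(1,2)] commutator_sym[OF s(2,3)] commutator_sym[OF s(1,3)]
    by (simp_all add: a_def b_def c_def) (simp_all add: commutator_def word_simps)
  have p: "s1 \<otimes> (s2 \<otimes> (s3 \<otimes> s4)) = c"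
    using s abc by (simp add: s4_def word_simps)
  have px: "s1 \<otimes> (s2 \<otimes> (s3 \<otimes> (s4 \<otimes> x))) = c \<otimes> x" if "x \<in> carrier G" for x
    using p s abc that by (simp add: m_assoc[symmetric])
  have q: "s4 \<otimes> (s1 \<otimes> (s2 \<otimes> (s3 \<otimes> x))) = c \<otimes> x" if "x \<in> carrier G" for x
  proof -
    have "s4 \<otimes> (s1 \<otimes> (s2 \<otimes> (s3 \<otimes> x))) = inv (s1 \<otimes> (s2 \<otimes> s3)) \<otimes> (c \<otimes> (s1 \<otimes> (s2 \<otimes> s3) \<otimes> x))"
      using s abc that by (simp add: s4_def m_assoc)
    also have "\<dots> = c \<otimes> (inv (s1 \<otimes> (s2 \<otimes> s3)) \<otimes> (s1 \<otimes> (s2 \<otimes> s3) \<otimes> x))"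
      using s abc that by (intro centralx) auto
    also have "inv (s1 \<otimes> (s2 \<otimes> s3)) \<otimes> (s1 \<otimes> (s2 \<otimes> s3) \<otimes> x) = x"
      using s that by (simp add: word_simps)
    finally show ?thesis .
  qed
  let ?S = "{#s4, s1, s2, s3#}"
  have "repeat_mset 2 ?S \<in> \<B>"
  proof (rule product_oneI)
    show "list_prod [s1, s2, s3, s4, s1, s2, s3, s4] = \<one>"
      using s abc by (simp add: p px sq)
  qed (use s abc in \<open>simp_all add: numeral_eq_Suc\<close>)
  moreover have "repeat_mset 3 ?S \<in> \<B>"
  proof (rule product_oneI)
    \<comment> \<open>The three blocks \<open>s1 s2 s3 s4\<close>, \<open>s4 s1 s2 s3\<close>,
      \<open>s1 s2 s3 s4\<close> have product \<open>c^3\<close>. Exchanging the adjacent letters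
      \<open>s3\<close> and \<open>s1\<close> at the second join supplies the fourth factor
      \<open>c\<close>.\<close>
    have "list_prod [s1, s2, s3, s4, s4, s1, s2, s1, s3, s2, s3, s4] =
      c \<otimes> (s4 \<otimes> (s1 \<otimes> (s2 \<otimes> (c \<otimes> (c \<otimes> (s1 \<otimes> (s3 \<otimes> (s2 \<otimes> (s3 \<otimes> s4)))))))))"
      using s abc by (simp add: px sqx)
    also have "\<dots> = c \<otimes> (c \<otimes> (s4 \<otimes> (s1 \<otimes> (s2 \<otimes> (s3 \<otimes> (s1 \<otimes> (s2 \<otimes> (s3 \<otimes> s4))))))))"
      using s abc by (simp add: centralx[of s4] centralx[of s1] centralx[of s2] swap(3))
    also have "\<dots> = \<one>"
      using s abc by (simp add: p q sq sqx)
    finally show "list_prod [s1, s2, s3, s4, s4, s1, s2, s1, s3, s2, s3, s4] = \<one>" .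
  qed (use s abc in \<open>simp_all add: numeral_eq_Suc\<close>)
  ultimately have "?S \<in> \<B>"
    by (rule seminormal_two_three[OF seminormal_product_one, rotated]) (use s abc in auto)
  from list_prod_four_product_one[OF this]
  have "s1 \<otimes> (s2 \<otimes> (s3 \<otimes> s4)) = \<one> \<or> s1 \<otimes> (s3 \<otimes> (s2 \<otimes> s4)) = \<one> \<or> s2 \<otimes> (s1 \<otimes> (s3 \<otimes> s4)) = \<one> \<or>
    s2 \<otimes> (s3 \<otimes> (s1 \<otimes> s4)) = \<one> \<or> s3 \<otimes> (s1 \<otimes> (s2 \<otimes> s4)) = \<one> \<or> s3 \<otimes> (s2 \<otimes> (s1 \<otimes> s4)) = \<one>"
    using s abc by (simp add: m_assoc)
  \<comment> \<open>Starting from \<open>s1 s2 s3 s4 = c\<close>, each inversion of two letters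
    contributes their commutator. The six products are therefore \<open>c\<close>,
    \<open>b c\<close>, \<open>a c\<close>, \<open>a\<close>, \<open>b\<close> and
    \<open>a b\<close>.\<close>
  then have "c = \<one> \<or> b \<otimes> c = \<one> \<or> a \<otimes> c = \<one> \<or> c \<otimes> (a \<otimes> c) = \<one> \<or> c \<otimes> (b \<otimes> c) = \<one> \<or>
    a \<otimes> (c \<otimes> (b \<otimes> c)) = \<one>"
    using s abc by (simp add: p swap centralx[of s1] centralx[of s2] centralx[of s3])
  moreover have "c \<otimes> (a \<otimes> c) = a" "c \<otimes> (b \<otimes> c) = b" "a \<otimes> (c \<otimes> (b \<otimes> c)) = a \<otimes> b"
    using abc by (simp_all add: centralx[of a c, symmetric] central(3)[of a] central(3)[of b] sqx)
  ultimately consider "c = \<one>" | "b \<otimes> c = \<one>" | "a \<otimes> c = \<one>" | "a = \<one>" | "b = \<one>" | "a \<otimes> b = \<one>"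
    by metis
  moreover have eq: "x = y" if "x \<otimes> y = \<one>" "y \<otimes> y = \<one>" "x \<in> carrier G" "y \<in> carrier G" for x y
    using inv_equality[OF that(1,4,3)] mult_self_eq_one_imp[OF that(4,2)] by simp
  ultimately have "c = \<one> \<or> b = c \<or> a = c \<or> a = \<one> \<or> b = \<one> \<or> a = b"
    using abc sq by cases (blast intro: eq)+
  with distinct ne show False by (auto simp: a_def b_def c_def)
qed

text \<open>If \<open>z = [x, b]\<close> and \<open>w = [x, c]\<close> were different, then
  multiplying \<open>b\<close> or \<open>c\<close> by \<open>x\<close> where necessary would produce
  a triple with three distinct nontrivial commutators.\<close>

lemma commutator_unique_left:
  assumes c: "x \<in> carrier G" "b \<in> carrier G" "c \<in> carrier G"
    and ne: "commutator x b \<noteq> \<one>" "commutator x c \<noteq> \<one>"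
  shows "commutator x b = commutator x c"
proof (rule ccontr)
  assume d: "commutator x b \<noteq> commutator x c"
  define z where "z = commutator x b"
  define w where "w = commutator x c"
  define v where "v = commutator b c"
  have zw: "z \<in> carrier G" "w \<in> carrier G" "v \<in> carrier G" using c by (simp_all add: z_def w_def v_def)
  have sq: "z \<otimes> z = \<one>" "w \<otimes> w = \<one>" using c by (simp_all add: z_def w_def commutator_square)
  have comm: "w \<otimes> z = z \<otimes> w" using commutes_commutator[of w x b] c zw by (simp add: z_def commutes_def)
  have new: "z \<otimes> w \<noteq> \<one>" "z \<otimes> w \<noteq> z" "z \<otimes> w \<noteq> w"
  proof -
    show "z \<otimes> w \<noteq> \<one>" using d zw sq by (metis inv_equality mult_self_eq_one_imp w_def z_def)
    show "z \<otimes> w \<noteq> z" "z \<otimes> w \<noteq> w" using ne zw by (simp_all add: z_def w_def)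
  qed
  have xx: "commutator x x = \<one>" using c by (simp add: commutator_eq_one_iff)
  have 1: "commutator (b \<otimes> x) x = z" "commutator b x = z" "commutator x (c \<otimes> x) = w"
    using c zw xx commutator_sym[OF c(2,1)]
    by (simp_all add: commutator_mult_left commutator_mult_right z_def w_def)
  have 2: "commutator (b \<otimes> x) c = v \<otimes> w" "commutator b (c \<otimes> x) = v \<otimes> z"
    "commutator (b \<otimes> x) (c \<otimes> x) = v \<otimes> w \<otimes> z"
    using c zw xx 1(2)
    by (simp_all add: commutator_mult_left commutator_mult_right v_def w_def z_def m_assoc comm[unfolded z_def w_def])
  \<comment> \<open>A new value \<open>v = [b, c]\<close> already completes the triple. In the other
    cases replacing \<open>b\<close>, \<open>c\<close> or both by their multiples by
    \<open>x\<close> keeps the commutators \<open>z\<close> and \<open>w\<close> and turns the third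
    one into \<open>z w\<close>, which is none of \<open>1\<close>, \<open>z\<close>,
    \<open>w\<close>.\<close>
  consider "v \<notin> {\<one>, z, w}" | "v = \<one>" | "v = z" | "v = w" by blast
  then show False
  proof cases
    case 1
    then show False using no_three_distinct_commutators[of b x c] c ne d \<open>commutator b x = z\<close>
      by (auto simp: z_def w_def v_def)
  next
    case 2
    then have "commutator (b \<otimes> x) (c \<otimes> x) = z \<otimes> w"
      using \<open>commutator (b \<otimes> x) (c \<otimes> x) = v \<otimes> w \<otimes> z\<close> zw comm by simp
    then show False
      using no_three_distinct_commutators[of "b \<otimes> x" x "c \<otimes> x"] c ne d new \<open>commutator (b \<otimes> x) x = z\<close>
        \<open>commutator x (c \<otimes> x) = w\<close> by (auto simp: z_def w_def)
  next
    case 3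
    then have "commutator (b \<otimes> x) c = z \<otimes> w"
      using \<open>commutator (b \<otimes> x) c = v \<otimes> w\<close> by simp
    then show False
      using no_three_distinct_commutators[of "b \<otimes> x" x c] c ne d new \<open>commutator (b \<otimes> x) x = z\<close>
      by (auto simp: z_def w_def)
  next
    case 4
    then have "commutator b (c \<otimes> x) = z \<otimes> w"
      using \<open>commutator b (c \<otimes> x) = v \<otimes> z\<close> comm by simp
    then show False
      using no_three_distinct_commutators[of b x "c \<otimes> x"] c ne d new \<open>commutator b x = z\<close>
        \<open>commutator x (c \<otimes> x) = w\<close> by (auto simp: z_def w_def)
  qed
qed

text \<open>A nontrivial commutator across the two pairs would equal both given ones. If all of
  these are trivial, then \<open>a c\<close> has commutator \<open>[a, b]\<close> with
  \<open>b\<close> and \<open>[c, d]\<close> with \<open>d\<close>, and the previous lemma compares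
  the two.\<close>

lemma commutator_unique:
  assumes c: "a \<in> carrier G" "b \<in> carrier G" "c \<in> carrier G" "d \<in> carrier G"
    and ne: "commutator a b \<noteq> \<one>" "commutator c d \<noteq> \<one>"
  shows "commutator a b = commutator c d"
proof (rule ccontr)
  assume d: "commutator a b \<noteq> commutator c d"
  have cross: "commutator x y = \<one>" if "x \<in> {a, b}" "y \<in> {c, d}" for x y
  proof (rule ccontr)
    assume "commutator x y \<noteq> \<one>"
    have x: "x \<in> carrier G" "y \<in> carrier G" using that c by auto
    have "commutator x y = commutator a b"
      using that commutator_unique_left[of a b y] commutator_unique_left[of b a y] c ne x
        commutator_sym[of a b] \<open>commutator x y \<noteq> \<one>\<close> by auto
    moreover have "commutator y x = commutator c d"
      using that commutator_unique_left[of c d x] commutator_unique_left[of d c x] c ne x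
        commutator_sym[of c d] commutator_sym[of x y] \<open>commutator x y \<noteq> \<one>\<close> by auto
    ultimately show False using d commutator_sym[of x y] x by simp
  qed
  have "commutator (a \<otimes> c) b = commutator a b" "commutator (a \<otimes> c) d = commutator c d"
    using c cross[of a d] cross[of b c] commutator_sym[of c b]
    by (simp_all add: commutator_mult_left)
  then show False using commutator_unique_left[of "a \<otimes> c" b d] c ne d by simp
qed

lemma card_derived_le_two:
  "finite (derived G (carrier G)) \<and> card (derived G (carrier G)) \<le> 2"
proof -
  \<comment> \<open>If all commutators are trivial, \<open>z = 1\<close> serves.\<close>
  have "\<exists>z\<in>carrier G. z \<otimes> z = \<one> \<and> (\<forall>a\<in>carrier G. \<forall>b\<in>carrier G. commutator a b \<in> {\<one>, z})"
  proof (cases "\<exists>a\<in>carrier G. \<exists>b\<in>carrier G. commutator a b \<noteq> \<one>")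
    case True
    then obtain a b where ab: "a \<in> carrier G" "b \<in> carrier G" "commutator a b \<noteq> \<one>" by blast
    show ?thesis
    proof (intro bexI conjI ballI)
      fix x y assume "x \<in> carrier G" "y \<in> carrier G"
      then show "commutator x y \<in> {\<one>, commutator a b}" using commutator_unique[of x y a b] ab by blast
    qed (use ab commutator_square in simp_all)
  qed (auto intro!: bexI[of _ \<one>])
  then obtain z where z: "z \<in> carrier G" "z \<otimes> z = \<one>"
    "\<And>a b. a \<in> carrier G \<Longrightarrow> b \<in> carrier G \<Longrightarrow> commutator a b \<in> {\<one>, z}" by blast
  have "subgroup {\<one>, z} G"
    using z mult_self_eq_one_imp[of z] by (intro subgroupI) auto
  moreover have "derived_set G (carrier G) \<subseteq> {\<one>, z}"
    using z(3) by (auto simp: commutator_def)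
  ultimately have "derived G (carrier G) \<subseteq> {\<one>, z}"
    unfolding derived_def by (intro generate_subgroup_incl)
  moreover have "card {\<one>, z} \<le> 2" by (simp add: card_insert_if)
  ultimately show ?thesis
    using finite_subset[of _ "{\<one>, z}"] card_mono[of "{\<one>, z}" "derived G (carrier G)"] by auto
qed

end

section \<open>Rearranging products\<close>

context monoid
begin

lemma list_prod_commute:
  assumes "x \<in> carrier G" "set ys \<subseteq> carrier G" "\<And>y. y \<in> set ys \<Longrightarrow> x \<otimes> y = y \<otimes> x"
  shows "x \<otimes> list_prod ys = list_prod ys \<otimes> x"
  using assms
proof (induction ys)
  case (Cons y ys)
  then have c: "y \<in> carrier G" "list_prod ys \<in> carrier G" by auto
  have xy: "x \<otimes> y = y \<otimes> x" using Cons.prems(3)[of y] by simp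
  have "x \<otimes> (y \<otimes> list_prod ys) = (x \<otimes> y) \<otimes> list_prod ys"
    using m_assoc[of x y "list_prod ys"] Cons.prems(1) c by (simp only:)
  also have "\<dots> = y \<otimes> (x \<otimes> list_prod ys)" using Cons.prems(1) c by (simp add: xy m_assoc)
  also have "x \<otimes> list_prod ys = list_prod ys \<otimes> x" using Cons by simp
  also have "y \<otimes> (list_prod ys \<otimes> x) = y \<otimes> list_prod ys \<otimes> x"
    using m_assoc[of y "list_prod ys" x] Cons.prems(1) c by (simp only:)
  finally show ?case by simp
qed simp

text \<open>Commutation is asked of the letters only, so that the lemma applies to commuting words
  in a nonabelian group as well as to the quotient by \<open>G'\<close>.\<close>

lemma list_prod_mset_cong:
  assumes "mset us = mset vs" "set us \<subseteq> carrier G"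
    and "\<And>x y. x \<in> set us \<Longrightarrow> y \<in> set us \<Longrightarrow> x \<otimes> y = y \<otimes> x"
  shows "list_prod us = list_prod vs"
  using assms
proof (induction us arbitrary: vs)
  case (Cons x us)
  from Cons.prems(1) have "mset vs = add_mset x (mset us)" by simp
  then obtain ys zs where vs: "vs = ys @ x # zs" "mset (zs @ ys) = mset us"
    by (rule mset_eq_add_mset)
  have set: "set us = set ys \<union> set zs" using mset_eq_setD[OF vs(2)] by auto
  have "list_prod us = list_prod (ys @ zs)"
    using Cons.prems vs(2) by (intro Cons.IH) (auto simp: add.commute)
  then have "list_prod (x # us) = (x \<otimes> list_prod ys) \<otimes> list_prod zs"
    using Cons.prems set by (simp add: m_assoc)
  also have "x \<otimes> list_prod ys = list_prod ys \<otimes> x"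
    using Cons.prems set by (intro list_prod_commute) auto
  also have "list_prod ys \<otimes> x \<otimes> list_prod zs = list_prod vs"
    using Cons.prems set vs by (simp add: m_assoc)
  finally show ?case .
qed simp

lemma list_prod_concat_replicate:
  "set gs \<subseteq> carrier G \<Longrightarrow> list_prod (concat (replicate n gs)) = list_prod gs [^] n"
proof (induction n)
  case (Suc n)
  have "set (concat (replicate n gs)) \<subseteq> carrier G" using Suc.prems by (induction n) auto
  moreover have "list_prod gs [^] Suc n = list_prod gs \<otimes> list_prod gs [^] n"
    using Suc.prems by (intro nat_pow_Suc2) auto
  ultimately show ?case
    using Suc by (simp only: replicate_Suc concat.simps list_prod_append)
qed simp

end

lemma (in group_hom) hom_list_prod:
  "set gs \<subseteq> carrier G \<Longrightarrow> h (G.list_prod gs) = H.list_prod (map h gs)"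
  by (induction gs) auto

context group
begin

lemma derived_normal: "derived G (carrier G) \<lhd> G"
  by (rule derived_is_normal[OF normal_self])

text \<open>Two arrangements of the same letters have the same image in the abelian quotient modulo
  \<open>G'\<close>.\<close>

lemma products_quotient_derived:
  assumes "p \<in> products G S" "q \<in> products G S" "set_mset S \<subseteq> carrier G"
  shows "p \<otimes> inv q \<in> derived G (carrier G)"
proof -
  let ?N = "derived G (carrier G)"
  interpret N: normal ?N G by (rule derived_normal)
  interpret Q: comm_group "G Mod ?N" by (rule derived_quot_is_comm_group)
  interpret h: group_hom G "G Mod ?N" "\<lambda>a. ?N #> a"
    by unfold_locales (rule N.r_coset_hom_Mod)
  obtain gs hs where gs: "mset gs = S" "list_prod gs = p" "mset hs = S" "list_prod hs = q"
    using assms by (auto simp: products_eq)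
  then have c: "set gs \<subseteq> carrier G" "set hs \<subseteq> carrier G"
    using assms(3) by (metis set_mset_mset)+
  have "?N #> p = Q.list_prod (map (\<lambda>a. ?N #> a) gs)"
    using h.hom_list_prod[OF c(1)] gs by simp
  also have "\<dots> = Q.list_prod (map (\<lambda>a. ?N #> a) hs)"
  proof (intro Q.list_prod_mset_cong)
    show "set (map (\<lambda>a. ?N #> a) gs) \<subseteq> carrier (G Mod ?N)"
      using c h.hom_closed by auto
    then show "x \<otimes>\<^bsub>G Mod ?N\<^esub> y = y \<otimes>\<^bsub>G Mod ?N\<^esub> x"
      if "x \<in> set (map (\<lambda>a. ?N #> a) gs)" "y \<in> set (map (\<lambda>a. ?N #> a) gs)" for x y
      using that by (intro Q.m_comm) blast+
  qed (simp add: gs)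
  also have "\<dots> = ?N #> q" using h.hom_list_prod[OF c(2)] gs by simp
  finally have "p \<in> ?N #> q"
    using rcos_self[OF _ derived_is_subgroup, of p "carrier G"] gs c by auto
  then show ?thesis
    using gs c N.subset by (auto simp: r_coset_def m_assoc subset_iff)
qed

text \<open>Let \<open>T = a - s\<close>. All products of \<open>T\<close> lie in \<open>G'\<close>,
  so if \<open>1\<close> is not among them, the only product is the involution \<open>z\<close>.
  Then the letters of \<open>T\<close> commute pairwise, and an odd power of \<open>T\<close> has
  the sole product \<open>z\<close>, against the assumption on large powers.\<close>

lemma seminormal_of_card_derived:
  assumes fin: "finite (derived G (carrier G))" and card: "card (derived G (carrier G)) \<le> 2"
  shows "seminormal \<H>"
proof -
  let ?D = "derived G (carrier G)"
  interpret D: subgroup ?D G by (rule derived_is_subgroup) simp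
  show ?thesis
    unfolding seminormal_product_one_iff
  proof (intro ballI impI)
    fix a s
    assume a: "a \<in> \<B>" and s: "s \<in> \<B>"
      and "\<exists>n::nat. 0 < n \<and> (\<forall>m\<ge>n. \<exists>c\<in>\<B>. repeat_mset m a = c + repeat_mset m s)"
    then obtain n where n: "0 < n"
      "\<And>m. m \<ge> n \<Longrightarrow> \<exists>c\<in>\<B>. repeat_mset m a = c + repeat_mset m s"
      by blast
    have "s \<subseteq># a" by (rule repeat_mset_subsetD[OF n(1)]) (use n(2)[of n] in auto)
    define T where "T = a - s"
    have aT: "a = T + s" using \<open>s \<subseteq># a\<close> by (simp add: T_def)
    have mT: "repeat_mset m T \<in> \<B>" if "m \<ge> n" for m
      using n(2)[OF that] by (auto simp: aT)
    have Tc: "set_mset T \<subseteq> carrier G" and sc: "set_mset s \<subseteq> carrier G"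
      using product_one_carrier[of "T + s"] product_one_carrier[of s] a s by (auto simp: aT)
    have T_derived: "p \<in> ?D" if "p \<in> products G T" for p
    proof -
      have "p \<in> carrier G" using that Tc products_closed by blast
      moreover have "p \<otimes> \<one> \<in> products G a"
        unfolding aT using that s Tc sc by (intro products_add) (auto simp: in_product_one_iff)
      moreover have "\<one> \<in> products G a" "set_mset a \<subseteq> carrier G"
        using a by (auto simp: in_product_one_iff)
      ultimately show ?thesis using products_quotient_derived[of "p \<otimes> \<one>" a \<one>] by simp
    qed
    have "T \<in> \<B>"
    proof (rule ccontr)
      assume nT: "T \<notin> \<B>"
      obtain ts where ts: "mset ts = T" by (meson ex_mset)
      define z where "z = list_prod ts"
      have tsc: "set ts \<subseteq> carrier G" using ts Tc by auto
      have z: "z \<in> ?D" "z \<noteq> \<one>" "z \<in> carrier G"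
        using T_derived[of z] list_prod_in_products[of ts] ts nT Tc tsc
        by (auto simp: z_def in_product_one_iff)
      have D: "?D = {\<one>, z}"
      proof -
        have "{\<one>, z} \<subseteq> ?D" using z by simp
        moreover have "card {\<one>, z} = 2" using z by simp
        ultimately show ?thesis using card_seteq[OF fin, of "{\<one>, z}"] card by simp
      qed
      have p_eq: "p = z" if "p \<in> products G T" for p
        using T_derived[OF that] that nT Tc D by (auto simp: in_product_one_iff)
      \<comment> \<open>Placing \<open>x, y\<close> or \<open>y, x\<close> in front of the same rest
        gives the same product \<open>z\<close>.\<close>
      have comm: "x \<otimes> y = y \<otimes> x" if x: "x \<in> set ts" "y \<in> set ts" for x y
      proof (cases "x = y")
        case False
        have "y \<in># T" using x ts by auto
        with False have "y \<in># T - {#x#}" by (simp add: in_diff_count)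
        then obtain R where R: "T = {#x, y#} + R"
          using x ts by (metis add_mset_add_single insert_DiffM mset_add set_mset_mset
            union_mset_add_mset_left empty_neutral(1))
        obtain rs where rs: "mset rs = R" by (meson ex_mset)
        have c: "x \<in> carrier G" "y \<in> carrier G" "set rs \<subseteq> carrier G" using R rs Tc by auto
        have "list_prod ([x, y] @ rs) = z" "list_prod ([y, x] @ rs) = z"
          using list_prod_in_products[of "[x, y] @ rs"] list_prod_in_products[of "[y, x] @ rs"] R rs
          by (intro p_eq; simp add: add_mset_commute)+
        then have "(x \<otimes> y) \<otimes> list_prod rs = (y \<otimes> x) \<otimes> list_prod rs"
          using c by (simp add: m_assoc)
        then show ?thesis using c by simp
      qed simp
      \<comment> \<open>An odd exponent that is at least \<open>n\<close>.\<close>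
      define m where "m = 2 * n + 1"
      have "repeat_mset m T \<in> \<B>" using mT[of m] by (simp add: m_def)
      then obtain us where us: "mset us = repeat_mset m T" "set us \<subseteq> carrier G" "list_prod us = \<one>"
        by (rule product_oneE)
      have "mset (concat (replicate m ts)) = repeat_mset m T"
        using ts by (induction m) (auto)
      then have "list_prod (concat (replicate m ts)) = list_prod us"
        using us tsc by (intro list_prod_mset_cong comm) auto
      then have "z [^] m = \<one>"
        using us tsc by (simp add: list_prod_concat_replicate z_def)
      moreover have "z \<otimes> z = \<one>"
      proof -
        have "z \<otimes> z \<in> {\<one>, z}" using D z by (metis D.m_closed)
        then show ?thesis using z by auto
      qed
      then have "z [^] m = z"
        using z nat_pow_pow[of z 2 n] by (simp add: m_def numeral_2_eq_2)
      ultimately show False using z by simp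
    qed
    then show "\<exists>c\<in>\<B>. a = c + s"
      using aT by blast
  qed
qed

lemma seminormal_iff_card_derived:
  "seminormal \<H> \<longleftrightarrow>
   finite (derived G (carrier G)) \<and> card (derived G (carrier G)) \<le> 2"
proof
  assume "seminormal \<H>"
  then interpret seminormal_sequences by unfold_locales
  show "finite (derived G (carrier G)) \<and> card (derived G (carrier G)) \<le> 2"
    by (rule card_derived_le_two)
qed (simp add: seminormal_of_card_derived)

section \<open>Conditions forcing commutativity\<close>

lemma conj_pair_product_one_iff:
  assumes "g \<in> carrier G" "h \<in> carrier G"
  shows "{#g, inv (h \<otimes> g \<otimes> inv h)#} \<in> \<B> \<longleftrightarrow> commutator g h = \<one>"
proof
  assume "{#g, inv (h \<otimes> g \<otimes> inv h)#} \<in> \<B>"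
  then have "inv (h \<otimes> g \<otimes> inv h) \<otimes> g = \<one>" using assms by (simp add: pair_product_one_iff)
  then have "h \<otimes> g \<otimes> inv h \<otimes> (inv (h \<otimes> g \<otimes> inv h) \<otimes> g) = h \<otimes> g \<otimes> inv h \<otimes> \<one>"
    by (simp only:)
  then have "h \<otimes> g \<otimes> inv h = g" using assms by (simp del: inv_mult_group)
  then have "h \<otimes> g \<otimes> inv h \<otimes> h = g \<otimes> h" by simp
  then show "commutator g h = \<one>" using assms by (simp add: commutator_eq_one_iff m_assoc)
next
  assume "commutator g h = \<one>"
  then have "g \<otimes> h = h \<otimes> g" using assms by (simp add: commutator_eq_one_iff)
  then have "h \<otimes> g \<otimes> inv h = g" using assms by (metis inv_solve_right m_closed)
  then show "{#g, inv (h \<otimes> g \<otimes> inv h)#} \<in> \<B>" using assms by simp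
qed

text \<open>A single pair \<open>h, h^-1\<close> placed around the block \<open>g^n\<close>
  conjugates all of it at once, so the denominator does not grow with \<open>n\<close>.\<close>

lemma conj_pair_product_one:
  assumes "g \<in> carrier G" "h \<in> carrier G"
  shows "{#h, inv h#} + repeat_mset n {#g, inv (h \<otimes> g \<otimes> inv h)#} \<in> \<B>"
proof -
  have conj: "inv (h \<otimes> g \<otimes> inv h) [^] n = h \<otimes> inv g [^] n \<otimes> inv h"
    using assms by (induction n) (simp_all add: word_simps)
  let ?T = "{#h#} + replicate_mset n g + {#inv h#} + replicate_mset n (inv (h \<otimes> g \<otimes> inv h))"
  have "h \<otimes> g [^] n \<otimes> inv h \<otimes> inv (h \<otimes> g \<otimes> inv h) [^] n \<in> products G ?T"
    using assms by (intro products_add products_replicate) auto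
  moreover have "h \<otimes> g [^] n \<otimes> inv h \<otimes> (h \<otimes> inv g [^] n \<otimes> inv h) = \<one>"
    using assms by (simp add: m_assoc nat_pow_inv)
  ultimately have "\<one> \<in> products G ?T" unfolding conj by (simp only:)
  moreover have "?T = {#h, inv h#} + repeat_mset n {#g, inv (h \<otimes> g \<otimes> inv h)#}"
    by (simp add: multiset_eq_iff)
  moreover have "set_mset ?T \<subseteq> carrier G" using assms by auto
  ultimately show ?thesis unfolding in_product_one_iff by metis
qed

lemma comm_group_of_completely_integrally_closed:
  assumes "completely_integrally_closed \<H>"
  shows "comm_group G"
proof (rule comm_groupI_commutator)
  fix g h assume gh: "g \<in> carrier G" "h \<in> carrier G"
  let ?x = "{#g, inv (h \<otimes> g \<otimes> inv h)#}" and ?c = "{#h, inv h#}"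
  \<comment> \<open>The pair \<open>?c\<close> serves twice: as denominator, since \<open>?x\<close>
    is represented by \<open>(?c + ?x)/?c\<close>, and as the fixed multiplier that makes all powers
    integral.\<close>
  have "\<exists>c\<in>\<B>. ?c + repeat_mset n (?c + ?x) = c + repeat_mset n ?c" for n
    using conj_pair_product_one[OF gh, of n]
    by (intro bexI[of _ "?c + repeat_mset n ?x"]) (simp_all add: multiset_eq_iff algebra_simps)
  moreover have "?c \<in> \<B>" "?c + ?x \<in> \<B>"
    using gh conj_pair_product_one[OF gh, of 1] by (simp_all add: add_mset_commute)
  ultimately have "\<exists>c\<in>\<B>. ?c + ?x = c + ?c"
    using assms[unfolded completely_integrally_closed_product_one_iff] by blast
  then have "?x \<in> \<B>" by (auto simp: add_mset_commute)
  then show "commutator g h = \<one>" using gh by (simp add: conj_pair_product_one_iff)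
qed

lemma comm_group_of_root_closed:
  assumes "root_closed \<H>"
  shows "comm_group G"
proof (rule comm_groupI_commutator)
  interpret seminormal_sequences
    using root_closed_imp_seminormal[OF assms] by unfold_locales
  fix g h assume gh: "g \<in> carrier G" "h \<in> carrier G"
  have "{#commutator g h#} \<in> \<B>"
  proof (rule root_closed_product_oneD[OF assms four_product_one(1)[OF gh(2,1)]])
    show "{#commutator g h#} + {#h, g, inv h, inv g#} \<in> \<B>"
      using four_product_one(2)[OF gh(2,1)] by (simp add: add_mset_commute)
    show "repeat_mset 2 {#commutator g h#} \<in> \<B>"
      using commutator_square[OF gh] gh by (simp add: numeral_2_eq_2 pair_product_one_iff)
  qed simp
  then show "commutator g h = \<one>" by (simp add: single_product_one_iff)
qed

lemma comm_group_of_saturated: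
  assumes "saturated_submonoid (\<B>) (free_abelian_monoid G)"
  shows "comm_group G"
proof (rule comm_groupI_commutator)
  fix g h assume gh: "g \<in> carrier G" "h \<in> carrier G"
  let ?a = "{#h, g, inv h, inv g#}" and ?F = "free_abelian_monoid G"
  have "?a \<in> \<B>" "add_mset (commutator g h) ?a \<in> \<B>"
    using four_product_one[OF gh(2,1)] by simp_all
  moreover have "?a divides\<^bsub>?F\<^esub> add_mset (commutator g h) ?a"
    using gh by (auto simp: factor_def intro!: exI[of _ "{#commutator g h#}"])
  ultimately have "?a divides\<^bsub>?F\<lparr>carrier := \<B>\<rparr>\<^esub> add_mset (commutator g h) ?a"
    using assms by (auto simp: saturated_submonoid_def)
  then have "{#commutator g h#} \<in> \<B>"
    by (auto simp: factor_def)
  then show "commutator g h = \<one>" by (simp add: single_product_one_iff)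
qed

end

section \<open>Minimal primes and the weakly Krull property\<close>

context group
begin

lemma prime_s_ideal_mult_closed:
  assumes "prime_s_ideal \<H> P" "S \<in> P" "T \<in> \<B>"
  shows "S + T \<in> P"
proof -
  have "P <#>\<^bsub>\<H>\<^esub> \<B> = P"
    using assms(1) by (simp add: prime_s_ideal_def s_ideal_def)
  then show ?thesis using assms(2,3) by (fastforce simp: set_mult_def)
qed

lemma prime_s_ideal_subset:
  "prime_s_ideal \<H> P \<Longrightarrow> P \<subseteq> \<B>"
  by (simp add: prime_s_ideal_def s_ideal_def)

lemma empty_notin_prime_s_ideal:
  assumes P: "prime_s_ideal \<H> P"
  shows "{#} \<notin> P"
proof
  assume "{#} \<in> P"
  then have "\<B> \<subseteq> P"
    using prime_s_ideal_mult_closed[OF P] by fastforce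
  then have "P = \<B>" using prime_s_ideal_subset[OF P] by blast
  with P show False by (simp add: prime_s_ideal_def)
qed

lemma add_notin_prime_s_ideal:
  assumes "prime_s_ideal \<H> P"
    and "S \<in> \<B>" "T \<in> \<B>" "S \<notin> P" "T \<notin> P"
  shows "S + T \<notin> P"
  using assms by (auto simp: prime_s_ideal_def)

definition letter_prime :: "'a \<Rightarrow> 'a multiset set" where
  "letter_prime g = {S \<in> \<B>. g \<in># S}"

lemma letter_prime_prime:
  assumes "g \<in> carrier G"
  shows "prime_s_ideal \<H> (letter_prime g)" "letter_prime g \<noteq> {}"
proof -
  have "{#} \<in> \<B>" "{#} \<notin> letter_prime g" by (simp_all add: letter_prime_def)
  then have "letter_prime g \<noteq> \<B>" by blast
  moreover have "letter_prime g <#>\<^bsub>\<H>\<^esub> \<B> = letter_prime g"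
    by (fastforce simp: set_mult_def letter_prime_def)
  ultimately show "prime_s_ideal \<H> (letter_prime g)"
    unfolding prime_s_ideal_def s_ideal_def by (auto simp: letter_prime_def)
  show "letter_prime g \<noteq> {}" using assms by (auto simp: letter_prime_def intro!: exI[of _ "{#g, inv g#}"])
qed

text \<open>
  If every letter \<open>g\<close> occurred in some \<open>S\<^sub>g\<close> outside \<open>P\<close>, then any product-one \<open>g\<^sub>1 \<cdots> g\<^sub>l\<close> would
  divide \<open>S\<^sub>g\<^sub>1 \<cdots> S\<^sub>g\<^sub>l\<close>: the remainders of the \<open>S\<^sub>g\<^sub>i\<close>, taken in reverse order, have product one.
\<close>

lemma prime_contains_letter_prime:
  assumes P: "prime_s_ideal \<H> P" and ne: "P \<noteq> {}"
  obtains g where "g \<in> carrier G" "letter_prime g \<subseteq> P"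
proof -
  have "\<exists>g\<in>carrier G. letter_prime g \<subseteq> P"
  proof (rule ccontr)
    assume "\<not> (\<exists>g\<in>carrier G. letter_prime g \<subseteq> P)"
    then have out: "\<exists>S. S \<in> \<B> \<and> g \<in># S \<and> S \<notin> P" if "g \<in> carrier G" for g
      using that by (auto simp: letter_prime_def)
    have claim: "\<exists>vs. set vs \<subseteq> carrier G \<and> list_prod vs = inv (list_prod gs) \<and>
        mset gs + mset vs \<in> \<B> \<and> mset gs + mset vs \<notin> P"
      if "set gs \<subseteq> carrier G" for gs
      using that
    proof (induction gs)
      case Nil
      then show ?case using empty_notin_prime_s_ideal[OF P] by (auto intro!: exI[of _ "[]"])
    next
      case (Cons g gs)
      then obtain vs where vs: "set vs \<subseteq> carrier G" "list_prod vs = inv (list_prod gs)"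
        "mset gs + mset vs \<in> \<B>" "mset gs + mset vs \<notin> P" by auto
      obtain S where S: "S \<in> \<B>" "g \<in># S" "S \<notin> P" using out Cons.prems by auto
      then have "add_mset g (S - {#g#}) \<in> \<B>" by simp
      then obtain hs where hs: "mset hs = S - {#g#}" "set hs \<subseteq> carrier G" "list_prod hs \<otimes> g = \<one>"
        by (auto simp: add_mset_product_one_iff)
      have "list_prod hs = inv g" using hs Cons.prems inv_equality by auto
      have eq: "mset (g # gs) + mset (vs @ hs) = (mset gs + mset vs) + S"
        using S hs by simp
      show ?case
      proof (intro exI[of _ "vs @ hs"] conjI)
        show "list_prod (vs @ hs) = inv (list_prod (g # gs))"
          using vs hs Cons.prems \<open>list_prod hs = inv g\<close> by (simp add: inv_mult_group)
        show "mset (g # gs) + mset (vs @ hs) \<in> \<B>"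
          unfolding eq using vs(3) S(1) by (rule add_product_one)
        show "mset (g # gs) + mset (vs @ hs) \<notin> P"
          unfolding eq by (rule add_notin_prime_s_ideal[OF P vs(3) S(1) vs(4) S(3)])
      qed (use vs hs in simp)
    qed
    obtain S where S: "S \<in> P" using ne by blast
    then obtain gs where gs: "mset gs = S" "set gs \<subseteq> carrier G" "list_prod gs = \<one>"
      using prime_s_ideal_subset[OF P] by (blast elim: product_oneE)
    then obtain vs where vs: "set vs \<subseteq> carrier G" "list_prod vs = \<one>" "S + mset vs \<notin> P"
      using claim[OF gs(2)] by auto
    then show False
      using prime_s_ideal_mult_closed[OF P S, of "mset vs"] product_oneI[of vs] by blast
  qed
  then show thesis using that by blast
qed

lemma min_primes_letter:
  assumes "P \<in> min_primes \<H>"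
  obtains g where "g \<in> carrier G" "P = letter_prime g"
proof -
  from assms have P: "prime_s_ideal \<H> P" "P \<noteq> {}"
    and min: "\<And>Q. prime_s_ideal \<H> Q \<Longrightarrow> Q \<noteq> {} \<Longrightarrow> Q \<subseteq> P \<Longrightarrow> Q = P"
    by (auto simp: min_primes_def)
  from prime_contains_letter_prime[OF P] obtain g where "g \<in> carrier G" "letter_prime g \<subseteq> P" by blast
  then show thesis using min[of "letter_prime g"] letter_prime_prime[of g] that by blast
qed

text \<open>For \<open>g \<noteq> h\<close> some product-one sequence contains \<open>g\<close> but
  not \<open>h\<close>: the pair \<open>g, g^-1\<close> if \<open>h\<close> is not
  \<open>g^-1\<close>, and otherwise \<open>g, g, g^-2\<close>.\<close>

lemma letter_prime_subset_imp_eq: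
  assumes gh: "g \<in> carrier G" "h \<in> carrier G" and sub: "letter_prime g \<subseteq> letter_prime h"
  shows "g = h"
proof (rule ccontr)
  assume ne: "g \<noteq> h"
  show False
  proof (cases "h = inv g")
    case False
    then have "{#g, inv g#} \<in> letter_prime g - letter_prime h"
      using gh ne by (auto simp: letter_prime_def)
    with sub show False by blast
  next
    case True
    then have "{#g, g, h \<otimes> h#} \<in> \<B>"
      using gh by (intro product_oneI[of "[g, g, h \<otimes> h]"]) (auto simp: m_assoc)
    moreover have "h \<otimes> h \<noteq> h" using True ne gh by auto
    ultimately have "{#g, g, h \<otimes> h#} \<in> letter_prime g - letter_prime h"
      using ne by (auto simp: letter_prime_def)
    with sub show False by blast
  qed
qed

lemma letter_prime_min:
  assumes "g \<in> carrier G"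
  shows "letter_prime g \<in> min_primes \<H>"
proof -
  have "Q = letter_prime g"
    if Q: "prime_s_ideal \<H> Q" "Q \<noteq> {}" "Q \<subseteq> letter_prime g" for Q
  proof -
    obtain h where h: "h \<in> carrier G" "letter_prime h \<subseteq> Q"
      by (rule prime_contains_letter_prime[OF Q(1,2)])
    then have "h = g" using letter_prime_subset_imp_eq[OF h(1) assms] Q by blast
    then show ?thesis using h Q by blast
  qed
  then show ?thesis using letter_prime_prime[OF assms] by (auto simp: min_primes_def)
qed

lemma comm_group_of_weakly_krull:
  assumes wk: "weakly_krull \<H>"
  shows "comm_group G"
proof (rule comm_groupI_commutator, rule ccontr)
  interpret B: comm_monoid_cancel "\<H>"
    by (rule comm_monoid_cancel_product_one_monoid)
  fix h g assume gh: "h \<in> carrier G" "g \<in> carrier G" and ne: "commutator h g \<noteq> \<one>"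
  define k where "k = commutator h g"
  let ?s = "{#g, h, inv g, inv h#}"
  let ?x = "fraction \<H> (add_mset k ?s) ?s"
  have kc: "k \<in> carrier G" using gh by (simp add: k_def)
  have s: "?s \<in> \<B>" "add_mset k ?s \<in> \<B>"
    using four_product_one[OF gh(2,1)] by (simp_all add: k_def)
  have gh_ne: "g \<noteq> \<one>" "h \<noteq> \<one>" "g \<noteq> h"
    using ne gh by (auto simp: commutator_eq_one_iff)
  have loc: "?x \<in> localization_at \<H> P"
    if P: "P \<in> min_primes \<H>" for P
  proof -
    obtain a where a: "a \<in> carrier G" "P = letter_prime a" using P by (rule min_primes_letter)
    \<comment> \<open>One of \<open>g\<close> and \<open>h\<close> differs from \<open>a\<close>,
      and neither is trivial.\<close>
    obtain c where c: "c \<in> carrier G" "c \<noteq> \<one>" "c \<noteq> a"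
      using gh gh_ne by (cases "g = a") auto
    \<comment> \<open>Splits the letter \<open>a\<close> into \<open>c\<close> and
      \<open>c^-1 a\<close>, both different from \<open>a\<close>. Substituting these words for
      letters changes no product but removes \<open>a\<close>.\<close>
    define r where "r = (\<lambda>y. if y = a then [c, inv c \<otimes> a] else [y])"
    have inv_ca: "inv c \<otimes> a \<noteq> a" using a c by auto
    have r: "set (r y) \<subseteq> carrier G" "list_prod (r y) = y" "a \<notin> set (r y)" if "y \<in> carrier G" for y
      using that a c inv_ca by (auto simp: r_def)
    let ?t = "mset (r g) + mset (r h) + mset (r (inv g)) + mset (r (inv h))"
    have t: "?t \<in> \<B>"
      by (rule product_oneI[of "r g @ r (inv g) @ r h @ r (inv h)"]) (use gh r in simp_all)
    have kt: "add_mset k ?t \<in> \<B>"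
      by (rule product_oneI[of "[k] @ r g @ r h @ r (inv g) @ r (inv h)"])
        (use gh r kc in \<open>simp_all add: k_def commutator_def word_simps\<close>)
    have "?t \<notin> P" using r gh by (auto simp: a letter_prime_def)
    \<comment> \<open>Both fractions stand for the single letter \<open>k\<close>; only the
      denominator has changed, from \<open>?s\<close> to \<open>?t\<close> outside
      \<open>P\<close>.\<close>
    moreover have "?x = fraction \<H> (add_mset k ?t) ?t"
      using s t kt by (subst B.fraction_eq_iff) (auto simp: add.commute)
    ultimately show ?thesis using t kt by (auto simp: localization_at_def)
  qed
  have "?x \<in> carrier (quotient_group \<H>)"
    using s by (intro B.fraction_closed) simp_all
  then have "?x \<in> embedded \<H>"
    using loc wk by (auto simp: weakly_krull_def)
  then have "\<exists>c\<in>\<B>. add_mset k ?s = c + ?s"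
    using s by (subst (asm) B.fraction_in_embedded_iff) simp_all
  then have "{#k#} \<in> \<B>" by auto
  with ne show False by (simp add: single_product_one_iff k_def)
qed

section \<open>Transfer homomorphisms to Krull monoids\<close>

lemma comm_group_of_transfer_krull:
  assumes "transfer_krull TYPE('d) \<H>"
  shows "comm_group G"
proof (rule comm_groupI_commutator, rule ccontr)
  obtain D :: "'d monoid" and \<theta> where D: "krull_monoid D" and \<theta>: "transfer_hom \<H> D \<theta>"
    using assms by (auto simp: transfer_krull_def)
  interpret D: comm_monoid_cancel D using D by (simp add: krull_monoid_def)
  have hom: "\<theta> (S + T) = \<theta> S \<otimes>\<^bsub>D\<^esub> \<theta> T"
    and closed: "\<theta> S \<in> carrier D"
    if "S \<in> \<B>" "T \<in> \<B>" for S T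
    using \<theta> that by (auto simp: transfer_hom_def hom_def)
  have one: "\<theta> {#} = \<one>\<^bsub>D\<^esub>" using \<theta> by (simp add: transfer_hom_def)
  have unit: "S = {#}" if "S \<in> \<B>" "\<theta> S \<in> Units D" for S
    using \<theta> that by (auto simp: transfer_hom_def)
  have split: "\<exists>v\<in>\<B>. \<exists>w\<in>\<B>. u = v + w \<and>
      equal_up_to_unit D (\<theta> v) b \<and> equal_up_to_unit D (\<theta> w) c"
    if "u \<in> \<B>" "b \<in> carrier D" "c \<in> carrier D" "\<theta> u = b \<otimes>\<^bsub>D\<^esub> c" for u b c
    using \<theta> that by (auto simp: transfer_hom_def)
  have pow: "\<theta> (repeat_mset n S) = \<theta> S [^]\<^bsub>D\<^esub> n" if "S \<in> \<B>" for S n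
  proof (induction n)
    case (Suc n)
    have "\<theta> (repeat_mset (Suc n) S) = \<theta> (repeat_mset n S + S)" by (simp add: add.commute)
    then show ?case using Suc that by (simp only: hom repeat_product_one D.nat_pow_Suc)
  qed (simp add: one)
  have unit_of_equal: "b \<in> Units D" if eq: "equal_up_to_unit D \<one>\<^bsub>D\<^esub> b" and b: "b \<in> carrier D" for b
  proof -
    obtain e where e: "e \<in> Units D" "\<one>\<^bsub>D\<^esub> = b \<otimes>\<^bsub>D\<^esub> e" using eq by (auto simp: equal_up_to_unit_def)
    then have "e \<in> carrier D" "b \<otimes>\<^bsub>D\<^esub> e = \<one>\<^bsub>D\<^esub>" "e \<otimes>\<^bsub>D\<^esub> b = \<one>\<^bsub>D\<^esub>"
      using b D.m_comm[of e b] by auto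
    then show ?thesis using b unfolding Units_def by blast
  qed
  \<comment> \<open>Complete integral closure of \<open>D\<close> gives a quotient \<open>y\<close>
    of the two images, and (T2) lifts the factorization to \<open>?c + ?x = v + w\<close> with
    \<open>\<theta> v\<close> associated to \<open>y\<close>. As \<open>?c + ?x\<close> is an atom,
    \<open>v\<close> is empty and \<open>y\<close> is a unit.\<close>
  have key: "\<exists>e\<in>Units D. \<theta> ({#h, inv h#} + {#g, inv (h \<otimes> g \<otimes> inv h)#}) = e \<otimes>\<^bsub>D\<^esub> \<theta> {#h, inv h#}"
    if gh: "g \<in> carrier G" "h \<in> carrier G" and ne: "commutator g h \<noteq> \<one>" for g h
  proof -
    let ?c = "{#h, inv h#}" and ?x = "{#g, inv (h \<otimes> g \<otimes> inv h)#}"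
    have c: "?c \<in> \<B>" using gh by simp
    have cx: "?c + repeat_mset n ?x \<in> \<B>" for n
      using gh by (rule conj_pair_product_one)
    have cx1: "?c + ?x \<in> \<B>" using cx[of 1] by (simp add: add_mset_commute)
    have "\<exists>y\<in>carrier D. \<theta> (?c + ?x) = y \<otimes>\<^bsub>D\<^esub> \<theta> ?c"
    proof -
      have "\<exists>d\<in>carrier D. \<forall>n::nat. 0 < n \<longrightarrow> (\<exists>y\<in>carrier D.
          d \<otimes>\<^bsub>D\<^esub> \<theta> (?c + ?x) [^]\<^bsub>D\<^esub> n = y \<otimes>\<^bsub>D\<^esub> \<theta> ?c [^]\<^bsub>D\<^esub> n)"
      proof (rule bexI[of _ "\<theta> ?c"], intro allI impI)
        fix n :: nat
        have "\<theta> ?c \<otimes>\<^bsub>D\<^esub> \<theta> (?c + ?x) [^]\<^bsub>D\<^esub> n = \<theta> (?c + repeat_mset n (?c + ?x))"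
          by (simp only: hom[OF c repeat_product_one[OF cx1]] pow[OF cx1])
        also have "?c + repeat_mset n (?c + ?x) = (?c + repeat_mset n ?x) + repeat_mset n ?c"
          by (simp add: multiset_eq_iff)
        also have "\<theta> \<dots> = \<theta> (?c + repeat_mset n ?x) \<otimes>\<^bsub>D\<^esub> \<theta> ?c [^]\<^bsub>D\<^esub> n"
          by (simp only: hom[OF cx repeat_product_one[OF c]] pow[OF c])
        finally show "\<exists>y\<in>carrier D.
            \<theta> ?c \<otimes>\<^bsub>D\<^esub> \<theta> (?c + ?x) [^]\<^bsub>D\<^esub> n = y \<otimes>\<^bsub>D\<^esub> \<theta> ?c [^]\<^bsub>D\<^esub> n"
          using closed[OF cx c] by blast
      qed (rule closed[OF c c])
      moreover have "completely_integrally_closed D" using D by (simp add: krull_monoid_def)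
      ultimately show ?thesis
        using closed[OF cx1 c] closed[OF c c] unfolding D.completely_integrally_closed_iff by blast
    qed
    then obtain y where y: "y \<in> carrier D" "\<theta> (?c + ?x) = y \<otimes>\<^bsub>D\<^esub> \<theta> ?c" by blast
    then obtain v w where vw: "v \<in> \<B>" "w \<in> \<B>"
      "?c + ?x = v + w" "equal_up_to_unit D (\<theta> v) y" "equal_up_to_unit D (\<theta> w) (\<theta> ?c)"
      using split[OF cx1 y(1) closed[OF c c] y(2)] by blast
    \<comment> \<open>An empty \<open>w\<close> would make \<open>\<theta> ?c\<close> a unit, and
      only the empty sequence is sent to a unit.\<close>
    have "w \<noteq> {#}"
      using unit_of_equal[of "\<theta> ?c"] vw(5) one closed[OF c c] unit[OF c] by auto
    have nontrivial: "g \<noteq> \<one>" "h \<noteq> \<one>" using ne gh by (auto simp: commutator_eq_one_iff)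
    \<comment> \<open>No proper factor has length one, because no letter is trivial. So both factors
      have length two; the one that contains \<open>h\<close> is \<open>h, h^-1\<close>, and the
      other is \<open>?x\<close>, which lacks product one.\<close>
    have atom: "p = {#} \<or> q = {#}"
      if pq: "p \<in> \<B>" "q \<in> \<B>" "?c + ?x = p + q" "h \<in># p" for p q
    proof (rule ccontr)
      assume "\<not> (p = {#} \<or> q = {#})"
      have "inv (h \<otimes> g \<otimes> inv h) \<noteq> \<one>"
      proof
        assume "inv (h \<otimes> g \<otimes> inv h) = \<one>"
        then have "inv h \<otimes> inv (inv (h \<otimes> g \<otimes> inv h)) \<otimes> h = inv h \<otimes> inv \<one> \<otimes> h" by (simp only:)
        then show False using gh nontrivial by (simp add: word_simps)
      qed
      then have letters: "a \<noteq> \<one>" if "a \<in># ?c + ?x" for a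
        using that gh nontrivial by (simp, elim disjE) simp_all
      have size: "size S \<noteq> 1" if "S \<in> \<B>" "S \<subseteq># ?c + ?x" for S
      proof
        assume "size S = 1"
        then obtain a where "S = {#a#}" using size_1_singleton_mset by blast
        with that letters[of a] show False by (auto simp: single_product_one_iff)
      qed
      have "size p \<noteq> 1" "size q \<noteq> 1" using pq size[of p] size[of q] by simp_all
      moreover have "size p + size q = 4" using arg_cong[OF pq(3), of size] by simp
      moreover have "size p \<noteq> 0" "size q \<noteq> 0" using \<open>\<not> (p = {#} \<or> q = {#})\<close> by auto
      ultimately have "size p = 2" by linarith
      moreover obtain p' where p': "p = add_mset h p'" using pq(4) by (meson multi_member_split)
      ultimately have "size p' = 1" by simp
      then obtain b where b: "p = {#h, b#}" using p' size_1_singleton_mset by blast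
      have "{#inv h, g, inv (h \<otimes> g \<otimes> inv h)#} = add_mset b q"
        using pq(3) b by (simp add: add_mset_commute)
      have bh: "b \<in> carrier G" "b \<otimes> h = \<one>" using pq(1) b by (auto simp: pair_product_one_iff)
      then have "b = inv h" using gh inv_equality by auto
      then have "q = ?x"
        using \<open>{#inv h, g, inv (h \<otimes> g \<otimes> inv h)#} = add_mset b q\<close> by simp
      then show False using pq(2) ne gh by (simp only: conj_pair_product_one_iff)
    qed
    have "h \<in># v \<or> h \<in># w" using vw(3) by (metis union_iff union_single_eq_member add_mset_add_single)
    then have "v = {#}"
      using atom[of v w] atom[of w v] vw \<open>w \<noteq> {#}\<close> by (auto simp: add.commute)
    then have "y \<in> Units D" using unit_of_equal vw(4) one y(1) by simp
    then show ?thesis using y by blast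
  qed
  fix g h assume gh: "g \<in> carrier G" "h \<in> carrier G" and ne: "commutator g h \<noteq> \<one>"
  \<comment> \<open>Applying \<open>key\<close> to \<open>g\<close> and to \<open>g^-1\<close>
    yields units whose product is the image of \<open>?x + ?x'\<close>. This sequence has product
    one and is nonempty, a contradiction.\<close>
  have ne': "commutator (inv g) h \<noteq> \<one>"
    using gh ne commutes_inv[of h "inv g"] commutes_sym
    by (auto simp: commutes_commutator_iff[symmetric])
  let ?c = "{#h, inv h#}" and ?x = "{#g, inv (h \<otimes> g \<otimes> inv h)#}"
    and ?x' = "{#inv g, inv (h \<otimes> inv g \<otimes> inv h)#}"
  have c: "?c \<in> \<B>" using gh by simp
  have cx: "?c + ?x \<in> \<B>" "?c + ?x' \<in> \<B>"
    using conj_pair_product_one[of g h 1] conj_pair_product_one[of "inv g" h 1] gh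
    by (simp_all add: add_mset_commute)
  have xx: "?x + ?x' \<in> \<B>"
    by (rule product_oneI[of "[g, inv g, inv (h \<otimes> g \<otimes> inv h), inv (h \<otimes> inv g \<otimes> inv h)]"])
      (use gh in \<open>simp_all add: word_simps add_mset_commute\<close>)
  obtain e where e: "e \<in> Units D" "\<theta> (?c + ?x) = e \<otimes>\<^bsub>D\<^esub> \<theta> ?c" using key[OF gh ne] by blast
  obtain e' where e': "e' \<in> Units D" "\<theta> (?c + ?x') = e' \<otimes>\<^bsub>D\<^esub> \<theta> ?c"
    using key[OF _ gh(2) ne'] gh by auto
  have carr: "e \<in> carrier D" "e' \<in> carrier D" "\<theta> ?c \<in> carrier D" "\<theta> (?x + ?x') \<in> carrier D"
    using e e' closed[OF c c] closed[OF xx xx] by auto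
  have "(e \<otimes>\<^bsub>D\<^esub> e') \<otimes>\<^bsub>D\<^esub> (\<theta> ?c \<otimes>\<^bsub>D\<^esub> \<theta> ?c) = \<theta> ((?c + ?x) + (?c + ?x'))"
    using carr by (simp only: hom[OF cx] e e') (simp add: D.m_ac)
  also have "(?c + ?x) + (?c + ?x') = (?x + ?x') + (?c + ?c)" by (simp add: multiset_eq_iff)
  also have "\<theta> \<dots> = \<theta> (?x + ?x') \<otimes>\<^bsub>D\<^esub> (\<theta> ?c \<otimes>\<^bsub>D\<^esub> \<theta> ?c)"
    by (simp only: hom[OF xx add_product_one[OF c c]] hom[OF c c])
  finally have "e \<otimes>\<^bsub>D\<^esub> e' = \<theta> (?x + ?x')"
    using carr by (meson D.m_closed D.r_cancel)
  then have "\<theta> (?x + ?x') \<in> Units D" using e e' by (metis D.Units_m_closed)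
  then show False using unit[OF xx] by simp
qed

text \<open>An element whose powers are divisible by all pairs \<open>g, g^-1\<close> contains every
  letter. Conversely, for finite \<open>G\<close> the sum of all these pairs has the required
  property.\<close>

lemma G_monoid_iff_finite: "G_monoid \<H> \<longleftrightarrow> finite (carrier G)"
proof
  assume "G_monoid \<H>"
  then obtain a where a: "\<And>b. b \<in> \<B> \<Longrightarrow>
      \<exists>n::nat. b divides\<^bsub>\<H>\<^esub> (repeat_mset n a)"
    by (auto simp: G_monoid_def)
  have "carrier G \<subseteq> set_mset a"
  proof
    fix g assume "g \<in> carrier G"
    then obtain n where "{#g, inv g#} divides\<^bsub>\<H>\<^esub> (repeat_mset n a)"
      using a[of "{#g, inv g#}"] by auto
    then have "g \<in># repeat_mset n a" by (auto simp: factor_def)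
    then show "g \<in># a" by (rule subsetD[OF set_repeat_mset_subset])
  qed
  then show "finite (carrier G)" by (rule finite_subset) simp
next
  assume fin: "finite (carrier G)"
  define a where "a = (\<Sum>g\<in>carrier G. {#g, inv g#})"
  have "\<exists>n. b divides\<^bsub>\<H>\<^esub> repeat_mset n a"
    if b: "b \<in> \<B>" for b
  proof -
    have claim: "\<exists>vs R. set vs \<subseteq> carrier G \<and> list_prod vs = inv (list_prod gs) \<and>
        R \<in> \<B> \<and> mset gs + (mset vs + R) = repeat_mset (length gs) a"
      if "set gs \<subseteq> carrier G" for gs
      using that
    proof (induction gs)
      case (Cons g gs)
      then obtain vs R where vs: "set vs \<subseteq> carrier G" "list_prod vs = inv (list_prod gs)"
        "R \<in> \<B>" "mset gs + (mset vs + R) = repeat_mset (length gs) a" by auto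
      define A where "A = (\<Sum>g\<in>carrier G - {g}. {#g, inv g#})"
      have A: "A \<in> \<B>" unfolding A_def by (rule sum_product_one) auto
      have aA: "a = {#g, inv g#} + A"
        unfolding a_def A_def using fin Cons.prems by (intro sum.remove) auto
      have "mset (g # gs) + (mset (vs @ [inv g]) + (R + A)) =
          (mset gs + (mset vs + R)) + ({#g, inv g#} + A)"
        by (simp add: ac_simps)
      also have "\<dots> = repeat_mset (length (g # gs)) a" by (simp add: vs(4) aA)
      finally show ?case
        using vs A Cons.prems
        by (intro exI[of _ "vs @ [inv g]"] exI[of _ "R + A"]) (auto simp: inv_mult_group)
    qed (auto intro!: exI[of _ "[]"])
    obtain gs where gs: "mset gs = b" "set gs \<subseteq> carrier G" "list_prod gs = \<one>"
      using b by (rule product_oneE)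
    then obtain vs R where vs: "set vs \<subseteq> carrier G" "list_prod vs = \<one>"
      "R \<in> \<B>" "b + (mset vs + R) = repeat_mset (length gs) a"
      using claim[OF gs(2)] by auto
    then have "mset vs + R \<in> \<B>" using product_oneI[of vs] by auto
    then show ?thesis using vs(4) by (auto simp: factor_def intro!: exI[of _ "length gs"] bexI[of _ "mset vs + R"])
  qed
  moreover have "a \<in> \<B>" unfolding a_def by (rule sum_product_one) auto
  ultimately show "G_monoid \<H>" by (auto simp: G_monoid_def)
qed

end

section \<open>Sequences over abelian groups\<close>

context comm_group
begin

lemma in_product_one_comm_iff:
  assumes "set gs \<subseteq> carrier G"
  shows "mset gs \<in> \<B> \<longleftrightarrow> list_prod gs = \<one>"
proof
  assume "mset gs \<in> \<B>"
  then obtain hs where "mset hs = mset gs" "set hs \<subseteq> carrier G" "list_prod hs = \<one>"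
    by (rule product_oneE)
  then show "list_prod gs = \<one>"
    using list_prod_mset_cong[of hs gs] m_comm by (auto simp: subset_iff)
qed (use assms product_oneI in blast)

lemma product_one_cancel:
  assumes "S \<in> \<B>" "S + T \<in> \<B>"
  shows "T \<in> \<B>"
proof -
  obtain gs where gs: "mset gs = S" "set gs \<subseteq> carrier G" "list_prod gs = \<one>"
    using assms(1) by (rule product_oneE)
  obtain hs where hs: "mset hs = T" by (meson ex_mset)
  have hsc: "set hs \<subseteq> carrier G" using product_one_carrier[OF assms(2)] hs by auto
  then have "list_prod (gs @ hs) = \<one>"
    using in_product_one_comm_iff[of "gs @ hs"] gs hs assms(2) by simp
  then show ?thesis using in_product_one_comm_iff[of hs] gs hs hsc by simp
qed

text \<open>Over an abelian group all orders have the same product, so the complement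
  \<open>T - S\<close> automatically has product one.\<close>

lemma product_one_divides_iff:
  assumes "S \<in> \<B>" "T \<in> \<B>"
  shows "(\<exists>c\<in>\<B>. T = c + S) \<longleftrightarrow> S \<subseteq># T"
proof
  assume "S \<subseteq># T"
  then have "T = (T - S) + S" "S + (T - S) = T" by simp_all
  then show "\<exists>c\<in>\<B>. T = c + S"
    using product_one_cancel[of S "T - S"] assms by metis
qed auto

lemma saturated_product_one:
  "saturated_submonoid (\<B>) (free_abelian_monoid G)"
  unfolding saturated_submonoid_def
proof (intro conjI submonoid_product_one_sequences ballI impI)
  fix a b assume ab: "a \<in> \<B>" "b \<in> \<B>"
    and "a divides\<^bsub>free_abelian_monoid G\<^esub> b"
  then have "a \<subseteq># b" by (auto simp: factor_def)
  then obtain c where "c \<in> \<B>" "b = c + a"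
    using product_one_divides_iff[OF ab] by blast
  then show "a divides\<^bsub>free_abelian_monoid G\<lparr>carrier := \<B>\<rparr>\<^esub> b"
    by (auto simp: factor_def add.commute)
qed

lemma completely_integrally_closed_product_one:
  "completely_integrally_closed \<H>"
  unfolding completely_integrally_closed_product_one_iff
proof (intro ballI impI)
  fix a s
  assume as: "a \<in> \<B>" "s \<in> \<B>"
    and "\<exists>d\<in>\<B>. \<forall>n::nat. 0 < n \<longrightarrow>
      (\<exists>c\<in>\<B>. d + repeat_mset n a = c + repeat_mset n s)"
  then obtain d where d: "\<And>n::nat. 0 < n \<Longrightarrow> \<exists>c. d + repeat_mset n a = c + repeat_mset n s" by blast
  have "s \<subseteq># a"
  proof (rule subset_of_bounded_multiples)
    fix n :: nat assume "0 < n"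
    then obtain c where "d + repeat_mset n a = c + repeat_mset n s" using d by blast
    then show "repeat_mset n s \<subseteq># d + repeat_mset n a" by simp
  qed
  then show "\<exists>c\<in>\<B>. a = c + s"
    using product_one_divides_iff[of s a] as by simp
qed

text \<open>For nonempty \<open>I\<close> of embedded elements the infimum is attained, being taken
  over natural numbers.\<close>

definition min_mult :: "('a multiset \<times> 'a multiset) set set \<Rightarrow> 'a \<Rightarrow> nat" where
  "min_mult I g =
     Inf {count S g | S. S \<in> \<B> \<and> to_quotient \<H> S \<in> I}"

text \<open>
  Since divisibility of product-one sequences is comparison of multiplicities, \<open>(H : I)\<close>, and hence a
  \<open>v\<close>-ideal \<open>I\<close>, depends only on the minimal multiplicities in \<open>I\<close>.
\<close>

lemma fraction_in_colon_iff:
  assumes I: "I \<subseteq> embedded \<H>" "I \<noteq> {}"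
    and as: "a \<in> \<B>" "s \<in> \<B>"
  shows "fraction \<H> a s \<in> colon \<H> I \<longleftrightarrow>
    (\<forall>g. count s g \<le> count a g + min_mult I g)"
proof -
  interpret B: comm_monoid_cancel "\<H>"
    by (rule comm_monoid_cancel_product_one_monoid)
  interpret Q: comm_group "quotient_group \<H>"
    by (rule B.comm_group_quotient_group)
  let ?q = "to_quotient \<H>"
  have "fraction \<H> a s \<in> colon \<H> I \<longleftrightarrow>
      (\<forall>S\<in>\<B>. ?q S \<in> I \<longrightarrow>
        fraction \<H> a s \<otimes>\<^bsub>quotient_group \<H>\<^esub> ?q S
        \<in> embedded \<H>)"
    using I as B.fraction_closed[of a s] by (auto simp: colon_def embedded_def)
  also have "\<dots> \<longleftrightarrow> (\<forall>S\<in>\<B>. ?q S \<in> I \<longrightarrow> s \<subseteq># a + S)"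
  proof (intro ball_cong refl imp_cong)
    fix S assume S: "S \<in> \<B>"
    have "fraction \<H> a s \<otimes>\<^bsub>quotient_group \<H>\<^esub> ?q S =
        fraction \<H> (a + S) s"
      using as S by (simp add: to_quotient_def B.mult_fraction)
    then show "fraction \<H> a s \<otimes>\<^bsub>quotient_group \<H>\<^esub> ?q S
        \<in> embedded \<H> \<longleftrightarrow> s \<subseteq># a + S"
      using as S product_one_divides_iff[of s "a + S"]
      by (simp add: B.fraction_in_embedded_iff add_product_one)
  qed
  also have "\<dots> \<longleftrightarrow> (\<forall>g. count s g \<le> count a g + min_mult I g)"
  proof
    assume *: "\<forall>S\<in>\<B>. ?q S \<in> I \<longrightarrow> s \<subseteq># a + S"
    show "\<forall>g. count s g \<le> count a g + min_mult I g"
    proof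
      fix g
      let ?K = "{count S g | S. S \<in> \<B> \<and> ?q S \<in> I}"
      have "?K \<noteq> {}" using I by (auto simp: embedded_def)
      then have "min_mult I g \<in> ?K" unfolding min_mult_def by (rule Inf_nat_def1)
      then obtain S where "min_mult I g = count S g" "S \<in> \<B>" "?q S \<in> I" by blast
      then show "count s g \<le> count a g + min_mult I g"
        using * mset_subset_eq_count[of s "a + S" g] by auto
    qed
  next
    assume *: "\<forall>g. count s g \<le> count a g + min_mult I g"
    show "\<forall>S\<in>\<B>. ?q S \<in> I \<longrightarrow> s \<subseteq># a + S"
    proof (intro ballI impI mset_subset_eqI)
      fix S g assume S: "S \<in> \<B>" "?q S \<in> I"
      have "min_mult I g \<le> count S g"
        unfolding min_mult_def using S by (intro wellorder_Inf_le1) auto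
      then show "count s g \<le> count (a + S) g" using *[rule_format, of g] by simp
    qed
  qed
  finally show ?thesis .
qed

text \<open>Along an ascending chain the minimal multiplicities decrease, and they vanish outside
  the finite support of one member \<open>S0\<close>. Once their sum over that support is minimal
  they are constant, and so are the sets \<open>(H : I)\<close> and the \<open>v\<close>-ideals
  \<open>I\<close>.\<close>

lemma v_noetherian_product_one: "v_noetherian \<H>"
  unfolding v_noetherian_def
proof (intro allI impI)
  interpret B: comm_monoid_cancel "\<H>"
    by (rule comm_monoid_cancel_product_one_monoid)
  let ?q = "to_quotient \<H>"
  fix I :: "nat \<Rightarrow> ('a multiset \<times> 'a multiset) set set"
  assume I: "\<forall>n. v_ideal \<H> (I n) \<and> I n \<subseteq> I (Suc n)"
  then have v: "I n \<subseteq> embedded \<H>"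
    "colon \<H> (colon \<H> (I n)) = I n"
    for n by (auto simp: v_ideal_def)
  have mono: "I m \<subseteq> I n" if "m \<le> n" for m n
    by (rule lift_Suc_mono_le[OF _ that]) (use I in blast)
  show "\<exists>N. \<forall>n\<ge>N. I n = I N"
  proof (cases "\<exists>n. I n \<noteq> {}")
    case True
    then obtain n0 where "I n0 \<noteq> {}" by blast
    then obtain S0 where S0: "S0 \<in> \<B>" "?q S0 \<in> I n0"
      using v(1)[of n0] by (auto simp: embedded_def)
    have ne: "I n \<noteq> {}" if "n \<ge> n0" for n using mono[OF that] \<open>I n0 \<noteq> {}\<close> by blast
    have anti: "min_mult (I n) g \<le> min_mult (I m) g" if "n0 \<le> m" "m \<le> n" for m n g
      unfolding min_mult_def
    proof (rule cInf_superset_mono)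
      show "{count S g | S. S \<in> \<B> \<and> ?q S \<in> I m} \<noteq> {}"
        using S0 mono[OF that(1)] by blast
      show "{count S g | S. S \<in> \<B> \<and> ?q S \<in> I m} \<subseteq>
          {count S g | S. S \<in> \<B> \<and> ?q S \<in> I n}"
        using mono[OF that(2)] by blast
    qed simp
    have bound: "min_mult (I n) g \<le> count S0 g" if "n0 \<le> n" for n g
      unfolding min_mult_def using S0 mono[OF that] by (intro wellorder_Inf_le1) auto
    define f where "f = (\<lambda>n. \<Sum>g\<in>set_mset S0. min_mult (I n) g)"
    obtain N where N: "N \<ge> n0" "\<And>n. n \<ge> n0 \<Longrightarrow> f N \<le> f n"
      using ex_has_least_nat[of "\<lambda>n. n \<ge> n0" n0 f] by auto
    have "I n = I N" if n: "n \<ge> N" for n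
    proof -
      have "min_mult (I n) g = min_mult (I N) g" for g
      proof (cases "g \<in># S0")
        case True
        have "f n \<le> f N" unfolding f_def by (intro sum_mono anti N n)
        then have eq: "f n = f N" using N n by (simp add: antisym)
        show ?thesis
          by (rule sum_mono_inv[OF eq[unfolded f_def] anti[OF N(1) n] True]) simp
      next
        case False
        then show ?thesis using bound[of n g] bound[of N g] N n by (simp add: not_in_iff)
      qed
      then have iff: "fraction \<H> a s \<in> colon \<H> (I n) \<longleftrightarrow>
          fraction \<H> a s \<in> colon \<H> (I N)"
        if "a \<in> \<B>" "s \<in> \<B>" for a s
        using fraction_in_colon_iff[OF v(1)[of n] ne that] fraction_in_colon_iff[OF v(1)[of N] ne that] N n
        by simp
      have "x \<in> colon \<H> (I n) \<longleftrightarrow> x \<in> colon \<H> (I N)" for x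
      proof (cases "x \<in> carrier (quotient_group \<H>)")
        case True
        then show ?thesis using iff by (auto simp: B.carrier_quotient_group)
      qed (simp add: colon_def)
      then have "colon \<H> (I n) = colon \<H> (I N)" by (rule Set.set_eqI)
      then show ?thesis by (metis v(2))
    qed
    then show ?thesis by blast
  qed auto
qed

lemma krull_monoid_product_one: "krull_monoid \<H>"
  by (simp add: krull_monoid_def completely_integrally_closed_product_one
      v_noetherian_product_one comm_monoid_cancel_product_one_monoid)

lemma root_closed_product_one: "root_closed \<H>"
  unfolding root_closed_product_one_iff
proof (intro ballI impI)
  fix a s
  assume as: "a \<in> \<B>" "s \<in> \<B>"
    and "\<exists>n::nat. 0 < n \<and> (\<exists>c\<in>\<B>. repeat_mset n a = c + repeat_mset n s)"
  then obtain c and n :: nat where n: "0 < n" "repeat_mset n a = c + repeat_mset n s" by blast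
  have "s \<subseteq># a" by (rule repeat_mset_subsetD[OF n(1)]) (simp add: n(2))
  then show "\<exists>c\<in>\<B>. a = c + s"
    using product_one_divides_iff[of s a] as by simp
qed

text \<open>Lying in the localization at the prime of the letter \<open>g\<close> bounds the
  multiplicity of \<open>g\<close> in the denominator by the one in the numerator. All letters
  together give divisibility.\<close>

lemma weakly_krull_product_one: "weakly_krull \<H>"
proof -
  interpret B: comm_monoid_cancel "\<H>"
    by (rule comm_monoid_cancel_product_one_monoid)
  have "x \<in> localization_at \<H> P"
    if "x \<in> embedded \<H>" "P \<in> min_primes \<H>" for x P
    using that empty_notin_prime_s_ideal[of P]
    by (fastforce simp: embedded_def to_quotient_def localization_at_def min_primes_def)
  moreover have "x \<in> embedded \<H>"
    if x: "x \<in> carrier (quotient_group \<H>)" and loc: "\<And>P. P \<in> min_primes \<H> \<Longrightarrow> x \<in> localization_at \<H> P" for x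
  proof -
    obtain a s where as: "x = fraction \<H> a s" "a \<in> \<B>" "s \<in> \<B>"
      using x by (auto simp: B.carrier_quotient_group)
    have "s \<subseteq># a"
    proof (rule mset_subset_eqI)
      fix g
      show "count s g \<le> count a g"
      proof (cases "g \<in> carrier G")
        case True
        then obtain b t where bt: "x = fraction \<H> b t" "b \<in> \<B>"
          "t \<in> \<B>" "t \<notin> letter_prime g"
          using loc[OF letter_prime_min[OF True]] by (auto simp: localization_at_def)
        then have "a + t = b + s" using as by (simp add: B.fraction_eq_iff)
        moreover have "count t g = 0" using bt by (simp add: letter_prime_def not_in_iff)
        ultimately have "count a g = count b g + count s g" by (metis add_0_right count_union)
        then show ?thesis by simp
      next
        case False
        then have "g \<notin># s" using product_one_carrier[OF as(3)] by blast
        then show ?thesis by (simp add: not_in_iff)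
      qed
    qed
    then show ?thesis using as product_one_divides_iff[of s a] by (simp add: B.fraction_in_embedded_iff)
  qed
  ultimately have "embedded \<H> =
      carrier (quotient_group \<H>) \<inter> (\<Inter>P\<in>min_primes \<H>. localization_at \<H> P)"
    using B.embedded_subset by blast
  moreover have "finite {P \<in> min_primes \<H>. a \<in> P}" for a
  proof (rule finite_subset)
    show "{P \<in> min_primes \<H>. a \<in> P} \<subseteq> letter_prime ` set_mset a"
      by (auto elim!: min_primes_letter simp: letter_prime_def)
  qed simp
  ultimately show ?thesis by (simp add: weakly_krull_def)
qed

lemma transfer_krull_product_one:
  "transfer_krull TYPE('a multiset) \<H>"
proof -
  have "transfer_hom \<H> \<H> (\<lambda>S. S)"
    by (auto simp: transfer_hom_def hom_def set_mult_def equal_up_to_unit_def)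
  then show ?thesis using krull_monoid_product_one unfolding transfer_krull_def by blast
qed

end

section \<open>Finite groups\<close>

context group
begin

section \<open>Cancelling letters of high multiplicity over a finite group\<close>

primrec marks :: "'a \<Rightarrow> 'a \<Rightarrow> 'a list \<Rightarrow> nat" where
  "marks g p [] = 0"
| "marks g p (a # s) = (if a = g \<and> p = \<one> then 1 else 0) + marks g (inv a \<otimes> p) s"

text \<open>\<open>marks g p t\<close> counts the letters \<open>g\<close> of \<open>t\<close> that are preceded by a prefix with product \<open>p\<close>.\<close>

lemma sum_marks:
  assumes "finite (carrier G)" "g \<in> carrier G" "set t \<subseteq> carrier G"
  shows "(\<Sum>p\<in>carrier G. marks g p t) = count (mset t) g"
  using assms(3)
proof (induction t)
  case (Cons a t)
  then have a: "a \<in> carrier G" by simp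
  \<comment> \<open>Passing the first letter \<open>a\<close> translates prefix products by
    \<open>a^-1\<close>, which only permutes the group and so preserves the sum.\<close>
  have bij: "bij_betw (\<lambda>p. inv a \<otimes> p) (carrier G) (carrier G)"
    by (rule bij_betw_byWitness[of _ "\<lambda>p. a \<otimes> p"]) (use a in auto)
  have "(\<Sum>p\<in>carrier G. marks g p (a # t)) =
      (\<Sum>p\<in>carrier G. if a = g \<and> p = \<one> then 1 else 0) + (\<Sum>p\<in>carrier G. marks g (inv a \<otimes> p) t)"
    by (simp add: sum.distrib)
  also have "(\<Sum>p\<in>carrier G. marks g (inv a \<otimes> p) t) = (\<Sum>p\<in>carrier G. marks g p t)"
    by (rule sum.reindex_bij_betw[OF bij])
  also have "(\<Sum>p\<in>carrier G. if a = g \<and> p = \<one> then 1 else 0) = (if a = g then 1 else (0::nat))"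
    using assms(1) by (cases "a = g") simp_all
  finally show ?case using Cons by simp
qed simp

text \<open>
  Between two marked letters \<open>g\<close> the word reads \<open>g B\<close> with \<open>B\<close> of product \<open>g\<^sup>-\<^sup>1\<close>, so
  dropping the letter \<open>g\<close> changes the product only by a conjugate of \<open>g\<^sup>-\<^sup>1\<close>.
\<close>

lemma remove_marked:
  assumes "set t \<subseteq> carrier G" "p \<in> carrier G" "g \<in> carrier G" "Suc k \<le> marks g p t"
  shows "\<exists>t'. mset t = mset t' + replicate_mset k g \<and>
    list_prod t' = p \<otimes> inv (g [^] k) \<otimes> inv p \<otimes> list_prod t"
  using assms
proof (induction t arbitrary: p k)
  case (Cons a t)
  then have c: "a \<in> carrier G" "set t \<subseteq> carrier G" "list_prod t \<in> carrier G" "inv a \<otimes> p \<in> carrier G"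
    by auto
  show ?case
  proof (cases "a = g \<and> p = \<one>")
    case False
    then have "Suc k \<le> marks g (inv a \<otimes> p) t" using Cons.prems(4) by (simp split: if_splits)
    then obtain t' where t': "mset t = mset t' + replicate_mset k g"
      "list_prod t' = inv a \<otimes> p \<otimes> inv (g [^] k) \<otimes> inv (inv a \<otimes> p) \<otimes> list_prod t"
      using Cons.IH[OF c(2,4) Cons.prems(3)] by blast
    have "list_prod (a # t') = p \<otimes> inv (g [^] k) \<otimes> inv p \<otimes> list_prod (a # t)"
      using t'(2) c Cons.prems(2,3) by (simp add: word_simps)
    then show ?thesis using t'(1) by (intro exI[of _ "a # t'"]) simp
  next
    case True
    show ?thesis
    proof (cases k)
      case 0
      then show ?thesis using Cons.prems by (intro exI[of _ "a # t"]) auto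
    next
      case (Suc k')
      then have "Suc k' \<le> marks g (inv a \<otimes> p) t" using Cons.prems(4) True by simp
      then obtain t' where t': "mset t = mset t' + replicate_mset k' g"
        "list_prod t' = inv a \<otimes> p \<otimes> inv (g [^] k') \<otimes> inv (inv a \<otimes> p) \<otimes> list_prod t"
        using Cons.IH[OF c(2,4) Cons.prems(3)] by blast
      have "list_prod t' = inv (g [^] k) \<otimes> (g \<otimes> list_prod t)"
        using t'(2) True c Cons.prems(2,3) Suc by (simp add: word_simps)
      then show ?thesis using t'(1) True Suc c by (intro exI[of _ t']) simp
    qed
  qed
qed simp

lemma replicate_order_product_one:
  "g \<in> carrier G \<Longrightarrow> replicate_mset (order G) g \<in> \<B>"
  using products_replicate[of g "order G"] pow_order_eq_1[of g] by (simp add: in_product_one_iff)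

text \<open>By the pigeonhole principle more than \<open>order G\<close> of the letters
  \<open>g\<close> are preceded by the same prefix product. Removing \<open>order G\<close> of them
  multiplies the product by a conjugate of a trivial power.\<close>

lemma remove_letters_product_one:
  assumes fin: "finite (carrier G)" and g: "g \<in> carrier G"
    and S: "S + replicate_mset (order G) g \<in> \<B>"
    and large: "card (carrier G) * order G < count (S + replicate_mset (order G) g) g"
  shows "S \<in> \<B>"
proof -
  obtain t where t: "mset t = S + replicate_mset (order G) g" "set t \<subseteq> carrier G" "list_prod t = \<one>"
    using S by (rule product_oneE)
  have "\<exists>p\<in>carrier G. Suc (order G) \<le> marks g p t"
  proof (rule ccontr)
    assume "\<not> ?thesis"
    then have "(\<Sum>p\<in>carrier G. marks g p t) \<le> (\<Sum>p\<in>carrier G. order G)"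
      by (intro sum_mono) (simp add: not_le less_Suc_eq_le)
    then show False using large sum_marks[OF fin g t(2)] t(1) by simp
  qed
  then obtain p where p: "p \<in> carrier G" "Suc (order G) \<le> marks g p t" by blast
  then obtain t' where t': "mset t = mset t' + replicate_mset (order G) g"
    "list_prod t' = p \<otimes> inv (g [^] order G) \<otimes> inv p \<otimes> list_prod t"
    using remove_marked[OF t(2) p(1) g p(2)] by blast
  then have "mset t' = S" "list_prod t' = \<one>"
    using t p g pow_order_eq_1[OF g] by simp_all
  then show ?thesis using product_one_carrier[OF S] by (intro product_oneI[of t']) auto
qed

lemma factorial_free_abelian_monoid: "factorial_monoid (free_abelian_monoid G)"
proof -
  let ?F = "free_abelian_monoid G"
  interpret F: comm_monoid_cancel ?F by (rule comm_monoid_cancel_free_abelian_monoid)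
  have Units: "Units ?F = {{#}}" by (auto simp: Units_def)
  have divides: "S divides\<^bsub>?F\<^esub> T \<longleftrightarrow> S \<subseteq># T" if "set_mset T \<subseteq> carrier G" for S T
  proof
    assume "S \<subseteq># T"
    then have "T = S + (T - S)" by simp
    moreover have "set_mset (T - S) \<subseteq> carrier G" using that by (meson in_diffD subset_iff)
    ultimately show "S divides\<^bsub>?F\<^esub> T" unfolding factor_def by auto
  qed (auto simp: factor_def)
  have "divisor_chain_condition_monoid ?F"
  proof
    show "wf {(x, y). x \<in> carrier ?F \<and> y \<in> carrier ?F \<and> properfactor ?F x y}"
      by (rule wf_subset[OF wf_measure[of size]])
        (auto simp: properfactor_def divides intro!: mset_subset_size)
  qed
  moreover have "primeness_condition_monoid ?F"
  proof
    fix a assume a: "a \<in> carrier ?F" "irreducible ?F a"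
    then have "a \<noteq> {#}" by (auto simp: irreducible_def Units)
    then obtain g where g: "g \<in># a" by blast
    then have gc: "set_mset {#g#} \<subseteq> carrier G" using a by auto
    have "a = {#g#}"
    proof (rule ccontr)
      assume "a \<noteq> {#g#}"
      then have "properfactor ?F {#g#} a"
        using a g gc by (auto simp: properfactor_def divides subset_mset.antisym)
      then have "{#g#} \<in> Units ?F" using a gc by (simp add: irreducible_def)
      then show False by (simp add: Units)
    qed
    then show "prime ?F a" by (auto simp: prime_def Units divides)
  qed
  ultimately show ?thesis using factorial_condition_one[of ?F] by blast
qed

text \<open>A longer sequence has a letter of multiplicity above \<open>M\<close>, and deleting
  \<open>order G\<close> copies of it does not change the class; induction on the size does the
  rest.\<close>

lemma bounded_representative:
  assumes fin: "finite (carrier G)" and "set_mset y \<subseteq> carrier G"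
  shows "\<exists>z. set_mset z \<subseteq> carrier G \<and> size z \<le> card (carrier G) * (card (carrier G) * order G + order G) \<and>
    submonoid_equiv (\<B>) (free_abelian_monoid G) y z"
  using assms(2)
proof (induction y rule: measure_induct_rule[of size])
  case (less y)
  define M where "M = card (carrier G) * order G + order G"
  show ?case
  proof (cases "size y \<le> card (carrier G) * M")
    case True
    then show ?thesis using less.prems by (auto simp: M_def submonoid_equiv_def)
  next
    case False
    have "\<exists>g\<in># y. M < count y g"
    proof (rule ccontr)
      assume "\<not> ?thesis"
      then have "size y \<le> (\<Sum>g\<in>set_mset y. M)"
        unfolding size_multiset_overloaded_eq by (intro sum_mono) (auto simp: not_less)
      also have "\<dots> \<le> card (carrier G) * M"
        using card_mono[OF fin less.prems] by simp
      finally show False using False by simp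
    qed
    then obtain g where g: "g \<in># y" "M < count y g" by blast
    define z where "z = y - replicate_mset (order G) g"
    have gc: "g \<in> carrier G" using g less.prems by auto
    have y: "y = z + replicate_mset (order G) g"
      using g(2) by (simp add: z_def M_def count_le_replicate_mset_subset_eq[symmetric])
    have "order G > 0" using fin gc by (auto simp: order_def card_gt_0_iff)
    then have "size z < size y" using y by (metis less_add_same_cancel1 size_replicate_mset size_union)
    moreover have zc: "set_mset z \<subseteq> carrier G" using less.prems y by auto
    ultimately obtain w where w: "set_mset w \<subseteq> carrier G" "size w \<le> card (carrier G) * M"
      "submonoid_equiv (\<B>) (free_abelian_monoid G) z w"
      using less.IH[of z] by (auto simp: M_def)
    have "y + x \<in> \<B> \<longleftrightarrow> z + x \<in> \<B>" for x
    proof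
      assume "y + x \<in> \<B>"
      then have "(z + x) + replicate_mset (order G) g \<in> \<B>"
        by (simp add: y ac_simps)
      then show "z + x \<in> \<B>"
        by (rule remove_letters_product_one[OF fin gc]) (use g(2) in \<open>simp add: y M_def\<close>)
    next
      assume "z + x \<in> \<B>"
      then have "(z + x) + replicate_mset (order G) g \<in> \<B>"
        using replicate_order_product_one[OF gc] by blast
      then show "y + x \<in> \<B>" by (simp add: y ac_simps)
    qed
    then have "submonoid_equiv (\<B>) (free_abelian_monoid G) y w"
      using w(3) by (simp add: submonoid_equiv_def)
    then show ?thesis using w by (auto simp: M_def)
  qed
qed

lemma C_monoid_of_finite:
  assumes fin: "finite (carrier G)"
  shows "C_monoid TYPE('a multiset) \<H>"
proof -
  let ?F = "free_abelian_monoid G" and ?B = "\<B>"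
  let ?K = "card (carrier G) * (card (carrier G) * order G + order G)"
  have Units: "Units ?F = {{#}}" by (auto simp: Units_def)
  let ?cls = "\<lambda>y. {y' \<in> carrier ?F. submonoid_equiv ?B ?F y y'}"
  let ?Y = "mset ` {xs. set xs \<subseteq> carrier G \<and> length xs \<le> ?K}"
  have "reduced_class_set ?B ?F \<subseteq> ?cls ` ?Y"
  proof
    fix Q assume "Q \<in> reduced_class_set ?B ?F"
    then obtain y where "y \<in> (carrier ?F - Units ?F) \<union> {\<one>\<^bsub>?F\<^esub>}" and y: "Q = ?cls y"
      unfolding reduced_class_set_def by blast
    then have "set_mset y \<subseteq> carrier G" by auto
    then obtain z where z: "set_mset z \<subseteq> carrier G" "size z \<le> ?K" "submonoid_equiv ?B ?F y z"
      using bounded_representative[OF fin] by blast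
    obtain xs where "mset xs = z" by (meson ex_mset)
    then have "z \<in> ?Y" using z by (auto intro!: image_eqI[of _ _ xs])
    moreover have "Q = ?cls z" using z(3) by (auto simp: y submonoid_equiv_def)
    ultimately show "Q \<in> ?cls ` ?Y" by blast
  qed
  moreover have "finite ?Y" using finite_lists_length_le[OF fin] by simp
  ultimately have "finite (reduced_class_set ?B ?F)" by (meson finite_imageI finite_subset)
  then have "finite (reduced_class_set ((\<lambda>S. S) ` carrier \<H>) ?F)" by simp
  moreover have "(\<lambda>S. S) \<in> hom \<H> ?F"
    by (auto simp: hom_def dest: product_one_carrier)
  ultimately show ?thesis
    using factorial_free_abelian_monoid unfolding C_monoid_def
    by (intro exI[of _ ?F] exI[of _ "\<lambda>S. S"]) (auto simp: Units)
qed

end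

section \<open>Finite normal sets\<close>

context group
begin

lemma finite_order_of_finite_powers:
  assumes x: "x \<in> carrier G" and fin: "finite (range (\<lambda>n::nat. x [^] n))"
  shows "\<exists>n>0. x [^] (n::nat) = \<one>"
proof -
  have "\<not> inj (\<lambda>n::nat. x [^] n)" using fin finite_imageD infinite_UNIV_nat by blast
  then obtain i j :: nat where ij: "i < j" "x [^] i = x [^] j"
    unfolding inj_def by (metis nat_neq_iff)
  have "x [^] i \<otimes> x [^] (j - i) = x [^] j" using nat_pow_mult[OF x, of i "j - i"] ij(1) by simp
  then have "x [^] i \<otimes> x [^] (j - i) = x [^] i \<otimes> \<one>" using x by (simp add: ij(2))
  then have "x [^] (j - i) = \<one>" using x by simp
  then show ?thesis using ij(1) by (intro exI[of _ "j - i"]) simp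
qed

text \<open>Moving \<open>x^k\<close> to the left past a letter \<open>y\<close> replaces
  \<open>y\<close> by \<open>x^-k y x^k\<close>, which stays in \<open>A\<close> by the closure
  under conjugation.\<close>

lemma power_to_front:
  assumes A: "A \<subseteq> carrier G" and conj: "\<And>x y. x \<in> A \<Longrightarrow> y \<in> A \<Longrightarrow> inv x \<otimes> y \<otimes> x \<in> A"
    and x: "x \<in> A" and w: "set w \<subseteq> A" "k \<le> count (mset w) x"
  shows "\<exists>w'. set w' \<subseteq> A \<and> list_prod w = x [^] k \<otimes> list_prod w' \<and> length w' + k = length w"
  using w
proof (induction w arbitrary: k)
  case Nil
  then show ?case by (intro exI[of _ "[]"]) simp
next
  case (Cons y w)
  have c: "x \<in> carrier G" "y \<in> carrier G" "y \<in> A" "set w \<subseteq> carrier G" using Cons.prems x A by auto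
  show ?case
  proof (cases "y = x")
    case True
    show ?thesis
    proof (cases k)
      case 0
      then show ?thesis using Cons.prems c by (intro exI[of _ "y # w"]) auto
    next
      case (Suc k')
      then obtain w' where w': "set w' \<subseteq> A" "list_prod w = x [^] k' \<otimes> list_prod w'" "length w' + k' = length w"
        using Cons.IH[of k'] Cons.prems True by auto
      then have "list_prod w' \<in> carrier G" using A by blast
      then have "list_prod (y # w) = x [^] k \<otimes> list_prod w'"
        using w' True Suc c m_assoc[of x "x [^] k'" "list_prod w'"]
        by (simp add: nat_pow_Suc2[symmetric] del: nat_pow_Suc)
      then show ?thesis using w' Suc by (intro exI[of _ w']) simp
    qed
  next
    case False
    then obtain w' where w': "set w' \<subseteq> A" "list_prod w = x [^] k \<otimes> list_prod w'" "length w' + k = length w"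
      using Cons.IH[of k] Cons.prems by auto
    have "inv (x [^] n) \<otimes> y \<otimes> x [^] n \<in> A" for n :: nat
    proof (induction n)
      case (Suc n)
      have "inv (x [^] Suc n) \<otimes> y \<otimes> x [^] Suc n = inv x \<otimes> (inv (x [^] n) \<otimes> y \<otimes> x [^] n) \<otimes> x"
        using c by (simp add: word_simps)
      then show ?case using conj[OF x Suc] by simp
    qed (use c in simp)
    moreover have "list_prod w' \<in> carrier G" using w' A by blast
    then have "list_prod (y # w) = x [^] k \<otimes> list_prod ((inv (x [^] k) \<otimes> y \<otimes> x [^] k) # w')"
      using w' c by (simp add: word_simps)
    ultimately show ?thesis
      using w' by (intro exI[of _ "(inv (x [^] k) \<otimes> y \<otimes> x [^] k) # w'"]) simp
  qed
qed

text \<open>Dietzmann's argument: a letter occurring \<open>N\<close> times can be collected and replaced by \<open>z\<close>.\<close>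

lemma shorten_word:
  assumes A: "A \<subseteq> carrier G" "finite A" and conj: "\<And>x y. x \<in> A \<Longrightarrow> y \<in> A \<Longrightarrow> inv x \<otimes> y \<otimes> x \<in> A"
    and N: "0 < N" "\<And>x. x \<in> A \<Longrightarrow> x [^] N = z" and z: "z \<in> carrier G"
    and w: "set w \<subseteq> A"
  shows "\<exists>j w'. set w' \<subseteq> A \<and> length w' \<le> card A * N \<and> j * N + length w' = length w \<and>
    list_prod w = z [^] j \<otimes> list_prod w'"
  using w
proof (induction w rule: measure_induct_rule[of length])
  case (less w)
  show ?case
  proof (cases "length w \<le> card A * N")
    case True
    then show ?thesis using less.prems A by (intro exI[of _ 0] exI[of _ w]) auto
  next
    case False
    have "\<exists>x\<in>A. N \<le> count (mset w) x"
    proof (rule ccontr)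
      assume neg: "\<not> ?thesis"
      have "length w = (\<Sum>x\<in>set w. count (mset w) x)"
        using size_multiset_overloaded_eq[of "mset w"] by simp
      also have "\<dots> \<le> (\<Sum>x\<in>set w. N)"
        using neg less.prems by (intro sum_mono) (auto simp: not_le less_imp_le)
      also have "\<dots> \<le> card A * N" using card_mono[OF A(2) less.prems] by simp
      finally show False using False by simp
    qed
    then obtain x where x: "x \<in> A" "N \<le> count (mset w) x" by blast
    then obtain v where v: "set v \<subseteq> A" "list_prod w = x [^] N \<otimes> list_prod v" "length v + N = length w"
      using power_to_front[OF A(1) conj x(1) less.prems] by blast
    then obtain j w' where w': "set w' \<subseteq> A" "length w' \<le> card A * N" "j * N + length w' = length v"
      "list_prod v = z [^] j \<otimes> list_prod w'"
      using less.IH[of v] N(1) by auto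
    have "list_prod w' \<in> carrier G" using w' A by blast
    then have "list_prod w = z [^] Suc j \<otimes> list_prod w'"
      using v(2) w'(4) N(2)[OF x(1)] m_assoc[of z "z [^] j" "list_prod w'"] nat_pow_Suc2[of z j] z
      by simp
    then show ?thesis using w' v(3) by (intro exI[of _ "Suc j"] exI[of _ w']) simp
  qed
qed

text \<open>The conjugacy class of \<open>g\<close> is finite, and all its members have the same
  central \<open>N\<close>-th power \<open>z\<close>. A word of length \<open>N\<close> over the
  class represents \<open>z [g, h]\<close>, so shortening its powers leaves finitely many values for
  the powers of \<open>[g, h]\<close>.\<close>

lemma commutator_finite_order:
  assumes g: "g \<in> carrier G" and h: "h \<in> carrier G"
    and fin: "finite {u \<otimes> g \<otimes> inv u | u. u \<in> carrier G}"
    and N: "0 < N" "\<And>x. x \<in> carrier G \<Longrightarrow> commutes x (g [^] (N::nat))"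
  shows "\<exists>n>0. commutator g h [^] (n::nat) = \<one>"
proof -
  let ?A = "{u \<otimes> g \<otimes> inv u | u. u \<in> carrier G}"
  define z where "z = g [^] N"
  have z: "z \<in> carrier G" using g by (simp add: z_def)
  have A: "?A \<subseteq> carrier G" using g by auto
  have conj: "inv x \<otimes> y \<otimes> x \<in> ?A" if "x \<in> ?A" "y \<in> ?A" for x y
  proof -
    obtain v where v: "v \<in> carrier G" "y = v \<otimes> g \<otimes> inv v" using \<open>y \<in> ?A\<close> by blast
    have x: "x \<in> carrier G" using \<open>x \<in> ?A\<close> A by blast
    have "inv x \<otimes> y \<otimes> x = (inv x \<otimes> v) \<otimes> g \<otimes> inv (inv x \<otimes> v)"
      using v x g by (simp add: word_simps)
    then show ?thesis using v x by blast
  qed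
  have xN: "x [^] N = z" if x: "x \<in> ?A" for x
  proof -
    obtain u where u: "u \<in> carrier G" "x = u \<otimes> g \<otimes> inv u" using x by blast
    have "x [^] n = u \<otimes> g [^] n \<otimes> inv u" for n :: nat
      using u g by (induction n) (simp_all add: m_assoc)
    then show ?thesis using commutes_conj[OF N(2)[OF u(1)]] by (simp add: z_def)
  qed
  define a where "a = h \<otimes> g \<otimes> inv h"
  have "a \<in> ?A" unfolding a_def using h by blast
  moreover have "g \<in> ?A" using g by (intro CollectI exI[of _ \<one>]) simp
  ultimately have a: "a \<in> ?A" "g \<in> ?A" "a \<in> carrier G" using A by blast+
  \<comment> \<open>With \<open>a = h g h^-1\<close> we have \<open>[g, h] = g a^-1\<close>, and
    \<open>a^-1\<close> is replaced by \<open>a^(N-1) = z a^-1\<close> to obtain a word over the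
    class.\<close>
  define v where "v = g # replicate (N - 1) a"
  have v: "set v \<subseteq> ?A" "length v = N" using a N(1) by (auto simp: v_def)
  define k where "k = commutator g h"
  have k: "k \<in> carrier G" using g h by (simp add: k_def)
  have lp_rep: "list_prod (replicate n a) = a [^] n" for n
  proof (induction n)
    case (Suc n)
    then show ?case using nat_pow_Suc2[OF a(3), of n] by (simp only: replicate_Suc list_prod_Cons)
  qed simp
  have "a [^] N = a [^] (N - 1) \<otimes> a" using N(1) by (cases N) simp_all
  then have "a [^] (N - 1) = z \<otimes> inv a" using a xN[OF a(1)] z by (simp add: m_assoc)
  then have "list_prod v = g \<otimes> (z \<otimes> inv a)" by (simp add: v_def lp_rep)
  also have "\<dots> = z \<otimes> (g \<otimes> inv a)"
    using N(2)[OF g] g a z by (simp add: m_assoc[symmetric] z_def commutes_def)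
  also have "g \<otimes> inv a = k" using g h by (simp add: k_def commutator_def a_def word_simps)
  finally have vk: "list_prod v = z \<otimes> k" .
  have zx: "commutes x z" if "x \<in> carrier G" for x using N(2)[OF that] by (simp add: z_def)
  let ?W = "(\<lambda>(i, w). inv (z [^] i) \<otimes> list_prod w) `
    ({..card ?A} \<times> {w. set w \<subseteq> ?A \<and> length w \<le> card ?A * N})"
  have "k [^] n \<in> ?W" for n :: nat
  proof -
    have "set (concat (replicate n v)) \<subseteq> ?A" using v(1) by (induction n) auto
    then obtain j w where w: "set w \<subseteq> ?A" "length w \<le> card ?A * N"
      "j * N + length w = length (concat (replicate n v))"
      "list_prod (concat (replicate n v)) = z [^] j \<otimes> list_prod w"
      using shorten_word[OF A fin conj N(1) xN z] by meson
    have wc: "list_prod w \<in> carrier G" using w A by blast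
    have len: "j * N + length w = n * N"
      using w(3) v(2) by (simp add: length_concat sum_list_replicate)
    then have "j \<le> n" using N(1) by (metis le_add1 mult_le_cancel2 not_less0)
    \<comment> \<open>The shortened word has length at most \<open>card ?A * N\<close>, so the
      length equation keeps \<open>n - j\<close>, the remaining power of \<open>z\<close>,
      bounded.\<close>
    have "n * N \<le> (j + card ?A) * N" using len w(2) by (simp add: add_mult_distrib)
    then have "n - j \<le> card ?A" using N(1) by simp
    have "(z \<otimes> k) [^] n = z [^] n \<otimes> k [^] n"
    proof -
      have "commutes z k" using zx[OF k] by (rule commutes_sym)
      then show ?thesis using pow_mult_distrib[of z k n] z k by (simp add: commutes_def)
    qed
    moreover have "(z \<otimes> k) [^] n = z [^] j \<otimes> list_prod w"
      using w(4) v(1) A by (simp add: list_prod_concat_replicate vk[symmetric] subset_trans[OF v(1) A])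
    moreover have "z [^] n = z [^] j \<otimes> z [^] (n - j)" using \<open>j \<le> n\<close> z by (simp add: nat_pow_mult)
    ultimately have "z [^] j \<otimes> (z [^] (n - j) \<otimes> k [^] n) = z [^] j \<otimes> list_prod w"
      using z k by (simp add: m_assoc)
    then have "z [^] (n - j) \<otimes> k [^] n = list_prod w" using z k wc by simp
    then have "inv (z [^] (n - j)) \<otimes> (z [^] (n - j) \<otimes> k [^] n) = inv (z [^] (n - j)) \<otimes> list_prod w"
      by simp
    then have "k [^] n = inv (z [^] (n - j)) \<otimes> list_prod w" using z k by simp
    then show ?thesis using \<open>n - j \<le> card ?A\<close> w(1,2)
      by (intro image_eqI[of _ _ "(n - j, w)"]) auto
  qed
  then have sub: "range (\<lambda>n::nat. k [^] n) \<subseteq> ?W" by (rule image_subsetI)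
  have "finite ?W" using finite_lists_length_le[OF fin] by simp
  with sub have "finite (range (\<lambda>n::nat. k [^] n))" by (rule finite_subset)
  then have "\<exists>n>0. k [^] (n::nat) = \<one>" by (rule finite_order_of_finite_powers[OF k])
  then show ?thesis by (simp only: k_def)
qed

text \<open>The finite set of commutators is closed under inverses and conjugation, and
  \<open>N\<close> is a common exponent. Shortening with \<open>z = 1\<close> bounds the length of
  the words needed to represent elements of \<open>G'\<close>.\<close>

lemma finite_derived:
  assumes fin: "finite (derived_set G (carrier G))"
    and ord: "\<And>g h. g \<in> carrier G \<Longrightarrow> h \<in> carrier G \<Longrightarrow> \<exists>n>0. commutator g h [^] (n::nat) = \<one>"
  shows "finite (derived G (carrier G))"
proof -
  let ?C = "derived_set G (carrier G)"
  have C: "?C = {commutator g h | g h. g \<in> carrier G \<and> h \<in> carrier G}"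
    by (auto simp: commutator_def)
  have Cc: "?C \<subseteq> carrier G" by (auto simp: C)
  have conj: "inv x \<otimes> y \<otimes> x \<in> ?C" if xy: "x \<in> ?C" "y \<in> ?C" for x y
  proof -
    have x: "x \<in> carrier G" using xy(1) Cc by blast
    have "\<exists>g h. g \<in> carrier G \<and> h \<in> carrier G \<and> y = commutator g h"
      using xy(2) unfolding C by auto
    then obtain g h where gh: "g \<in> carrier G" "h \<in> carrier G" "y = commutator g h" by blast
    have "inv x \<otimes> y \<otimes> x = commutator (inv x \<otimes> g \<otimes> x) (inv x \<otimes> h \<otimes> x)"
      using x gh by (simp add: commutator_def word_simps)
    then show ?thesis unfolding C using x gh by blast
  qed
  have "\<forall>c\<in>?C. \<exists>n>0. c [^] (n::nat) = \<one>" unfolding C using ord by blast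
  from bchoice[OF this] obtain f :: "'a \<Rightarrow> nat" where "\<forall>c\<in>?C. f c > 0 \<and> c [^] f c = \<one>" ..
  then have f: "f c > 0 \<and> c [^] f c = \<one>" if "c \<in> ?C" for c using that by (rule bspec)
  define N where "N = (\<Prod>c\<in>?C. f c)"
  have N: "N > 0" using f by (auto simp: N_def intro!: prod_pos)
  have cN: "c [^] N = \<one>" if "c \<in> ?C" for c
  proof -
    have "f c dvd N" unfolding N_def using fin that by (rule dvd_prodI)
    then obtain q where "N = f c * q" by (elim dvdE)
    moreover have "c \<in> carrier G" using that Cc by blast
    ultimately show ?thesis using f[OF that] by (simp add: nat_pow_pow[symmetric])
  qed
  let ?W = "list_prod ` {w. set w \<subseteq> ?C \<and> length w \<le> card ?C * N}"
  have word: "\<exists>w. set w \<subseteq> ?C \<and> x = list_prod w" if "x \<in> generate G ?C" for x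
    using that
  proof (induction rule: generate.induct)
    case one
    then show ?case by (intro exI[of _ "[]"]) simp
  next
    case (incl h)
    then have "h \<in> carrier G" using Cc by blast
    with incl show ?case by (intro exI[of _ "[h]"]) auto
  next
    case (inv h)
    then obtain a b where ab: "a \<in> carrier G" "b \<in> carrier G" "h = commutator a b"
      unfolding C by blast
    then have "inv h = commutator b a" by (simp add: inv_commutator)
    then have "inv h \<in> ?C" unfolding C using ab by blast
    then have "inv h \<in> carrier G" using Cc by blast
    with \<open>inv h \<in> ?C\<close> show ?case by (intro exI[of _ "[inv h]"]) auto
  next
    case (eng x y)
    then obtain v w where "set v \<subseteq> ?C" "x = list_prod v" "set w \<subseteq> ?C" "y = list_prod w" by blast
    then show ?case using Cc by (intro exI[of _ "v @ w"]) (simp add: subset_trans[OF _ Cc])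
  qed
  have "derived G (carrier G) \<subseteq> ?W"
  proof
    fix x assume "x \<in> derived G (carrier G)"
    then have "x \<in> generate G ?C" by (simp only: derived_def)
    from word[OF this] obtain w where w: "set w \<subseteq> ?C" "x = list_prod w" by (elim exE conjE)
    have "\<exists>j w'. set w' \<subseteq> ?C \<and> length w' \<le> card ?C * N \<and> j * N + length w' = length w \<and>
        list_prod w = \<one> [^] j \<otimes> list_prod w'"
      by (rule shorten_word[OF Cc fin conj N cN one_closed w(1)])
    then obtain j :: nat and w' where w': "set w' \<subseteq> ?C" "length w' \<le> card ?C * N"
      "list_prod w = \<one> [^] j \<otimes> list_prod w'" by (elim exE conjE)
    moreover have "list_prod w' \<in> carrier G" using w'(1) Cc by blast
    ultimately show "x \<in> ?W" using w(2) by auto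
  qed
  moreover have "finite ?W" using finite_lists_length_le[OF fin] by simp
  ultimately show ?thesis by (rule finite_subset)
qed

end

section \<open>C-monoids\<close>

text \<open>If \<open>m\<close> copies of \<open>A\<close> as well as \<open>C\<close> and
  \<open>A + C\<close> have product one, this shows that \<open>m\<close> copies of \<open>C\<close>
  are a common denominator for all powers of \<open>A\<close>.\<close>

lemma repeat_mset_div_mod:
  assumes "r \<le> m"
  shows "repeat_mset m C + repeat_mset (q * m + r) A =
    repeat_mset q (repeat_mset m A) + repeat_mset r (A + C) + repeat_mset (m - r) C"
proof -
  obtain d where "m = r + d" using assms le_Suc_ex by blast
  then show ?thesis by (simp add: multiset_eq_iff algebra_simps)
qed

section \<open>Divisibility in factorial monoids\<close>

context factorial_monoid
begin

text \<open>The multiset of prime factors up to associates, taken from a chosen factorization of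
  each element.\<close>

lemma exists_valuation:
  "\<exists>\<nu> :: 'a \<Rightarrow> 'a set multiset. \<forall>a\<in>carrier G. \<forall>b\<in>carrier G.
     \<nu> (a \<otimes> b) = \<nu> a + \<nu> b \<and> (a divides b \<longleftrightarrow> \<nu> a \<subseteq># \<nu> b)"
proof -
  define \<phi> where "\<phi> = (\<lambda>a. SOME fs. set fs \<subseteq> carrier G \<and> wfactors G fs a)"
  have \<phi>: "set (\<phi> a) \<subseteq> carrier G" "wfactors G (\<phi> a) a" if "a \<in> carrier G" for a
    using someI_ex[OF wfactors_exist[OF that]] by (auto simp: \<phi>_def)
  have "fmset G (\<phi> (a \<otimes> b)) = fmset G (\<phi> a) + fmset G (\<phi> b)"
    "a divides b \<longleftrightarrow> fmset G (\<phi> a) \<subseteq># fmset G (\<phi> b)"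
    if "a \<in> carrier G" "b \<in> carrier G" for a b
    using mult_wfactors_fmset[OF \<phi>(2)[OF that(1)] \<phi>(2)[OF that(2)] \<phi>(2)] \<phi>(1) that
      divides_fmsubset[of a b "\<phi> a" "\<phi> b"] fmsubset_divides[of "\<phi> a" "\<phi> b" a b] \<phi>(2)
    by (auto simp del: subset_mset.le_iff_add)
  then show ?thesis by (intro exI[of _ "\<lambda>a. fmset G (\<phi> a)"]) blast
qed

text \<open>This is complete integral closure of a factorial monoid, read off from the
  valuations.\<close>

lemma divides_of_powers:
  assumes c: "a \<in> carrier G" "b \<in> carrier G" "d \<in> carrier G"
    and "\<And>n::nat. 0 < n \<Longrightarrow> b [^] n divides d \<otimes> a [^] n"
  shows "b divides a"
proof -
  obtain \<nu> :: "'a \<Rightarrow> 'a set multiset" where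
    \<nu>: "\<And>a b. a \<in> carrier G \<Longrightarrow> b \<in> carrier G \<Longrightarrow> \<nu> (a \<otimes> b) = \<nu> a + \<nu> b"
      "\<And>a b. a \<in> carrier G \<Longrightarrow> b \<in> carrier G \<Longrightarrow> a divides b \<longleftrightarrow> \<nu> a \<subseteq># \<nu> b"
    using exists_valuation by blast
  have "\<nu> \<one> = {#}" using \<nu>(1)[of \<one> \<one>] by simp
  then have pow: "\<nu> (x [^] n) = repeat_mset n (\<nu> x)" if "x \<in> carrier G" for x and n :: nat
    using that by (induction n) (simp_all add: \<nu>(1) add.commute)
  have "\<nu> b \<subseteq># \<nu> a"
  proof (rule subset_of_bounded_multiples)
    fix n :: nat assume "0 < n"
    then show "repeat_mset n (\<nu> b) \<subseteq># \<nu> d + repeat_mset n (\<nu> a)"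
      using assms(4)[of n] c by (simp add: \<nu> pow)
  qed
  then show ?thesis using \<nu>(2) c by blast
qed

lemma exists_prime_divisor:
  assumes "a \<in> carrier G" "a \<notin> Units G"
  obtains p where "p \<in> carrier G" "prime G p" "p divides a"
proof -
  obtain fs where fs: "set fs \<subseteq> carrier G" "wfactors G fs a" using wfactors_exist[OF assms(1)] by blast
  have "fs \<noteq> []"
  proof
    assume "fs = []"
    then have "\<one> \<sim> a" using fs(2) by (simp add: wfactors_def)
    then show False using assms Units_cong[of \<one> a] by simp
  qed
  then obtain p where p: "p \<in> set fs" by (cases fs) auto
  then have "irreducible G p" using fs(2) by (auto simp: wfactors_def)
  moreover have "p \<in> carrier G" using p fs(1) by blast
  ultimately show thesis
    using that irreducible_prime wfactors_dividesI[OF fs(2,1) assms(1) p] by blast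
qed

lemma prime_divides_pow:
  assumes "prime G p" "p \<in> carrier G" "a \<in> carrier G" "p divides a [^] (n::nat)"
  shows "p divides a"
  using assms(4)
proof (induction n)
  case 0
  then have "p \<in> Units G" using divides_unit[of p \<one>] assms(2) by simp
  then show ?case using assms(1) by (simp add: prime_def)
next
  case (Suc n)
  then show ?case using prime_divides[of "a [^] n" a p] assms by auto
qed

end

section \<open>Common denominators and finiteness of the derived subgroup\<close>

locale C_embedding = group G + F: factorial_monoid F
  for G :: "('a, 'b) monoid_scheme" (structure) and F :: "'f monoid" and \<iota> :: "'a multiset \<Rightarrow> 'f" +
  assumes hom: "\<iota> \<in> hom \<H> F"
    and one: "\<iota> {#} = \<one>\<^bsub>F\<^esub>"
    and inj: "inj_on \<iota> (\<B>)"
    and units: "\<iota> ` Units \<H> = \<iota> ` \<B> \<inter> Units F"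
    and finite_classes: "finite (reduced_class_set (\<iota> ` \<B>) F)"
begin

abbreviation mult_F (infixl "\<cdot>" 70) where "a \<cdot> b \<equiv> a \<otimes>\<^bsub>F\<^esub> b"

abbreviation equivalent where "equivalent \<equiv> submonoid_equiv (\<iota> ` \<B>) F"

definition cls :: "'f \<Rightarrow> 'f set" where
  "cls y = {y' \<in> carrier F. equivalent y y'}"

lemma \<iota>_closed [simp]: "S \<in> \<B> \<Longrightarrow> \<iota> S \<in> carrier F"
  using hom by (auto simp: hom_def)

lemma \<iota>_add [simp]: "S \<in> \<B> \<Longrightarrow> T \<in> \<B> \<Longrightarrow> \<iota> (S + T) = \<iota> S \<cdot> \<iota> T"
  using hom by (auto simp: hom_def)

lemma \<iota>_repeat [simp]: "S \<in> \<B> \<Longrightarrow> \<iota> (repeat_mset n S) = \<iota> S [^]\<^bsub>F\<^esub> n"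
  by (induction n) (simp_all add: one F.m_comm repeat_product_one)

lemma \<iota>_eqD: "S \<in> \<B> \<Longrightarrow> T \<in> \<B> \<Longrightarrow> \<iota> S = \<iota> T \<Longrightarrow> S = T"
  using inj by (auto simp: inj_on_def)

lemma \<iota>_unit: "S \<in> \<B> \<Longrightarrow> \<iota> S \<in> Units F \<Longrightarrow> S = {#}"
  using units \<iota>_eqD[of S "{#}"] by auto

lemma cls_eqD:
  assumes "cls y = cls y'" "y \<in> carrier F"
  shows "equivalent y y'"
proof -
  have "y \<in> cls y" using assms(2) by (simp add: cls_def submonoid_equiv_def)
  then have "y \<in> cls y'" using assms(1) by (simp only:)
  then have "equivalent y' y" by (simp add: cls_def)
  then show ?thesis by (simp add: submonoid_equiv_def)
qed

lemma cls_in: "y \<in> carrier F \<Longrightarrow> y \<notin> Units F \<Longrightarrow> cls y \<in> reduced_class_set (\<iota> ` \<B>) F"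
  by (auto simp: reduced_class_set_def cls_def)

text \<open>
  One denominator per class suffices, so finitely many classes yield a common denominator \<open>T\<close>.
\<close>

lemma conductor_nonunits:
  "\<exists>T\<in>\<B>. \<forall>y\<in>carrier F - Units F. \<forall>a\<in>\<B>. \<forall>b\<in>\<B>.
     \<iota> a = y \<cdot> \<iota> b \<longrightarrow> (\<exists>c\<in>\<B>. T + a = b + c)"
proof -
  define Q where "Q = reduced_class_set (\<iota> ` \<B>) F"
  \<comment> \<open>The sequences \<open>b\<close> that clear the denominator of at least one
    element of the class \<open>q\<close>.\<close>
  define denom where "denom = (\<lambda>q b. b \<in> \<B> \<and> (\<exists>y\<in>q. y \<in> carrier F \<and> (\<exists>a\<in>\<B>. \<iota> a = y \<cdot> \<iota> b)))"
  define \<beta> where "\<beta> = (\<lambda>q. SOME b. denom q b)"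
  have \<beta>: "denom q (\<beta> q)" if "denom q b" for q b
    unfolding \<beta>_def using that by (rule someI)
  define T where "T = (\<Sum>q | q \<in> Q \<and> (\<exists>b. denom q b). \<beta> q)"
  have B\<beta>: "\<beta> q \<in> \<B>" if "\<exists>b. denom q b" for q
    using that \<beta> by (auto simp: denom_def)
  have finQ: "finite Q" unfolding Q_def by (rule finite_classes)
  have T: "T \<in> \<B>" unfolding T_def using B\<beta> by (intro sum_product_one) auto
  have "\<exists>c\<in>\<B>. T + a = b + c"
    if y: "y \<in> carrier F - Units F" and ab: "a \<in> \<B>" "b \<in> \<B>" "\<iota> a = y \<cdot> \<iota> b" for y a b
  proof -
    define q where "q = cls y"
    have "q \<in> Q" using cls_in y by (simp add: q_def Q_def)
    have "y \<in> q" using y by (simp add: q_def cls_def submonoid_equiv_def)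
    then have "denom q b" unfolding denom_def using y ab by blast
    then have d: "denom q (\<beta> q)" by (rule \<beta>)
    then obtain y1 a1 where y1: "\<beta> q \<in> \<B>" "y1 \<in> q" "y1 \<in> carrier F" "a1 \<in> \<B>" "\<iota> a1 = y1 \<cdot> \<iota> (\<beta> q)"
      by (auto simp: denom_def)
    define R where "R = (\<Sum>q' | q' \<in> Q - {q} \<and> (\<exists>b. denom q' b). \<beta> q')"
    have R: "R \<in> \<B>" unfolding R_def using B\<beta> by (intro sum_product_one) auto
    have "T = \<beta> q + R"
    proof -
      have "T = \<beta> q + (\<Sum>q \<in> {q. q \<in> Q \<and> (\<exists>b. denom q b)} - {q}. \<beta> q)"
        unfolding T_def using finQ \<open>q \<in> Q\<close> d by (intro sum.remove) auto
      also have "{q. q \<in> Q \<and> (\<exists>b. denom q b)} - {q} = {q'. q' \<in> Q - {q} \<and> (\<exists>b. denom q' b)}" by blast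
      finally show ?thesis by (simp add: R_def)
    qed
    \<comment> \<open>The summand \<open>\<beta> q\<close> of \<open>T\<close> clears the
      denominator of the representative \<open>y1\<close>; equivalence transfers this to
      \<open>y\<close>.\<close>
    then have "y1 \<cdot> \<iota> T = \<iota> (a1 + R)" using y1 R by (simp add: F.m_assoc)
    then have "y1 \<cdot> \<iota> T \<in> \<iota> ` \<B>" using y1 R by blast
    moreover have "equivalent y y1" using y1(2) by (simp add: q_def cls_def)
    ultimately have "y \<cdot> \<iota> T \<in> \<iota> ` \<B>" using T by (auto simp: submonoid_equiv_def)
    then obtain c where c: "c \<in> \<B>" "y \<cdot> \<iota> T = \<iota> c" by auto
    have "\<iota> (T + a) = \<iota> (b + c)"
      using T ab y c(1) by (simp add: ab(3) c(2)[symmetric] F.m_ac)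
    then have "T + a = b + c" using T ab c by (intro \<iota>_eqD add_product_one)
    then show ?thesis using c by blast
  qed
  with T show ?thesis by blast
qed

text \<open>A unit quotient \<open>y\<close> is not covered by the finitely many classes.
  Multiplying by the image of the trivial letter, a non-unit, reduces it to the case of
  non-units.\<close>

lemma conductor:
  "\<exists>T\<in>\<B>. \<forall>a\<in>\<B>. \<forall>b\<in>\<B>. \<iota> b divides\<^bsub>F\<^esub> \<iota> a \<longrightarrow> (\<exists>c\<in>\<B>. T + a = b + c)"
proof -
  obtain T where T: "T \<in> \<B>"
    "\<And>y a b. y \<in> carrier F - Units F \<Longrightarrow> a \<in> \<B> \<Longrightarrow> b \<in> \<B> \<Longrightarrow> \<iota> a = y \<cdot> \<iota> b \<Longrightarrow>
       \<exists>c\<in>\<B>. T + a = b + c"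
    using conductor_nonunits by blast
  have e: "{#\<one>#} \<in> \<B>" by (simp add: single_product_one_iff)
  have "\<exists>c\<in>\<B>. (T + {#\<one>#}) + a = b + c" if ab: "a \<in> \<B>" "b \<in> \<B>" "\<iota> b divides\<^bsub>F\<^esub> \<iota> a" for a b
  proof -
    obtain y where y: "y \<in> carrier F" "\<iota> a = \<iota> b \<cdot> y" using ab(3) by (auto simp: factor_def)
    have "y \<cdot> \<iota> {#\<one>#} \<notin> Units F"
    proof
      assume "y \<cdot> \<iota> {#\<one>#} \<in> Units F"
      then have "\<iota> {#\<one>#} \<cdot> y \<in> Units F" using y(1) e by (simp add: F.m_comm)
      then have "\<iota> {#\<one>#} \<in> Units F" by (rule F.unit_factor[OF _ \<iota>_closed[OF e] y(1)])
      then show False using \<iota>_unit[OF e] by simp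
    qed
    moreover have "\<iota> (a + {#\<one>#}) = (y \<cdot> \<iota> {#\<one>#}) \<cdot> \<iota> b"
      using y ab e by (simp only: \<iota>_add) (simp add: F.m_ac)
    ultimately have "\<exists>c\<in>\<B>. T + (a + {#\<one>#}) = b + c"
      using T(2)[of "y \<cdot> \<iota> {#\<one>#}" "a + {#\<one>#}" b] y ab e
        F.m_closed[OF y(1) \<iota>_closed[OF e]] add_product_one[OF ab(1) e] by blast
    then show ?thesis by (simp add: ac_simps)
  qed
  moreover have "T + {#\<one>#} \<in> \<B>" using T(1) e by (rule add_product_one)
  ultimately show ?thesis by blast
qed

text \<open>The same \<open>T\<close> serves for all powers of \<open>a\<close> and
  \<open>b\<close>, so it is a fixed error term against growing multiples.\<close>

lemma divides_imp_subset:
  assumes "a \<in> \<B>" "b \<in> \<B>" "\<iota> b divides\<^bsub>F\<^esub> \<iota> a"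
  shows "b \<subseteq># a"
proof -
  obtain T where T: "T \<in> \<B>" "\<And>a b. a \<in> \<B> \<Longrightarrow> b \<in> \<B> \<Longrightarrow> \<iota> b divides\<^bsub>F\<^esub> \<iota> a \<Longrightarrow> \<exists>c\<in>\<B>. T + a = b + c"
    using conductor by blast
  obtain y where y: "y \<in> carrier F" "\<iota> a = \<iota> b \<cdot> y" using assms(3) by (auto simp: factor_def)
  show ?thesis
  proof (rule subset_of_bounded_multiples)
    fix n :: nat assume "0 < n"
    have "\<iota> (repeat_mset n a) = \<iota> (repeat_mset n b) \<cdot> y [^]\<^bsub>F\<^esub> n"
      using assms y by (simp add: F.nat_pow_distrib)
    then have "\<iota> (repeat_mset n b) divides\<^bsub>F\<^esub> \<iota> (repeat_mset n a)"
      using y unfolding factor_def by blast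
    then obtain c where "T + repeat_mset n a = repeat_mset n b + c"
      using T(2)[of "repeat_mset n a" "repeat_mset n b"] assms by blast
    then show "repeat_mset n b \<subseteq># T + repeat_mset n a" by simp
  qed
qed

text \<open>If \<open>S = (S + b)/b\<close> is almost integral, then complete integral closure of
  \<open>F\<close> puts this quotient into \<open>F\<close>, and the conductor \<open>T\<close>
  moves it back into the monoid.\<close>

lemma almost_integral:
  "\<exists>T\<in>\<B>. \<forall>S. \<forall>b\<in>\<B>. \<forall>c\<in>\<B>. S + b \<in> \<B> \<longrightarrow> (\<forall>n. c + repeat_mset n S \<in> \<B>) \<longrightarrow> T + S \<in> \<B>"
proof -
  obtain T where T: "T \<in> \<B>" "\<And>a b. a \<in> \<B> \<Longrightarrow> b \<in> \<B> \<Longrightarrow> \<iota> b divides\<^bsub>F\<^esub> \<iota> a \<Longrightarrow> \<exists>c\<in>\<B>. T + a = b + c"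
    using conductor by blast
  have "T + S \<in> \<B>" if S: "b \<in> \<B>" "S + b \<in> \<B>" "c \<in> \<B>" "\<And>n. c + repeat_mset n S \<in> \<B>" for S b c
  proof -
    have "\<iota> b divides\<^bsub>F\<^esub> \<iota> (S + b)"
    proof (rule F.divides_of_powers)
      fix n :: nat
      have "\<iota> c \<cdot> \<iota> (S + b) [^]\<^bsub>F\<^esub> n = \<iota> (c + repeat_mset n (S + b))"
        using S by (simp only: \<iota>_add \<iota>_repeat repeat_product_one)
      also have "c + repeat_mset n (S + b) = repeat_mset n b + (c + repeat_mset n S)"
        by (simp add: ac_simps)
      also have "\<iota> \<dots> = \<iota> b [^]\<^bsub>F\<^esub> n \<cdot> \<iota> (c + repeat_mset n S)"
        using S by (simp only: \<iota>_add \<iota>_repeat repeat_product_one)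
      finally show "\<iota> b [^]\<^bsub>F\<^esub> n divides\<^bsub>F\<^esub> \<iota> c \<cdot> \<iota> (S + b) [^]\<^bsub>F\<^esub> n"
        using \<iota>_closed[OF S(4)] unfolding factor_def by blast
    qed (use S \<iota>_closed in blast)+
    then obtain d where d: "d \<in> \<B>" "T + (S + b) = b + d" using T(2) S by blast
    then have "T + S = d" by (metis add.assoc add.commute add_right_imp_eq)
    then show ?thesis using d by simp
  qed
  then show ?thesis using T(1) by blast
qed

lemma finite_subproducts:
  "finite (list_prod ` {us. set us \<subseteq> set_mset T \<and> length us \<le> size T})"
  using finite_lists_length_le[of "set_mset T" "size T"] by simp

text \<open>For a conjugate \<open>x\<close> of \<open>g\<close> the sequence
  \<open>T + {#g, inv x#}\<close> has product one. Rotating \<open>x^-1\<close> to the end expresses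
  \<open>x\<close> as \<open>p g q\<close>, where \<open>p\<close> and \<open>q\<close> are products
  of short words in the letters of \<open>T\<close>, independently of \<open>g\<close>.\<close>

lemma bounded_conjugacy_classes:
  "\<exists>M. \<forall>g\<in>carrier G. finite {u \<otimes> g \<otimes> inv u | u. u \<in> carrier G} \<and>
     card {u \<otimes> g \<otimes> inv u | u. u \<in> carrier G} \<le> M"
proof -
  obtain T where T: "T \<in> \<B>" "\<And>S b c. b \<in> \<B> \<Longrightarrow> c \<in> \<B> \<Longrightarrow> S + b \<in> \<B> \<Longrightarrow>
      (\<And>n. c + repeat_mset n S \<in> \<B>) \<Longrightarrow> T + S \<in> \<B>"
    using almost_integral by blast
  define P where "P = list_prod ` {us. set us \<subseteq> set_mset T \<and> length us \<le> size T}"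
  have fin: "finite P" unfolding P_def by (rule finite_subproducts)
  have classes: "{u \<otimes> g \<otimes> inv u | u. u \<in> carrier G} \<subseteq> (\<lambda>(p, q). p \<otimes> g \<otimes> q) ` (P \<times> P)"
    if g: "g \<in> carrier G" for g
  proof
    fix x assume "x \<in> {u \<otimes> g \<otimes> inv u | u. u \<in> carrier G}"
    then obtain h where h: "h \<in> carrier G" "x = h \<otimes> g \<otimes> inv h" by blast
    have xc: "x \<in> carrier G" using g h by simp
    have "T + {#g, inv x#} \<in> \<B>"
    proof (rule T(2)[of "{#h, inv h#}" "{#h, inv h#}"])
      show "{#h, inv h#} + repeat_mset n {#g, inv x#} \<in> \<B>" for n
        unfolding h(2) by (rule conj_pair_product_one[OF g h(1)])
      from this[of 1] show "{#g, inv x#} + {#h, inv h#} \<in> \<B>" by (simp add: add_mset_commute)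
    qed (use h in simp_all)
    then have "add_mset (inv x) (add_mset g T) \<in> \<B>" by (simp add: add_mset_commute)
    then obtain hs where hs: "mset hs = add_mset g T" "set hs \<subseteq> carrier G" "list_prod hs \<otimes> inv x = \<one>"
      by (auto simp: add_mset_product_one_iff)
    then have "list_prod hs = x"
      using inv_equality[OF hs(3)] xc by auto
    obtain ys zs where yz: "hs = ys @ g # zs" "mset (zs @ ys) = T"
      using hs(1) by (rule mset_eq_add_mset)
    have "x = list_prod ys \<otimes> g \<otimes> list_prod zs"
      using \<open>list_prod hs = x\<close> yz(1) hs(2) g by (simp add: m_assoc)
    moreover have "set (zs @ ys) = set_mset T" "length (zs @ ys) = size T"
      using yz(2) by (metis set_mset_mset, metis size_mset)
    then have "list_prod ys \<in> P" "list_prod zs \<in> P" unfolding P_def by auto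
    ultimately show "x \<in> (\<lambda>(p, q). p \<otimes> g \<otimes> q) ` (P \<times> P)" by force
  qed
  have "finite {u \<otimes> g \<otimes> inv u | u. u \<in> carrier G} \<and>
      card {u \<otimes> g \<otimes> inv u | u. u \<in> carrier G} \<le> card (P \<times> P)" if "g \<in> carrier G" for g
    using classes[OF that] fin
    by (meson card_image_le card_mono finite_SigmaI finite_imageI finite_subset order_trans)
  then show ?thesis by blast
qed

text \<open>Among the conjugates of \<open>g\<close> by \<open>h^0, ..., h^M\<close> two agree, so
  \<open>g\<close> commutes with \<open>h^d\<close> for some positive \<open>d \<le> M\<close>,
  which divides \<open>M!\<close>.\<close>

lemma exponent_mod_center:
  "\<exists>N>0. \<forall>g\<in>carrier G. \<forall>h\<in>carrier G. commutes g (h [^] (N::nat))"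
proof -
  obtain M where M: "\<And>g. g \<in> carrier G \<Longrightarrow> finite {u \<otimes> g \<otimes> inv u | u. u \<in> carrier G} \<and>
     card {u \<otimes> g \<otimes> inv u | u. u \<in> carrier G} \<le> M"
    using bounded_conjugacy_classes by blast
  have "commutes g (h [^] (fact M :: nat))" if gh: "g \<in> carrier G" "h \<in> carrier G" for g h
  proof -
    let ?c = "\<lambda>i::nat. h [^] i \<otimes> g \<otimes> inv (h [^] i)"
    have "?c ` {..M} \<subseteq> {u \<otimes> g \<otimes> inv u | u. u \<in> carrier G}" using gh by auto
    then have "card (?c ` {..M}) \<le> M" using M[OF gh(1)] by (meson card_mono order_trans)
    then have "\<not> inj_on ?c {..M}" using card_image[of ?c "{..M}"] by auto
    then obtain i j where ij: "i \<le> M" "j \<le> M" "i < j" "?c i = ?c j"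
      unfolding inj_on_def by (metis atMost_iff nat_neq_iff)
    define d where "d = j - i"
    have d: "0 < d" "d \<le> M" using ij by (auto simp: d_def)
    have hj: "h [^] j = h [^] i \<otimes> h [^] d" using ij gh by (simp add: d_def nat_pow_mult)
    have "inv (h [^] i) \<otimes> ?c i \<otimes> h [^] i = inv (h [^] i) \<otimes> ?c j \<otimes> h [^] i" by (simp only: ij(4))
    then have "g = h [^] d \<otimes> g \<otimes> inv (h [^] d)" using gh by (simp add: hj word_simps)
    then have "g \<otimes> h [^] d = h [^] d \<otimes> g \<otimes> inv (h [^] d) \<otimes> h [^] d" by simp
    then have comm: "commutes g (h [^] d)" using gh by (simp add: commutes_def m_assoc)
    have "d dvd fact M" using d by (simp add: dvd_fact)
    then obtain e where e: "fact M = d * e" by (elim dvdE)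
    have "commutes g ((h [^] d) [^] e)"
    proof (induction e)
      case (Suc e)
      then show ?case using commutes_mult[OF Suc comm] by simp
    qed (use gh in \<open>simp add: commutes_def\<close>)
    then show ?thesis using gh e by (simp add: nat_pow_pow)
  qed
  then show ?thesis by (intro exI[of _ "fact M"]) simp
qed

lemma commutator_order:
  assumes "g \<in> carrier G" "h \<in> carrier G"
  shows "\<exists>n>0. commutator g h [^] (n::nat) = \<one>"
proof -
  obtain N :: nat where "0 < N" "\<And>x y. x \<in> carrier G \<Longrightarrow> y \<in> carrier G \<Longrightarrow> commutes x (y [^] N)"
    using exponent_mod_center by blast
  then show ?thesis
    using bounded_conjugacy_classes assms by (intro commutator_finite_order[of g h N]) auto
qed

text \<open>A commutator \<open>k\<close> of order dividing \<open>m\<close> is almost integral as a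
  letter, with \<open>m\<close> copies of \<open>?b\<close> as multiplier. Hence
  \<open>T + {#k#}\<close> has product one, and \<open>k^-1\<close> is one of the finitely many
  products of words in the letters of \<open>T\<close>.\<close>

lemma finite_derived_subgroup: "finite (derived G (carrier G))"
proof (rule finite_derived[OF _ commutator_order])
  obtain T where T: "T \<in> \<B>" "\<And>S b c. b \<in> \<B> \<Longrightarrow> c \<in> \<B> \<Longrightarrow> S + b \<in> \<B> \<Longrightarrow>
      (\<And>n. c + repeat_mset n S \<in> \<B>) \<Longrightarrow> T + S \<in> \<B>"
    using almost_integral by blast
  let ?P = "list_prod ` {us. set us \<subseteq> set_mset T \<and> length us \<le> size T}"
  have "derived_set G (carrier G) \<subseteq> m_inv G ` ?P"
  proof
    fix k assume "k \<in> derived_set G (carrier G)"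
    then obtain g h where gh: "g \<in> carrier G" "h \<in> carrier G" "k = commutator g h"
      by (auto simp: commutator_def)
    have k: "k \<in> carrier G" using gh by simp
    obtain m :: nat where m: "0 < m" "k [^] m = \<one>" using commutator_order[OF gh(1,2)] gh(3) by blast
    let ?b = "{#h, g, inv h, inv g#}"
    have b: "?b \<in> \<B>" "{#k#} + ?b \<in> \<B>"
      using four_product_one[OF gh(2,1)] by (simp_all add: gh(3) add_mset_commute)
    have mk: "repeat_mset m {#k#} \<in> \<B>"
      using products_replicate[OF k, of m] m k by (simp add: in_product_one_iff)
    have "T + {#k#} \<in> \<B>"
    proof (rule T(2)[OF b(1) _ b(2)])
      show "repeat_mset m ?b \<in> \<B>" by (rule repeat_product_one[OF b(1)])
      fix n
      define q r where "q = n div m" and "r = n mod m"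
      have n: "n = q * m + r" "r \<le> m" using m(1) by (simp_all add: q_def r_def less_imp_le)
      have "repeat_mset m ?b + repeat_mset n {#k#} =
          repeat_mset q (repeat_mset m {#k#}) + repeat_mset r ({#k#} + ?b) + repeat_mset (m - r) ?b"
        unfolding n(1) using n(2) by (rule repeat_mset_div_mod)
      also have "\<dots> \<in> \<B>" by (intro add_product_one repeat_product_one[OF mk] repeat_product_one[OF b(2)] repeat_product_one[OF b(1)])
      finally show "repeat_mset m ?b + repeat_mset n {#k#} \<in> \<B>" .
    qed
    then have "add_mset k T \<in> \<B>" by simp
    then obtain us where us: "mset us = T" "set us \<subseteq> carrier G" "list_prod us \<otimes> k = \<one>"
      by (auto simp: add_mset_product_one_iff)
    have "inv k = list_prod us" using inv_equality[OF us(3)] us(2) k by auto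
    then have "k = inv (list_prod us)" using k by (metis inv_inv)
    moreover have "set us \<subseteq> set_mset T" "length us \<le> size T" using us(1) by auto
    ultimately show "k \<in> m_inv G ` ?P" by blast
  qed
  then show "finite (derived_set G (carrier G))"
    using finite_subproducts[of T] by (meson finite_imageI finite_subset)
qed

end

section \<open>Letters inside the factorial monoid and finiteness of the group\<close>

context C_embedding
begin

lemma pow_nonunit:
  assumes "y \<in> carrier F" "y \<notin> Units F" "0 < (n::nat)"
  shows "y [^]\<^bsub>F\<^esub> n \<notin> Units F"
proof -
  obtain k where "n = Suc k" using assms(3) gr0_implies_Suc by blast
  then have "y [^]\<^bsub>F\<^esub> n = y \<cdot> y [^]\<^bsub>F\<^esub> k" using assms(1) F.nat_pow_Suc2 by simp
  then show ?thesis
    using F.unit_factor[of y "y [^]\<^bsub>F\<^esub> k"] assms by auto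
qed

text \<open>
  Two powers of a divisor \<open>y\<close> of some \<open>\<iota> S\<close> are equivalent, so a power of \<open>y\<close> is a quotient of
  product-one sequences, and by \<open>divides_imp_subset\<close> that quotient is a sequence \<open>R\<close>.
\<close>

lemma power_of_divisor:
  assumes y: "y \<in> carrier F" "y \<notin> Units F" and S: "S \<in> \<B>" "y divides\<^bsub>F\<^esub> \<iota> S"
  shows "\<exists>m>0. \<exists>R b. R \<noteq> {#} \<and> b \<in> \<B> \<and> R + b \<in> \<B> \<and> \<iota> (R + b) = y [^]\<^bsub>F\<^esub> m \<cdot> \<iota> b \<and>
    (\<forall>S'\<in>\<B>. y divides\<^bsub>F\<^esub> \<iota> S' \<longrightarrow> R \<subseteq># repeat_mset m S')"
proof -
  \<comment> \<open>The exponents start at one, so the powers are non-units and their classes belong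
    to the finite class set.\<close>
  have "finite ((\<lambda>n. cls (y [^]\<^bsub>F\<^esub> Suc n)) ` UNIV)"
    by (rule finite_subset[OF image_subsetI finite_classes],
        rule cls_in[OF F.nat_pow_closed[OF y(1)] pow_nonunit[OF y zero_less_Suc]])
  then have "\<not> inj (\<lambda>n. cls (y [^]\<^bsub>F\<^esub> Suc n))" using finite_imageD infinite_UNIV_nat by blast
  then obtain i0 j0 where ij0: "i0 < j0" "cls (y [^]\<^bsub>F\<^esub> Suc i0) = cls (y [^]\<^bsub>F\<^esub> Suc j0)"
    unfolding inj_def by (metis nat_neq_iff)
  define i j where "i = Suc i0" and "j = Suc j0"
  have ij: "0 < i" "i < j" "cls (y [^]\<^bsub>F\<^esub> i) = cls (y [^]\<^bsub>F\<^esub> j)"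
    using ij0 by (simp_all only: i_def j_def zero_less_Suc Suc_less_eq)
  define m where "m = j - i"
  have m: "0 < m" "j = m + i" using ij by (simp_all add: m_def)
  obtain z where z: "z \<in> carrier F" "\<iota> S = y \<cdot> z" using S(2) by (auto simp: factor_def)
  define b where "b = repeat_mset i S"
  have b: "b \<in> \<B>" unfolding b_def using S(1) by (rule repeat_product_one)
  have \<iota>b: "\<iota> b = y [^]\<^bsub>F\<^esub> i \<cdot> z [^]\<^bsub>F\<^esub> i"
    using S y z by (simp add: b_def F.nat_pow_distrib)
  have "equivalent (y [^]\<^bsub>F\<^esub> i) (y [^]\<^bsub>F\<^esub> j)" using ij(3) y by (intro cls_eqD) auto
  moreover have "y [^]\<^bsub>F\<^esub> i \<cdot> z [^]\<^bsub>F\<^esub> i \<in> \<iota> ` \<B>" using \<iota>b b by (metis imageI)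
  ultimately have "y [^]\<^bsub>F\<^esub> j \<cdot> z [^]\<^bsub>F\<^esub> i \<in> \<iota> ` \<B>"
    using z by (simp add: submonoid_equiv_def)
  then obtain a where a: "a \<in> \<B>" "\<iota> a = y [^]\<^bsub>F\<^esub> j \<cdot> z [^]\<^bsub>F\<^esub> i" by auto
  have "y [^]\<^bsub>F\<^esub> j = y [^]\<^bsub>F\<^esub> m \<cdot> y [^]\<^bsub>F\<^esub> i" using y m by (simp add: F.nat_pow_mult)
  then have \<iota>a: "\<iota> a = y [^]\<^bsub>F\<^esub> m \<cdot> \<iota> b" using a(2) \<iota>b y z by (simp add: F.m_assoc)
  then have "\<iota> b divides\<^bsub>F\<^esub> \<iota> a"
    unfolding factor_def using y b by (intro bexI[of _ "y [^]\<^bsub>F\<^esub> m"]) (simp_all add: F.m_comm)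
  then have "b \<subseteq># a" using divides_imp_subset a b by blast
  define R where "R = a - b"
  have aR: "a = R + b" using \<open>b \<subseteq># a\<close> by (simp add: R_def)
  have "R \<noteq> {#}"
  proof
    assume "R = {#}"
    then have "\<one>\<^bsub>F\<^esub> \<cdot> \<iota> b = y [^]\<^bsub>F\<^esub> m \<cdot> \<iota> b" using \<iota>a aR b by simp
    from F.r_cancel[OF this F.one_closed F.nat_pow_closed[OF y(1)] \<iota>_closed[OF b]]
    have "y [^]\<^bsub>F\<^esub> m = \<one>\<^bsub>F\<^esub>" by simp
    then show False using pow_nonunit[OF y m(1)] by simp
  qed
  moreover have "R \<subseteq># repeat_mset m S'" if S': "S' \<in> \<B>" "y divides\<^bsub>F\<^esub> \<iota> S'" for S'
  proof -
    obtain x where x: "x \<in> carrier F" "\<iota> S' = y \<cdot> x" using S'(2) by (auto simp: factor_def)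
    \<comment> \<open>With \<open>\<iota> S' = y x\<close>, the image of \<open>m\<close> copies of
      \<open>S'\<close> together with \<open>b\<close> is \<open>\<iota> a\<close> times
      \<open>x^m\<close>. Thus \<open>R + b\<close> is contained in that sequence, and
      \<open>b\<close> cancels.\<close>
    have "\<iota> (repeat_mset m S' + b) = \<iota> (repeat_mset m S') \<cdot> \<iota> b"
      using S'(1) b repeat_product_one by (intro \<iota>_add)
    also have "\<dots> = y [^]\<^bsub>F\<^esub> m \<cdot> x [^]\<^bsub>F\<^esub> m \<cdot> \<iota> b"
      using S'(1) x y by (simp add: F.nat_pow_distrib)
    also have "\<dots> = \<iota> a \<cdot> x [^]\<^bsub>F\<^esub> m"
      using x y b by (simp add: \<iota>a F.m_ac)
    finally have "\<iota> a divides\<^bsub>F\<^esub> \<iota> (repeat_mset m S' + b)"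
      unfolding factor_def using x by blast
    then have "a \<subseteq># repeat_mset m S' + b"
      using a(1) b S'(1) by (intro divides_imp_subset) auto
    then show ?thesis by (simp add: aR)
  qed
  ultimately show ?thesis using m(1) b a(1) \<iota>a aR by blast
qed

lemma finite_order_of_power_in_derived:
  assumes "x \<in> carrier G" "x [^] j \<in> derived G (carrier G)" "0 < (j::nat)"
  shows "\<exists>n>0. x [^] (n::nat) = \<one>"
proof -
  let ?D = "derived G (carrier G)"
  interpret D: subgroup ?D G by (rule derived_is_subgroup) simp
  have "(x [^] j) [^] n \<in> ?D" for n :: nat
    using assms(2) by (induction n) (simp_all add: D.m_closed)
  then have "finite (range (\<lambda>n::nat. (x [^] j) [^] n))"
    using finite_derived_subgroup by (meson finite_subset image_subsetI)
  then obtain n :: nat where "0 < n" "(x [^] j) [^] n = \<one>"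
    using finite_order_of_finite_powers[of "x [^] j"] assms(1) by blast
  then show ?thesis using assms(1,3) by (intro exI[of _ "j * n"]) (simp add: nat_pow_pow)
qed

lemma products_in_derived:
  assumes "R + b \<in> \<B>" "b \<in> \<B>" "p \<in> products G R"
  shows "p \<in> derived G (carrier G)"
proof -
  have c: "set_mset R \<subseteq> carrier G" "set_mset b \<subseteq> carrier G" "set_mset (R + b) \<subseteq> carrier G"
    using product_one_carrier[OF assms(1)] by auto
  then have "p \<otimes> \<one> \<in> products G (R + b)"
    using assms by (intro products_add) (simp_all add: in_product_one_iff)
  moreover have "p \<in> carrier G" using assms(3) c(1) by (rule products_closed)
  ultimately show ?thesis
    using products_quotient_derived[of "p \<otimes> \<one>" "R + b" \<one>] assms(1) c by (simp add: in_product_one_iff)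
qed

text \<open>For \<open>g\<close> of infinite order and \<open>h = g^-2\<close>, the sequences
  \<open>g, g, h\<close> and \<open>g^-1, g^-1, h^-1\<close> combine to pairs of inverse letters. A
  prime divisor of the first divides the image of one such pair, so its associated sequence
  \<open>R\<close> is a power of a single letter. The product of \<open>R\<close> lies in the finite
  group \<open>G'\<close>, which gives that letter finite order.\<close>

lemma torsion:
  assumes g: "g \<in> carrier G"
  shows "\<exists>n>0. g [^] (n::nat) = \<one>"
proof (rule ccontr)
  assume "\<not> ?thesis"
  then have inf: "g [^] (n::nat) \<noteq> \<one>" if "0 < n" for n using that by blast
  define h where "h = inv (g \<otimes> g)"
  have h: "h \<in> carrier G" using g by (simp add: h_def)
  have ne: "inv g \<noteq> g" "inv g \<noteq> h" "h \<noteq> g" "inv h \<noteq> g" "inv h \<noteq> h"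
  proof -
    show "inv g \<noteq> g" using inf[of 2] g by (auto simp: numeral_eq_Suc dest: inv_solve_left)
        (metis r_inv)
    have "g \<otimes> g \<otimes> g \<noteq> \<one>" "g \<otimes> g \<otimes> g \<otimes> g \<noteq> \<one>" "g \<noteq> \<one>"
      using inf[of 3] inf[of 4] inf[of 1] g by (simp_all add: numeral_eq_Suc)
    then show "inv g \<noteq> h" "h \<noteq> g" "inv h \<noteq> g" "inv h \<noteq> h"
      using g by (auto simp: h_def m_assoc) (metis inv_closed inv_inv inv_mult_group l_inv m_assoc m_closed r_inv r_one l_one)+
  qed
  let ?S = "{#g, g, h#}" and ?S' = "{#inv g, inv g, inv h#}" and ?A = "{#g, inv g#}" and ?A' = "{#h, inv h#}"
  have S: "?S \<in> \<B>" "?S' \<in> \<B>"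
    using g product_oneI[of "[g, g, h]" ?S] product_oneI[of "[inv g, inv g, inv h]" ?S']
    by (simp_all add: h_def word_simps)
  have A: "?A \<in> \<B>" "?A' \<in> \<B>" using g h by simp_all
  have "\<iota> ?S \<notin> Units F" using \<iota>_unit[OF S(1)] by auto
  then obtain q where q: "q \<in> carrier F" "prime F q" "q divides\<^bsub>F\<^esub> \<iota> ?S"
    using F.exists_prime_divisor \<iota>_closed[OF S(1)] by blast
  then have "q \<notin> Units F" by (simp add: prime_def)
  then obtain m R b where R: "R \<noteq> {#}" "b \<in> \<B>" "R + b \<in> \<B>" "\<And>S'. S' \<in> \<B> \<Longrightarrow> q divides\<^bsub>F\<^esub> \<iota> S' \<Longrightarrow> R \<subseteq># repeat_mset m S'"
    using power_of_divisor[OF q(1) _ S(1) q(3)] by blast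
  have RS: "R \<subseteq># repeat_mset m ?S" using R(4)[OF S(1) q(3)] .
  have "\<iota> ?S divides\<^bsub>F\<^esub> \<iota> (?S + ?S')"
    using S by (simp only: \<iota>_add) (auto simp: factor_def)
  then have "q divides\<^bsub>F\<^esub> \<iota> (?S + ?S')"
    using F.divides_trans[OF q(3)] q(1) by blast
  also have "?S + ?S' = ?A + ?A + ?A'" by (simp add: add_mset_commute)
  also have "\<iota> (?A + ?A + ?A') = \<iota> ?A \<cdot> \<iota> ?A \<cdot> \<iota> ?A'"
    using A by (simp only: \<iota>_add add_product_one)
  finally have "q divides\<^bsub>F\<^esub> \<iota> ?A \<or> q divides\<^bsub>F\<^esub> \<iota> ?A'"
    using F.prime_divides[OF _ _ q(2)] \<iota>_closed[OF A(1)] \<iota>_closed[OF A(2)] q(1) by (meson F.m_closed)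
  then have sub: "R \<subseteq># repeat_mset m ?A \<or> R \<subseteq># repeat_mset m ?A'"
    using R(4) A by blast
  \<comment> \<open>The support of \<open>R\<close> lies in \<open>{g, h}\<close> and in one of the
    inverse pairs; by \<open>ne\<close> these meet in one letter.\<close>
  obtain x where x: "x \<in> {g, h}" "set_mset R \<subseteq> {x}"
  proof -
    have "set_mset R \<subseteq> {g, h}"
      using set_mset_mono[OF RS] set_repeat_mset_subset[of m ?S] by auto
    moreover have "set_mset R \<subseteq> {g, inv g} \<or> set_mset R \<subseteq> {h, inv h}"
      using sub set_mset_mono[of R] set_repeat_mset_subset[of m ?A] set_repeat_mset_subset[of m ?A']
      by (metis (no_types, lifting) set_mset_add_mset_insert set_mset_empty order_trans)
    ultimately have "set_mset R \<subseteq> {g} \<or> set_mset R \<subseteq> {h}" using ne by auto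
    then show thesis using that by blast
  qed
  have xc: "x \<in> carrier G" using x g h by auto
  define j where "j = size R"
  have Rj: "R = replicate_mset j x"
    using x(2) by (auto simp: j_def intro!: set_mset_subset_singletonD)
  have "0 < j" using R(1) by (simp add: j_def nonempty_has_size)
  have "x [^] j \<in> derived G (carrier G)"
    using products_in_derived[OF R(3,2)] products_replicate[OF xc, of j] Rj by simp
  then obtain n :: nat where n: "0 < n" "x [^] n = \<one>"
    using finite_order_of_power_in_derived[OF xc _ \<open>0 < j\<close>] by blast
  show False
  proof (cases "x = g")
    case True
    then show False using inf n by blast
  next
    case False
    then have "h [^] n = \<one>" using x n by simp
    then have "inv ((g \<otimes> g) [^] n) = \<one>" using g by (simp add: h_def nat_pow_inv)
    then have "(g \<otimes> g) [^] n = \<one>" using g by simp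
    moreover have "(g \<otimes> g) [^] n = g [^] (2 * n)" using g nat_pow_pow[of g 2 n] by (simp add: numeral_2_eq_2)
    ultimately show False using inf[of "2 * n"] n(1) by simp
  qed
qed

text \<open>The element \<open>p\<close> plays the role of the letter \<open>g\<close> inside the factorial monoid.\<close>

definition represents :: "'a \<Rightarrow> 'f \<Rightarrow> nat \<Rightarrow> nat \<Rightarrow> 'a multiset \<Rightarrow> bool" where
  "represents g p m r b \<longleftrightarrow> p \<in> carrier F \<and> p \<notin> Units F \<and> 0 < m \<and> 0 < r \<and> b \<in> \<B> \<and>
    replicate_mset r g + b \<in> \<B> \<and> \<iota> (replicate_mset r g + b) = p [^]\<^bsub>F\<^esub> m \<cdot> \<iota> b \<and>
    (\<forall>S\<in>\<B>. g \<in># S \<longrightarrow> p divides\<^bsub>F\<^esub> \<iota> S)"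

text \<open>If \<open>g^n = 1\<close>, any prime divisor \<open>p\<close> of the image of
  \<open>n\<close> copies of \<open>g\<close> will do. When \<open>g\<close> occurs in
  \<open>S'\<close>, the \<open>n\<close>-th power of \<open>S'\<close> splits off these copies with
  a product-one remainder, so \<open>p\<close> divides a power of \<open>\<iota> S'\<close> and
  hence \<open>\<iota> S'\<close>.\<close>

lemma letter_divisor:
  assumes g: "g \<in> carrier G"
  shows "\<exists>p m r b. represents g p m r b"
proof -
  obtain n :: nat where n: "0 < n" "g [^] n = \<one>" using torsion[OF g] by blast
  let ?S = "replicate_mset n g"
  have S: "?S \<in> \<B>" using products_replicate[OF g, of n] n g by (auto simp: in_product_one_iff)
  have "\<iota> ?S \<notin> Units F"
  proof
    assume "\<iota> ?S \<in> Units F"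
    then have "?S = {#}" by (rule \<iota>_unit[OF S])
    then show False using n(1) by simp
  qed
  then obtain p where p: "p \<in> carrier F" "prime F p" "p divides\<^bsub>F\<^esub> \<iota> ?S"
    using F.exists_prime_divisor \<iota>_closed[OF S] by blast
  then have nu: "p \<notin> Units F" by (simp add: prime_def)
  then obtain m R b where m: "0 < m" and R: "R \<noteq> {#}" "b \<in> \<B>" "R + b \<in> \<B>"
    "\<iota> (R + b) = p [^]\<^bsub>F\<^esub> m \<cdot> \<iota> b" "R \<subseteq># repeat_mset m ?S"
    using power_of_divisor[OF p(1) _ S p(3)] S p(3) by blast
  have "set_mset R \<subseteq> {g}"
    using set_mset_mono[OF R(5)] set_repeat_mset_subset[of m ?S] n(1) by auto
  then have Rr: "R = replicate_mset (size R) g" by (rule set_mset_subset_singletonD)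
  have "p divides\<^bsub>F\<^esub> \<iota> S'" if S': "S' \<in> \<B>" "g \<in># S'" for S'
  proof -
    define U where "U = S' - {#g#}"
    have SU: "S' = add_mset g U" using S'(2) by (simp add: U_def)
    have "set_mset U \<subseteq> carrier G" using product_one_carrier[OF S'(1)] SU by auto
    then have "inv g [^] n \<in> products G (repeat_mset n U)" "set_mset (repeat_mset n U) \<subseteq> carrier G"
      using products_repeat[OF inv_in_products, of g U n] S'(1) SU set_repeat_mset_subset[of n U] by auto
    then have U: "repeat_mset n U \<in> \<B>" using n(2) g by (simp add: in_product_one_iff nat_pow_inv)
    have "repeat_mset n S' = ?S + repeat_mset n U" by (simp add: SU multiset_eq_iff)
    then have "\<iota> S' [^]\<^bsub>F\<^esub> n = \<iota> ?S \<cdot> \<iota> (repeat_mset n U)"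
      using S'(1) S U by (metis \<iota>_add \<iota>_repeat)
    then have "p divides\<^bsub>F\<^esub> \<iota> S' [^]\<^bsub>F\<^esub> n"
      using F.divides_prod_r[OF p(3) p(1) \<iota>_closed[OF U]] S U p(1) by simp
    then show ?thesis using F.prime_divides_pow[OF p(2,1)] S'(1) by simp
  qed
  moreover have "0 < size R" using R(1) by (simp add: nonempty_has_size)
  ultimately show ?thesis unfolding represents_def using p(1) nu m R(2,3,4) Rr by metis
qed

lemma finite_carrier: "finite (carrier G)"
proof (rule ccontr)
  assume inf: "infinite (carrier G)"
  have "\<forall>g\<in>carrier G. \<exists>t. case t of (p, m, r, b) \<Rightarrow> represents g p m r b"
    using letter_divisor by (simp add: split_paired_Ex)
  from bchoice[OF this]
  obtain t where t: "\<forall>g\<in>carrier G. case t g of (p, m, r, b) \<Rightarrow> represents g p m r b" ..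
  define p where "p = (\<lambda>g. fst (t g))"
  define m where "m = (\<lambda>g. fst (snd (t g)))"
  define r where "r = (\<lambda>g. fst (snd (snd (t g))))"
  define b where "b = (\<lambda>g. snd (snd (snd (t g))))"
  have p: "p g \<in> carrier F" "p g \<notin> Units F" "0 < m g" "0 < r g" "b g \<in> \<B>" "replicate_mset (r g) g + b g \<in> \<B>"
    "\<iota> (replicate_mset (r g) g + b g) = p g [^]\<^bsub>F\<^esub> m g \<cdot> \<iota> (b g)"
    "\<And>S. S \<in> \<B> \<Longrightarrow> g \<in># S \<Longrightarrow> p g divides\<^bsub>F\<^esub> \<iota> S" if "g \<in> carrier G" for g
    using bspec[OF t that] by (auto simp: represents_def p_def m_def r_def b_def split: prod.splits)
  \<comment> \<open>Replacing the divisor \<open>p g\<close> of \<open>\<iota> S\<close> by the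
    equivalent \<open>p h\<close> leads to a product-one sequence \<open>S'\<close>; the equation
    records this exchange with all \<open>p\<close> eliminated.\<close>
  have exchange: "\<exists>S S'. S \<in> \<B> \<and> S' \<in> \<B> \<and> count S g = 1 \<and>
      repeat_mset (m h) (replicate_mset (r g) g) + repeat_mset (m g * m h) S' =
      repeat_mset (m g) (replicate_mset (r h) h) + repeat_mset (m g * m h) S"
    if gh: "g \<in> carrier G" "h \<in> carrier G" and eq: "cls (p g) = cls (p h)" for g h
  proof -
    \<comment> \<open>The two excluded values ensure that neither \<open>c\<close> nor
      \<open>c^-1 g^-1\<close> is \<open>g\<close>, so \<open>g\<close> occurs exactly once in
      \<open>S\<close>.\<close>
    obtain c where c: "c \<in> carrier G" "c \<noteq> g" "c \<noteq> inv (g \<otimes> g)"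
      using inf infinite_imp_nonempty[OF Diff_infinite_finite[of "{g, inv (g \<otimes> g)}", OF _ inf]] by auto
    define S where "S = {#g, c, inv c \<otimes> inv g#}"
    have S: "S \<in> \<B>" unfolding S_def
      by (rule product_oneI[of "[c, inv c \<otimes> inv g, g]"]) (use gh c in \<open>simp_all add: m_assoc\<close>)
    have "inv c \<otimes> inv g \<noteq> g"
    proof
      assume "inv c \<otimes> inv g = g"
      then have "c \<otimes> (inv c \<otimes> inv g) \<otimes> inv g = c \<otimes> g \<otimes> inv g" by simp
      then show False using c gh by (simp add: m_assoc inv_mult_group)
    qed
    then have Sg: "count S g = 1" using c(2) by (simp add: S_def)
    have "p g divides\<^bsub>F\<^esub> \<iota> S" using p(8)[OF gh(1) S] by (simp add: S_def)
    then obtain z where z: "z \<in> carrier F" "\<iota> S = p g \<cdot> z" by (auto simp: factor_def)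
    have "equivalent (p g) (p h)" using eq p(1)[OF gh(1)] by (rule cls_eqD)
    moreover have "p g \<cdot> z \<in> \<iota> ` \<B>" using z S by (metis imageI)
    ultimately have "p h \<cdot> z \<in> \<iota> ` \<B>" using z(1) by (simp add: submonoid_equiv_def)
    then obtain S' where S': "S' \<in> \<B>" "\<iota> S' = p h \<cdot> z" by auto
    let ?Rg = "replicate_mset (r g) g" and ?Rh = "replicate_mset (r h) h"
    have pg: "p g \<in> carrier F" "p h \<in> carrier F" using p(1) gh by auto
    have bg: "b g \<in> \<B>" "b h \<in> \<B>" using p(5) gh by auto
    have pb: "?Rg + b g \<in> \<B>" "?Rh + b h \<in> \<B>" using p(6) gh by auto
    \<comment> \<open>The multiplicities are chosen so that \<open>p g\<close>, \<open>p h\<close>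
      and \<open>z\<close> all occur to the power \<open>m g * m h\<close> in both images;
      injectivity then gives an equation of sequences.\<close>
    let ?L = "repeat_mset (m h) (?Rg + b g) + repeat_mset (m g) (b h) + repeat_mset (m g * m h) S'"
    let ?R = "repeat_mset (m g) (?Rh + b h) + repeat_mset (m h) (b g) + repeat_mset (m g * m h) S"
    have in_B: "repeat_mset (m h) (?Rg + b g) \<in> \<B>" "repeat_mset (m g) (b h) \<in> \<B>" "repeat_mset (m g * m h) S' \<in> \<B>"
      "repeat_mset (m g) (?Rh + b h) \<in> \<B>" "repeat_mset (m h) (b g) \<in> \<B>" "repeat_mset (m g * m h) S \<in> \<B>"
      by (rule repeat_product_one, fact)+
    have "\<iota> ?L = (p g [^]\<^bsub>F\<^esub> m g \<cdot> \<iota> (b g)) [^]\<^bsub>F\<^esub> m h \<cdot> \<iota> (b h) [^]\<^bsub>F\<^esub> m g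
        \<cdot> (p h \<cdot> z) [^]\<^bsub>F\<^esub> (m g * m h)"
      using in_B bg pb S' p(7)[OF gh(1)] by (simp only: \<iota>_add \<iota>_repeat add_product_one)
    also have "\<dots> = (p h [^]\<^bsub>F\<^esub> m h \<cdot> \<iota> (b h)) [^]\<^bsub>F\<^esub> m g \<cdot> \<iota> (b g) [^]\<^bsub>F\<^esub> m h
        \<cdot> (p g \<cdot> z) [^]\<^bsub>F\<^esub> (m g * m h)"
      using pg bg z(1) by (simp add: F.nat_pow_distrib F.nat_pow_pow F.m_ac mult.commute)
    also have "\<dots> = \<iota> ?R"
      using in_B bg pb S z(2) p(7)[OF gh(2)] by (simp only: \<iota>_add \<iota>_repeat add_product_one)
    finally have "?L = ?R" using in_B by (intro \<iota>_eqD add_product_one)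
    then have "repeat_mset (m h) ?Rg + repeat_mset (m g * m h) S' =
        repeat_mset (m g) ?Rh + repeat_mset (m g * m h) S"
      by (simp add: ac_simps)
    then show ?thesis using S S'(1) Sg by blast
  qed
  \<comment> \<open>Compare multiplicities of \<open>g\<close>: since \<open>r g\<close> is positive
    and \<open>g\<close> occurs once in \<open>S\<close>, it cannot occur in
    \<open>S'\<close>.\<close>
  have rm: "r g = m g" if gh: "g \<in> carrier G" "h \<in> carrier G" "cls (p g) = cls (p h)" "g \<noteq> h" for g h
  proof -
    obtain S S' where S: "count S g = 1" and
      eq: "repeat_mset (m h) (replicate_mset (r g) g) + repeat_mset (m g * m h) S' =
      repeat_mset (m g) (replicate_mset (r h) h) + repeat_mset (m g * m h) S"
      using exchange[OF gh(1-3)] by blast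
    have "m h * r g + m g * m h * count S' g = m g * m h"
      using arg_cong[OF eq, of "\<lambda>A. count A g"] gh(4) S by simp
    moreover from this have "count S' g = 0"
      using p(3,4)[OF gh(1)] p(3)[OF gh(2)] by (cases "count S' g") auto
    ultimately have "m h * r g = m h * m g" by (simp only: mult_0_right add_0_right mult.commute)
    then show ?thesis using p(3)[OF gh(2)] by simp
  qed
  \<comment> \<open>With \<open>r = m\<close> the exchange reads \<open>g S' = h S\<close>, so
    \<open>S = g U\<close> and \<open>S' = h U\<close>. Then \<open>g^-1\<close> and
    \<open>h^-1\<close> are both products of \<open>U\<close> and agree modulo
    \<open>G'\<close>.\<close>
  have coset: "inv g \<otimes> h \<in> derived G (carrier G)"
    if gh: "g \<in> carrier G" "h \<in> carrier G" "cls (p g) = cls (p h)" for g h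
  proof (cases "g = h")
    case True
    then show ?thesis using gh subgroup.one_closed[OF derived_is_subgroup] by simp
  next
    case False
    have rg: "r g = m g" "r h = m h" using rm[OF gh False] rm[of h g] gh False by auto
    obtain S S' where S: "S \<in> \<B>" "S' \<in> \<B>" "count S g = 1" and
      eq: "repeat_mset (m h) (replicate_mset (r g) g) + repeat_mset (m g * m h) S' =
      repeat_mset (m g) (replicate_mset (r h) h) + repeat_mset (m g * m h) S"
      using exchange[OF gh] by blast
    have "repeat_mset (m g * m h) (add_mset g S') = repeat_mset (m g * m h) (add_mset h S)"
    proof (rule multiset_eqI)
      fix x
      show "count (repeat_mset (m g * m h) (add_mset g S')) x = count (repeat_mset (m g * m h) (add_mset h S)) x"
        using arg_cong[OF eq, of "\<lambda>A. count A x"]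
        by (cases "x = g"; cases "x = h") (simp_all add: rg algebra_simps)
    qed
    then have swap: "add_mset g S' = add_mset h S"
      using p(3)[OF gh(1)] p(3)[OF gh(2)] by (simp only: repeat_mset_cancel1) simp
    define U where "U = S - {#g#}"
    have "g \<in># S" using S(3) by (simp flip: count_greater_zero_iff)
    then have SU: "S = add_mset g U" by (simp add: U_def)
    then have S'U: "S' = add_mset h U" using swap by (simp add: add_mset_commute)
    have "set_mset U \<subseteq> carrier G" using product_one_carrier[OF S(1)] SU by auto
    then have "inv g \<otimes> inv (inv h) \<in> derived G (carrier G)"
      using inv_in_products gh S SU S'U by (intro products_quotient_derived) auto
    then show ?thesis using gh by simp
  qed
  \<comment> \<open>This map has finitely many values, and each fibre lies in a coset of the finite
    group \<open>G'\<close>.\<close>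
  let ?f = "\<lambda>g. cls (p g)"
  have "?f ` carrier G \<subseteq> reduced_class_set (\<iota> ` \<B>) F" using cls_in p(1,2) by blast
  then have "finite (?f ` carrier G)" using finite_classes by (rule finite_subset)
  moreover have "finite {h \<in> carrier G. ?f h = q}" if "q \<in> ?f ` carrier G" for q
  proof -
    obtain g where g: "g \<in> carrier G" "q = ?f g" using \<open>q \<in> ?f ` carrier G\<close> by blast
    have "{h \<in> carrier G. ?f h = q} \<subseteq> (\<lambda>x. g \<otimes> x) ` derived G (carrier G)"
    proof
      fix h assume h: "h \<in> {h \<in> carrier G. ?f h = q}"
      then have "inv g \<otimes> h \<in> derived G (carrier G)" using coset[OF g(1)] g(2) by simp
      moreover have "h = g \<otimes> (inv g \<otimes> h)" using g h by simp
      ultimately show "h \<in> (\<lambda>x. g \<otimes> x) ` derived G (carrier G)" by blast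
    qed
    then show ?thesis using finite_derived_subgroup by (meson finite_imageI finite_subset)
  qed
  ultimately have "finite (\<Union>q\<in>?f ` carrier G. {h \<in> carrier G. ?f h = q})" by (intro finite_UN_I)
  moreover have "carrier G \<subseteq> (\<Union>q\<in>?f ` carrier G. {h \<in> carrier G. ?f h = q})" by blast
  ultimately show False using inf finite_subset by blast
qed

end

lemma (in group) finite_of_C_monoid:
  assumes "C_monoid TYPE('f) \<H>"
  shows "finite (carrier G)"
proof -
  obtain F :: "'f monoid" and \<iota> where "factorial_monoid F" and
    \<iota>: "\<iota> \<in> hom \<H> F" "\<iota> \<one>\<^bsub>\<H>\<^esub> = \<one>\<^bsub>F\<^esub>"
      "inj_on \<iota> (carrier \<H>)"
      "\<iota> ` Units \<H> = \<iota> ` carrier \<H> \<inter> Units F"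
      "finite (reduced_class_set (\<iota> ` carrier \<H>) F)"
    using assms unfolding C_monoid_def by blast
  interpret F: factorial_monoid F by fact
  interpret C_embedding G F \<iota>
    by unfold_locales (use \<iota> in \<open>simp_all only: product_one_monoid_simps\<close>)
  show ?thesis by (rule finite_carrier)
qed

theorem theorem3p14:
  fixes G :: "('a, 'b) monoid_scheme"
  assumes "group G"
  shows
    "((comm_group G \<longleftrightarrow> krull_monoid (product_one_monoid G)) \<and>
      (comm_group G \<longleftrightarrow> completely_integrally_closed (product_one_monoid G)) \<and>
      (comm_group G \<longleftrightarrow> root_closed (product_one_monoid G)) \<and>
      (comm_group G \<longleftrightarrow> weakly_krull (product_one_monoid G)) \<and>
      (comm_group G \<longleftrightarrow> transfer_krull TYPE('a multiset) (product_one_monoid G)) \<and>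
      (transfer_krull TYPE('d) (product_one_monoid G) \<longrightarrow> comm_group G) \<and>
      (comm_group G \<longleftrightarrow> saturated_submonoid (product_one_sequences G) (free_abelian_monoid G)))
     \<and>
     (seminormal (product_one_monoid G) \<longleftrightarrow>
        finite (derived G (carrier G)) \<and> card (derived G (carrier G)) \<le> 2)
     \<and>
     ((C_monoid TYPE('a multiset) (product_one_monoid G) \<longleftrightarrow> G_monoid (product_one_monoid G)) \<and>
      (G_monoid (product_one_monoid G) \<longleftrightarrow> finite (carrier G)) \<and>
      (C_monoid TYPE('f) (product_one_monoid G) \<longrightarrow> finite (carrier G)))"
proof -
  interpret group G by fact
  have 1: "comm_group G \<longleftrightarrow> completely_integrally_closed (product_one_monoid G)"
    using comm_group.completely_integrally_closed_product_one
      comm_group_of_completely_integrally_closed by blast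
  then have 2: "comm_group G \<longleftrightarrow> krull_monoid (product_one_monoid G)"
    using comm_group.krull_monoid_product_one krull_monoid_def by blast
  have 3: "comm_group G \<longleftrightarrow> root_closed (product_one_monoid G)"
    using comm_group.root_closed_product_one comm_group_of_root_closed by blast
  have 4: "comm_group G \<longleftrightarrow> weakly_krull (product_one_monoid G)"
    using comm_group.weakly_krull_product_one comm_group_of_weakly_krull by blast
  have 5: "transfer_krull TYPE('d) (product_one_monoid G) \<longrightarrow> comm_group G"
    using comm_group_of_transfer_krull by blast
  have 6: "comm_group G \<longleftrightarrow> transfer_krull TYPE('a multiset) (product_one_monoid G)"
    using comm_group.transfer_krull_product_one comm_group_of_transfer_krull by blast
  have 7: "comm_group G \<longleftrightarrow> saturated_submonoid (product_one_sequences G) (free_abelian_monoid G)"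
    using comm_group.saturated_product_one comm_group_of_saturated by blast
  have 8: "C_monoid TYPE('f) (product_one_monoid G) \<longrightarrow> finite (carrier G)"
    using finite_of_C_monoid by blast
  have 9: "C_monoid TYPE('a multiset) (product_one_monoid G) \<longleftrightarrow> finite (carrier G)"
    using finite_of_C_monoid C_monoid_of_finite by blast
  show ?thesis
    using 1 2 3 4 5 6 7 8 9 by (simp only: G_monoid_iff_finite seminormal_iff_card_derived simp_thms)
qed

end
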